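(* Suppose $\Omega\subset\mathbb{P}(\mathbb{R}^d)$ is a quasi-homogeneous properly convex domain, equipped with its Hilbert metric $d_\Omega$. Then $(\Omega,d_\Omega)$ admits a coarse $r$-median structure for any integer $r\ge\mathrm{r}_{\rm PES}(\Omega)$.
   Context: Convex projective notions. A properly convex domain is a nonempty open set $\Omega\subset\mathbb{P}(\mathbb{R}^d)$ whose closure $\overline{\Omega}$ lies in some affine chart, in which $\Omega$ is a bounded convex set; its dimension is assumed to be at least one. $\partial\Omega=\overline\Omega\setminus\Omega$, $\mathrm{Aut}(\Omega)=\{g\in \mathrm{PGL}_d(\mathbb{R}): g\Omega=\Omega\}$, and $\Omega$ is quasi-homogeneous if there is a compact $K\subset\Omega$ with $\mathrm{Aut}(\Omega)\cdot K=\Omega$. Hilbert metric: for distinct $x,y\in\Omega$ let $x_\infty,y_\infty\in\partial\Omega$ be the endpoints of the intersection of the projective line through $x,y$ with $\overline\Omega$, ordered $x_\infty,x,y,y_\infty$; then $d_\Omega(x,y)=\frac12\log\frac{|y-x_\infty||x-y_\infty|}{|x-x_\infty||y-y_\infty|}$. A non-degenerate $k$-simplex ($k\ge1$) is the convex hull $S$ in $\overline\Omega$ of points $v_0,\dots,v_k\in\overline\Omega$ with $\dim\mathbb{P}(\mathrm{Span}\{v_0,\dots,v_k\})=k$; its facet $F^i(S)$ is the convex hull of all vertices but $v_i$. A $k$-dimensional PES in $\Omega$ is a non-degenerate $k$-simplex $S$ with vertices in $\partial\Omega$ such that $S\cap\Omega\ne\emptyset$ and all $F^i(S)\subset\partial\Omega$;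 $\mathrm{r}_{\rm PES}(\Omega)=\sup\{\dim S: S\text{ is a PES in }\Omega\}$. Coarse medians. Let $(X,d)$ be a metric space and $r\ge1$. $\mathcal{N}_s(A)=\{x: d(x,A)<s\}$ for $s>0$, $\mathcal{N}_0(A)=A$; $d^{\rm H}$ is Hausdorff distance; $\mathrm{diam}(\emptyset)=0$; $\mathcal{P}(X)$ is the power set. A coarse $r$-filling on $X$ is a pair $(F,\Lambda)$ with $F=\{F_i:X^{i+1}\to\mathcal{P}(X)\}_{i=0,\dots,r}$ and $\Lambda:[0,\infty)\to[0,\infty)$ non-decreasing such that for all $k\in\{0,\dots,r\}$ and $a_0,\dots,a_k\in X$: (F0) $d^{\rm H}(a_0,F_0(a_0))\le\Lambda(0)$; (F1) (for $k\ge1$) $F_{k-1}(a_0,\dots,\widehat{a_i},\dots,a_k)\subseteq\mathcal{N}_{\Lambda(0)}(F_k(a_0,\dots,a_k))$ for all $i$; (F2) $d^{\rm H}(F_k(a_0,\dots,a_k),F_k(a_{\sigma(0)},\dots,a_{\sigma(k)}))\le\Lambda(0)$ for every permutation $\sigma$; (F3) for $k\le r-1$, $F_{k+1}(a_0,\dots,a_k,a_k)\subseteq\mathcal{N}_{\Lambda(0)}(F_k(a_0,\dots,a_k))$; (F4) for $R\ge0$, if $x\in\mathcal{N}_R(F_k(a_0,\dots,a_k))$ then $F_k(a_0,\dots,a_{j-1},x,a_{j+1},\dots,a_k)\subseteq\mathcal{N}_{\Lambda(R)}(F_k(a_0,\dots,a_k))$ for all $j$. For $I=\{j_1<\dots<j_p\}$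 write $F_{|I|-1}(a_i:i\in I)=F_{p-1}(a_{j_1},\dots,a_{j_p})$. For $\delta,D\ge0$, $(a_0,\dots,a_{r+1})\in X^{r+2}$ is $(\delta,D)$-generic if for any non-empty proper subsets $I_1,\dots,I_q\subset\{0,\dots,r+1\}$ with $\bigcap_jI_j=\emptyset$ and $\mathrm{diam}\big(\bigcap_{j}\mathcal{N}_\delta(F_{|I_j|-1}(a_i:i\in I_j))\big)>D$ one has $|I_1|=\dots=|I_q|=r+1$. $(X,d)$ has (admits) a coarse $r$-median structure if there exist a coarse $r$-filling $(F,\Lambda)$, a constant $\delta_0\ge0$, a non-constant affine $\lambda:[\delta_0,\infty)\to[0,\infty)$ (i.e. $\lambda(\delta)=a(\delta-\delta_0)+b$, $a>0$, $b\ge0$), and $\Psi:[\delta_0,\infty)^2\to[0,\infty)$ non-decreasing in both entries such that: (CM1) for all $a_0,\dots,a_{r+1}\in X$, $\bigcap_{j=0}^{r+1}\mathcal{N}_{\lambda(\delta_0)}(F_r(a_0,\dots,\widehat{a_j},\dots,a_{r+1}))\ne\emptyset$; (CM2) for all $\delta,D\ge\delta_0$ and every $(\delta,D)$-generic $(a_0,\dots,a_{r+1})$, $\mathrm{diam}\big(\bigcap_{j=0}^{r+1}\mathcal{N}_{\lambda(\delta)}(F_r(a_0,\dots,\widehat{a_j},\dots,a_{r+1}))\big)\le\Psi(\delta,D)$. *)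

theory Defs
  imports "HOL-Analysis.Analysis" "HOL-Combinatorics.Permutations"
begin

section \<open>Real projective space\<close>

text \<open>For \<open>d = CARD('n)\<close>, the type \<open>'n rproj\<close> is \<open>\<bbbP>(\<real>\<^sup>d)\<close>: a point is a line through the origin.\<close>

typedef (overloaded) ('n::finite) rproj = "{L :: (real ^ 'n) set. subspace L \<and> dim L = 1}"
  morphisms line_of Abs_rproj
proof -
  obtain b :: "real ^ 'n" where "b \<in> Basis"
    using nonempty_Basis by blast
  then have "b \<noteq> 0"
    by auto
  then have "subspace (span {b}) \<and> dim (span {b}) = 1"
    by (simp add: dim_eq_card_independent)
  then show ?thesis
    by blast
qed

definition proj_pt :: "real ^ 'n \<Rightarrow> 'n::finite rproj"
  where "proj_pt v = Abs_rproj (span {v})"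

text \<open>The topology is the quotient topology of \<open>\<real>\<^sup>d - {0}\<close>.\<close>

instantiation rproj :: (finite) topological_space
begin

definition open_rproj :: "'a rproj set \<Rightarrow> bool"
  where "open_rproj U \<longleftrightarrow> open {v. v \<noteq> 0 \<and> proj_pt v \<in> U}"

instance
proof
  have "{v :: real ^ 'a. v \<noteq> 0 \<and> proj_pt v \<in> (UNIV :: 'a rproj set)} = - {0}"
    by auto
  then show "open (UNIV :: 'a rproj set)"
    by (simp add: open_rproj_def open_Compl)
next
  fix S T :: "'a rproj set"
  assume "open S" and "open T"
  moreover have "{v. v \<noteq> 0 \<and> proj_pt v \<in> S \<inter> T} =
      {v. v \<noteq> 0 \<and> proj_pt v \<in> S} \<inter> {v. v \<noteq> 0 \<and> proj_pt v \<in> T}"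
    by auto
  ultimately show "open (S \<inter> T)"
    by (simp add: open_rproj_def open_Int)
next
  fix K :: "'a rproj set set"
  assume "\<forall>S\<in>K. open S"
  moreover have "{v. v \<noteq> 0 \<and> proj_pt v \<in> \<Union>K} = (\<Union>S\<in>K. {v. v \<noteq> 0 \<and> proj_pt v \<in> S})"
    by auto
  ultimately show "open (\<Union>K)"
    unfolding open_rproj_def by (metis (no_types, lifting) open_UN)
qed

end

definition proj_line :: "'n::finite rproj \<Rightarrow> 'n rproj \<Rightarrow> 'n rproj set"
  where "proj_line x y = {p. line_of p \<subseteq> span (line_of x \<union> line_of y)}"

text \<open>\<open>PGL\<^sub>d(\<real>)\<close> acts faithfully on \<open>\<bbbP>(\<real>\<^sup>d)\<close>; it is represented by the group of induced transformations.\<close>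

definition proj_map :: "real ^ 'n ^ 'n \<Rightarrow> 'n::finite rproj \<Rightarrow> 'n rproj"
  where "proj_map A p = Abs_rproj ((*v) A ` line_of p)"

definition PGL :: "('n::finite rproj \<Rightarrow> 'n rproj) set"
  where "PGL = {proj_map A | A. invertible A}"


section \<open>Affine charts and properly convex domains\<close>

text \<open>
  The affine chart of a covector \<open>w \<noteq> 0\<close> is the complement of the projective hyperplane given
  by the kernel of \<open>w\<close>, identified with the affine hyperplane \<open>{v. w \<bullet> v = 1}\<close>.
\<close>

definition chart_dom :: "real ^ 'n \<Rightarrow> 'n::finite rproj set"
  where "chart_dom w = {p. \<exists>v\<in>line_of p. w \<bullet> v \<noteq> 0}"

definition chart :: "real ^ 'n \<Rightarrow> 'n::finite rproj \<Rightarrow> real ^ 'n"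
  where "chart w p = (THE v. v \<in> line_of p \<and> w \<bullet> v = 1)"

definition convex_chart :: "'n::finite rproj set \<Rightarrow> real ^ 'n \<Rightarrow> bool"
  where "convex_chart \<Omega> w \<longleftrightarrow>
    w \<noteq> 0 \<and> closure \<Omega> \<subseteq> chart_dom w \<and> bounded (chart w ` \<Omega>) \<and> convex (chart w ` \<Omega>)"

definition properly_convex_domain :: "'n::finite rproj set \<Rightarrow> bool"
  where "properly_convex_domain \<Omega> \<longleftrightarrow>
    CARD('n) \<ge> 2 \<and> \<Omega> \<noteq> {} \<and> open \<Omega> \<and> (\<exists>w. convex_chart \<Omega> w)"

definition bdry :: "'n::finite rproj set \<Rightarrow> 'n rproj set"
  where "bdry \<Omega> = closure \<Omega> - \<Omega>"

definition Aut :: "'n::finite rproj set \<Rightarrow> ('n rproj \<Rightarrow> 'n rproj) set"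
  where "Aut \<Omega> = {g \<in> PGL. g ` \<Omega> = \<Omega>}"

definition quasi_homogeneous :: "'n::finite rproj set \<Rightarrow> bool"
  where "quasi_homogeneous \<Omega> \<longleftrightarrow> (\<exists>K. compact K \<and> K \<subseteq> \<Omega> \<and> (\<Union>g\<in>Aut \<Omega>. g ` K) = \<Omega>)"

text \<open>
  Convex hulls in \<open>closure \<Omega>\<close> and cross ratios do not depend on the affine chart containing
  \<open>closure \<Omega>\<close>, so both are computed in one chosen chart.
\<close>

definition some_chart :: "'n::finite rproj set \<Rightarrow> 'n rproj \<Rightarrow> real ^ 'n"
  where "some_chart \<Omega> = chart (SOME w. convex_chart \<Omega> w)"


section \<open>The Hilbert metric\<close>

text \<open>
  The pair \<open>(x\<^sub>\<infinity>, y\<^sub>\<infinity>)\<close> of endpoints of the segment in which the projective line through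
  \<open>x\<close> and \<open>y\<close> meets \<open>closure \<Omega>\<close>; the last two conditions impose the order
  \<open>x\<^sub>\<infinity>, x, y, y\<^sub>\<infinity>\<close>.
\<close>

definition hilbert_ends ::
    "'n::finite rproj set \<Rightarrow> 'n rproj \<Rightarrow> 'n rproj \<Rightarrow> 'n rproj \<times> 'n rproj"
  where "hilbert_ends \<Omega> x y =
    (let \<phi> = some_chart \<Omega> in
     THE (a, b). a \<in> bdry \<Omega> \<and> b \<in> bdry \<Omega> \<and>
       \<phi> ` (proj_line x y \<inter> closure \<Omega>) = closed_segment (\<phi> a) (\<phi> b) \<and>
       \<phi> x \<in> closed_segment (\<phi> a) (\<phi> y) \<and> \<phi> y \<in> closed_segment (\<phi> x) (\<phi> b))"

text \<open>
  The value \<open>0\<close> outside \<open>\<Omega>\<close> is a convention: the locale \<open>Metric_space\<close> requires nonnegativity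
  and symmetry on the whole type.
\<close>

definition hilbert_dist :: "'n::finite rproj set \<Rightarrow> 'n rproj \<Rightarrow> 'n rproj \<Rightarrow> real"
  where "hilbert_dist \<Omega> x y =
    (if x \<in> \<Omega> \<and> y \<in> \<Omega> \<and> x \<noteq> y then
       let \<phi> = some_chart \<Omega>; (a, b) = hilbert_ends \<Omega> x y in
       1 / 2 * ln ((dist (\<phi> y) (\<phi> a) * dist (\<phi> x) (\<phi> b)) /
                   (dist (\<phi> x) (\<phi> a) * dist (\<phi> y) (\<phi> b)))
     else 0)"


section \<open>Properly embedded simplices\<close>

definition proj_hull :: "'n::finite rproj set \<Rightarrow> 'n rproj set \<Rightarrow> 'n rproj set"
  where "proj_hull \<Omega> V = {p \<in> closure \<Omega>. some_chart \<Omega> p \<in> convex hull (some_chart \<Omega> ` V)}"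

text \<open>\<open>v 0, \<dots>, v k\<close> are the vertices of a non-degenerate \<open>k\<close>-simplex;
  \<open>dim \<bbbP>(W) = dim W - 1\<close> for a linear subspace \<open>W\<close>.\<close>

definition nondeg_vertices :: "'n::finite rproj set \<Rightarrow> nat \<Rightarrow> (nat \<Rightarrow> 'n rproj) \<Rightarrow> bool"
  where "nondeg_vertices \<Omega> k v \<longleftrightarrow>
    k \<ge> 1 \<and> v ` {..k} \<subseteq> closure \<Omega> \<and> dim (span (\<Union>i\<le>k. line_of (v i))) = k + 1"

definition is_PES :: "'n::finite rproj set \<Rightarrow> nat \<Rightarrow> 'n rproj set \<Rightarrow> bool"
  where "is_PES \<Omega> k S \<longleftrightarrow>
    (\<exists>v. nondeg_vertices \<Omega> k v \<and> S = proj_hull \<Omega> (v ` {..k}) \<and>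
         v ` {..k} \<subseteq> bdry \<Omega> \<and> S \<inter> \<Omega> \<noteq> {} \<and>
         (\<forall>i\<le>k. proj_hull \<Omega> (v ` ({..k} - {i})) \<subseteq> bdry \<Omega>))"

definition r_PES :: "'n::finite rproj set \<Rightarrow> enat"
  where "r_PES \<Omega> = (SUP k\<in>{k. \<exists>S. is_PES \<Omega> k S}. enat k)"


section \<open>Coarse medians\<close>

text \<open>
  Distances between sets and diameters take values in \<open>[0, \<infinity>]\<close>; in particular the distance
  to the empty set is \<open>\<infinity>\<close> and the diameter of the empty set is \<open>0\<close>.
\<close>

definition pt_dist :: "('a \<Rightarrow> 'a \<Rightarrow> real) \<Rightarrow> 'a \<Rightarrow> 'a set \<Rightarrow> ennreal"
  where "pt_dist d x A = (INF a\<in>A. ennreal (d x a))"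

definition nbhd :: "'a set \<Rightarrow> ('a \<Rightarrow> 'a \<Rightarrow> real) \<Rightarrow> real \<Rightarrow> 'a set \<Rightarrow> 'a set"
  where "nbhd X d s A = (if s = 0 then A else {x \<in> X. pt_dist d x A < ennreal s})"

definition hausdorff_dist :: "('a \<Rightarrow> 'a \<Rightarrow> real) \<Rightarrow> 'a set \<Rightarrow> 'a set \<Rightarrow> ennreal"
  where "hausdorff_dist d A B = max (SUP a\<in>A. pt_dist d a B) (SUP b\<in>B. pt_dist d b A)"

definition diam :: "('a \<Rightarrow> 'a \<Rightarrow> real) \<Rightarrow> 'a set \<Rightarrow> ennreal"
  where "diam d A = (SUP x\<in>A. SUP y\<in>A. ennreal (d x y))"

text \<open>
  Elements \<open>(a\<^sub>0, \<dots>, a\<^sub>k)\<close> of \<open>X\<^sup>k\<^sup>+\<^sup>1\<close> are lists of length \<open>k + 1\<close>. The subtuple with index set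
  \<open>I\<close> is \<open>nths as I\<close>, so the tuple omitting \<open>a\<^sub>i\<close> is \<open>nths as (- {i})\<close>.
\<close>

definition tuples :: "'a set \<Rightarrow> nat \<Rightarrow> 'a list set"
  where "tuples X m = {as. length as = m \<and> set as \<subseteq> X}"

definition coarse_filling ::
    "'a set \<Rightarrow> ('a \<Rightarrow> 'a \<Rightarrow> real) \<Rightarrow> nat \<Rightarrow> (nat \<Rightarrow> 'a list \<Rightarrow> 'a set) \<Rightarrow> (real \<Rightarrow> real) \<Rightarrow> bool"
  where "coarse_filling X d r F \<Lambda> \<longleftrightarrow>
    (\<forall>R\<ge>0. \<Lambda> R \<ge> 0) \<and> mono_on {0..} \<Lambda> \<and>
    (\<forall>k\<le>r. \<forall>as\<in>tuples X (k + 1). F k as \<subseteq> X) \<and>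
    (\<forall>a\<in>X. hausdorff_dist d {a} (F 0 [a]) \<le> ennreal (\<Lambda> 0)) \<and>
    (\<forall>k\<in>{1..r}. \<forall>as\<in>tuples X (k + 1). \<forall>i\<le>k.
       F (k - 1) (nths as (- {i})) \<subseteq> nbhd X d (\<Lambda> 0) (F k as)) \<and>
    (\<forall>k\<le>r. \<forall>as\<in>tuples X (k + 1). \<forall>\<sigma>. \<sigma> permutes {..<k + 1} \<longrightarrow>
       hausdorff_dist d (F k as) (F k (permute_list \<sigma> as)) \<le> ennreal (\<Lambda> 0)) \<and>
    (\<forall>k<r. \<forall>as\<in>tuples X (k + 1).
       F (k + 1) (as @ [last as]) \<subseteq> nbhd X d (\<Lambda> 0) (F k as)) \<and>
    (\<forall>k\<le>r. \<forall>as\<in>tuples X (k + 1). \<forall>R\<ge>0. \<forall>x\<in>nbhd X d R (F k as). \<forall>j\<le>k.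
       F k (as[j := x]) \<subseteq> nbhd X d (\<Lambda> R) (F k as))"

definition coarse_generic ::
    "'a set \<Rightarrow> ('a \<Rightarrow> 'a \<Rightarrow> real) \<Rightarrow> nat \<Rightarrow> (nat \<Rightarrow> 'a list \<Rightarrow> 'a set) \<Rightarrow> real \<Rightarrow> real \<Rightarrow> 'a list \<Rightarrow> bool"
  where "coarse_generic X d r F \<delta> D as \<longleftrightarrow>
    (\<forall>q\<ge>1. \<forall>I :: nat \<Rightarrow> nat set.
       (\<forall>j\<in>{1..q}. I j \<noteq> {} \<and> I j \<subset> {0..r + 1}) \<longrightarrow>
       (\<Inter>j\<in>{1..q}. I j) = {} \<longrightarrow>
       diam d (\<Inter>j\<in>{1..q}. nbhd X d \<delta> (F (card (I j) - 1) (nths as (I j)))) > ennreal D \<longrightarrow>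
       (\<forall>j\<in>{1..q}. card (I j) = r + 1))"

definition coarse_median_structure :: "'a set \<Rightarrow> ('a \<Rightarrow> 'a \<Rightarrow> real) \<Rightarrow> nat \<Rightarrow> bool"
  where "coarse_median_structure X d r \<longleftrightarrow>
    Metric_space X d \<and> r \<ge> 1 \<and>
    (\<exists>F \<Lambda> \<delta>\<^sub>0 a b lam \<Psi>.
       coarse_filling X d r F \<Lambda> \<and>
       \<delta>\<^sub>0 \<ge> 0 \<and>
       a > 0 \<and> b \<ge> 0 \<and> lam = (\<lambda>\<delta>. a * (\<delta> - \<delta>\<^sub>0) + b) \<and>
       (\<forall>s\<ge>\<delta>\<^sub>0. \<forall>t\<ge>\<delta>\<^sub>0. (\<Psi> s t :: real) \<ge> 0) \<and>
       (\<forall>s\<ge>\<delta>\<^sub>0. mono_on {\<delta>\<^sub>0..} (\<lambda>t. \<Psi> s t)) \<and>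
       (\<forall>t\<ge>\<delta>\<^sub>0. mono_on {\<delta>\<^sub>0..} (\<lambda>s. \<Psi> s t)) \<and>
       (\<forall>as\<in>tuples X (r + 2).
          (\<Inter>j\<in>{0..r + 1}. nbhd X d (lam \<delta>\<^sub>0) (F r (nths as (- {j})))) \<noteq> {}) \<and>
       (\<forall>\<delta>\<ge>\<delta>\<^sub>0. \<forall>D\<ge>\<delta>\<^sub>0. \<forall>as\<in>tuples X (r + 2).
          coarse_generic X d r F \<delta> D as \<longrightarrow>
          diam d (\<Inter>j\<in>{0..r + 1}. nbhd X d (lam \<delta>) (F r (nths as (- {j})))) \<le> ennreal (\<Psi> \<delta> D)))"

end

theory Submission
  imports Defs
begin

text \<open>
  In the cone \<open>C\<close> over \<open>\<Omega>\<close>, ordered by \<open>x \<preceq> y \<longleftrightarrow> y - x \<in> closure C\<close>, the condition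
  \<open>d(x, y) \<le> D\<close> says that \<open>\<alpha> y \<preceq> x \<preceq> \<alpha> exp (2 * D) y\<close> for some \<open>\<alpha> > 0\<close>. The
  filling of a tuple is its convex hull in \<open>\<Omega>\<close>; it satisfies (F4) because metric neighbourhoods
  of convex sets are convex.

  If (CM1) failed, the KKM lemma would give simplices of dimension \<open>r + 1\<close> with points
  arbitrarily far from all facets. Moving these points into a compact set by automorphisms, a
  limit simplex meets \<open>\<Omega>\<close> while its facets lie in the boundary; by Caratheodory's argument it is
  non-degenerate, so it is a PES of dimension \<open>r + 1\<close>.

  (CM2) needs no PES. If points \<open>x\<close>, \<open>y\<close> near all facets can be arbitrarily far apart, a limit
  gives a ray towards some \<open>\<xi> \<in> \<partial>\<Omega>\<close> that stays near all facets of a limit simplex. The vertices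
  in the closed face of \<open>\<xi>\<close> are some but not all of the vertices. Replacing, in the facet
  omitting a vertex \<open>j\<close> outside this face, the part in the face by the footpoint of \<open>\<xi>\<close> in the facet
  omitting a vertex \<open>i\<close> in the face, one sees that the ray ends up near the face omitting both
  \<open>i\<close> and \<open>j\<close>, at about three times the distance. As \<open>\<lambda>\<close> has slope \<open>1 / 4\<close>, genericity bounds the
  diameter of this part of the ray: a contradiction.
\<close>

section \<open>A KKM lemma for facets\<close>

text \<open>The limits in both arguments are vectors on the boundary of the cone, where the Hilbert
  metric is infinite. Distances are therefore expressed by the order, which makes sense there:
  \<open>rel\<close> compares two vectors, and \<open>near\<close> compares a vector with the cone
  over some vertices. Two facts of opposite kind carry the limits: \<open>near\<close> with a fixed
  constant is closed (\<open>near_lim\<close>), and at a point of the open cone it is open at the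
  price of any larger constant (\<open>near_perturb\<close>). Both notions ignore positive scalars,
  so an automorphism can move one point into a compact set while every vertex is rescaled back to
  the compact slice \<open>base\<close>.

  In terms of the order, the step to a face of codimension two turns the constant \<beta> into 3
  \<beta>^2. With \<beta> = exp (2 s) this is the distance 2 s + ln 3 / 2 < 2 s + 1. A slope below 1
  / 2 in \<open>lam\<close> keeps this below \<delta> for large \<delta>, so that genericity at
  scale \<delta> applies.\<close>

lemma convex_hull_indexed:
  fixes a :: "'i \<Rightarrow> 'a::real_vector"
  assumes "finite I"
  shows "convex hull (a ` I) = {\<Sum>i\<in>I. t i *\<^sub>R a i |t. (\<forall>i\<in>I. 0 \<le> t i) \<and> sum t I = 1}"
    (is "_ = ?R")
proof
  show "convex hull (a ` I) \<subseteq> ?R"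
  proof (rule hull_minimal)
    show "a ` I \<subseteq> ?R"
    proof
      fix v assume "v \<in> a ` I"
      then obtain j where j: "j \<in> I" "v = a j" by blast
      have "v = (\<Sum>i\<in>I. (if i = j then 1 else 0) *\<^sub>R a i)"
        using j assms by (simp add: if_distrib[of "\<lambda>c. c *\<^sub>R _"] sum.delta cong: if_cong)
      moreover have "(\<Sum>i\<in>I. if i = j then 1 else (0::real)) = 1"
        using j assms by simp
      ultimately show "v \<in> ?R"
        by (intro CollectI exI[of _ "\<lambda>i. if i = j then 1 else 0"]) auto
    qed
    show "convex ?R"
    proof (rule convexI)
      fix x y and u v :: real
      assume uv: "0 \<le> u" "0 \<le> v" "u + v = 1" and "x \<in> ?R" "y \<in> ?R"
      then obtain s t where s: "\<forall>i\<in>I. 0 \<le> s i" "sum s I = 1" "x = (\<Sum>i\<in>I. s i *\<^sub>R a i)"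
        and t: "\<forall>i\<in>I. 0 \<le> t i" "sum t I = 1" "y = (\<Sum>i\<in>I. t i *\<^sub>R a i)"
        by blast
      have "u *\<^sub>R x + v *\<^sub>R y = (\<Sum>i\<in>I. (u * s i + v * t i) *\<^sub>R a i)"
        by (simp add: s t scaleR_right.sum sum.distrib scaleR_add_left)
      moreover have "(\<Sum>i\<in>I. u * s i + v * t i) = 1"
        using uv s t by (simp add: sum.distrib flip: sum_distrib_left)
      ultimately show "u *\<^sub>R x + v *\<^sub>R y \<in> ?R"
        using s t uv by (intro CollectI exI[of _ "\<lambda>i. u * s i + v * t i"]) simp
    qed
  qed
  show "?R \<subseteq> convex hull (a ` I)"
  proof
    fix x assume "x \<in> ?R"
    then obtain s where s: "\<forall>i\<in>I. 0 \<le> s i" "sum s I = 1" "x = (\<Sum>i\<in>I. s i *\<^sub>R a i)"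
      by blast
    show "x \<in> convex hull (a ` I)"
      unfolding s(3) by (rule convex_sum) (use s assms in \<open>auto intro: hull_inc\<close>)
  qed
qed

text \<open>The facets are assigned to the vertices by a cyclic shift: a fixed point of the map below
  has a vanishing weight, and the shift propagates the vanishing to all weights.\<close>

lemma KKM_facets:
  fixes a :: "nat \<Rightarrow> 'a::euclidean_space"
  assumes closed: "\<And>j. j \<le> k \<Longrightarrow> closed (A j)"
    and facet: "\<And>j. j \<le> k \<Longrightarrow> convex hull (a ` ({..k} - {j})) \<subseteq> A j"
    and cover: "convex hull (a ` {..k}) \<subseteq> (\<Union>j\<le>k. A j)"
    and ne: "\<And>j. j \<le> k \<Longrightarrow> A j \<noteq> {}"
  shows "\<exists>x\<in>convex hull (a ` {..k}). \<forall>j\<le>k. x \<in> A j"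
proof (rule ccontr)
  assume no: "\<not> ?thesis"
  define S where "S = convex hull (a ` {..k})"
  define f where "f j x = infdist x (A j)" for j x
  define g where "g x = (\<Sum>j\<le>k. f j x)" for x
  define sh where "sh j = (if j = k then 0 else Suc j)" for j
  have f0: "f j x = 0 \<longleftrightarrow> x \<in> A j" if "j \<le> k" for j x
    unfolding f_def using in_closed_iff_infdist_zero[OF closed ne] that by blast
  have fnn: "0 \<le> f j x" for j x
    by (simp add: f_def infdist_nonneg)
  have gpos: "0 < g x" if x: "x \<in> S" for x
  proof -
    obtain j where j: "j \<le> k" "x \<notin> A j"
      using no x unfolding S_def by blast
    then have "0 < f j x"
      using f0 fnn by (metis order_less_le)
    then show ?thesis
      unfolding g_def using j fnn by (intro sum_pos2[of _ j]) auto
  qed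
  \<comment> \<open>The farther x is from \<open>A j\<close>, the more h moves it towards
    \<open>a (sh j)\<close>; where \<open>f j\<close> vanishes, this vertex is absent.\<close>
  define h where "h x = (\<Sum>j\<le>k. (f j x / g x) *\<^sub>R a (sh j))" for x
  have sh_le: "sh j \<le> k" if "j \<le> k" for j
    using that by (auto simp: sh_def)
  have sum1: "(\<Sum>j\<le>k. f j x / g x) = 1" if "x \<in> S" for x
    using gpos[OF that] by (simp add: g_def flip: sum_divide_distrib)
  have cS: "compact S" "convex S" "S \<noteq> {}"
    unfolding S_def by (auto intro!: finite_imp_compact_convex_hull)
  have conth: "continuous_on S h"
    unfolding h_def f_def g_def using gpos
    by (intro continuous_intros) (fastforce simp: g_def f_def)+
  have "h \<in> S \<rightarrow> S"
  proof
    fix x assume x: "x \<in> S"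
    show "h x \<in> S"
      unfolding h_def S_def
      by (rule convex_sum) (use sum1[OF x] gpos[OF x] fnn sh_le in \<open>auto intro!: hull_inc\<close>)
  qed
  then obtain x where x: "x \<in> S" "h x = x"
    using brouwer[OF cS(1,2,3) conth] by blast
  have step: "f (sh j) x = 0" if j: "j \<le> k" "f j x = 0" for j
  proof -
    have inj: "inj_on sh {..k}"
      by (auto simp: inj_on_def sh_def split: if_splits)
    have eq: "sh ` {..k} = {..k}"
      using inj sh_le by (intro endo_inj_surj) auto
    define t where "t i = f (inv_into {..k} sh i) x / g x" for i
    have t: "t (sh i) = f i x / g x" if "i \<le> k" for i
      using that inj by (simp add: t_def)
    have s1: "(\<Sum>i\<le>k. F (sh i)) = sum F {..k}" for F :: "nat \<Rightarrow> 'z::comm_monoid_add"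
      using sum.reindex[OF inj, of F] eq by simp
    have hx: "x = (\<Sum>i\<le>k. t i *\<^sub>R a i)"
      using x(2) t s1[of "\<lambda>i. t i *\<^sub>R a i"] by (simp add: h_def)
    have ts: "(\<Sum>i\<le>k. t i) = 1"
      using sum1[OF x(1)] t s1[of t] by simp
    have tn: "0 \<le> t i" for i
      using fnn gpos[OF x(1)] by (simp add: t_def)
    have tz: "t (sh j) = 0"
      using t j by simp
    have shj: "sh j \<in> {..k}" using sh_le j by simp
    \<comment> \<open>One representation of x without the index \<open>sh j\<close> suffices, even
      when vertices coincide or are dependent.\<close>
    have "x = (\<Sum>i\<in>{..k} - {sh j}. t i *\<^sub>R a i)"
      using hx tz shj by (simp add: sum.remove)
    moreover have "(\<Sum>i\<in>{..k} - {sh j}. t i) = 1"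
      using ts tz shj by (simp add: sum.remove)
    ultimately have "x \<in> convex hull (a ` ({..k} - {sh j}))"
      unfolding convex_hull_indexed[OF finite_Diff[OF finite_atMost]] using tn by blast
    then show ?thesis
      using facet[of "sh j"] f0 shj by auto
  qed
  obtain j where j: "j \<le> k" "f j x = 0"
    using cover x f0 unfolding S_def by blast
  have up: "f (j + n) x = 0" if "j + n \<le> k" for n
    using that
  proof (induction n)
    case (Suc n)
    then show ?case
      using step[of "j + n"] by (auto simp: sh_def split: if_splits)
  qed (use j in simp)
  have "f k x = 0"
    using up[of "k - j"] j by simp
  then have z: "f 0 x = 0"
    using step[of k] by (simp add: sh_def)
  have "f n x = 0" if "n \<le> k" for n
    using that
  proof (induction n)
    case (Suc n)
    then show ?case
      using step[of n] by (auto simp: sh_def split: if_splits)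
  qed (use z in simp)
  then have "g x = 0"
    by (simp add: g_def)
  then show False
    using gpos[OF x(1)] by simp
qed

lemma convergent_subseq_family:
  fixes f :: "nat \<Rightarrow> nat \<Rightarrow> 'a::metric_space"
  assumes "compact S" and "\<And>n i. i \<le> k \<Longrightarrow> f n i \<in> S"
  shows "\<exists>l \<rho>. strict_mono (\<rho> :: nat \<Rightarrow> nat) \<and> (\<forall>i\<le>k. l i \<in> S \<and> (\<lambda>n. f (\<rho> n) i) \<longlonglongrightarrow> l i)"
  using assms(2)
proof (induction k)
  case 0
  then obtain l \<rho> where "l \<in> S" "strict_mono (\<rho> :: nat \<Rightarrow> nat)" "((\<lambda>n. f n 0) \<circ> \<rho>) \<longlonglongrightarrow> l"
    using assms(1) unfolding compact_def by (metis le0)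
  then show ?case
    by (intro exI[of _ "\<lambda>_. l"] exI[of _ \<rho>]) (auto simp: o_def)
next
  case (Suc k)
  then obtain l \<rho> where l: "strict_mono (\<rho> :: nat \<Rightarrow> nat)"
    "\<forall>i\<le>k. l i \<in> S \<and> (\<lambda>n. f (\<rho> n) i) \<longlonglongrightarrow> l i"
    by (metis le_SucI)
  have "\<forall>n. f (\<rho> n) (Suc k) \<in> S"
    using Suc.prems by simp
  then obtain m \<sigma> where m: "m \<in> S" "strict_mono (\<sigma> :: nat \<Rightarrow> nat)"
    "((\<lambda>n. f (\<rho> n) (Suc k)) \<circ> \<sigma>) \<longlonglongrightarrow> m"
    using assms(1) unfolding compact_def by metis
  have "(\<lambda>n. f ((\<rho> \<circ> \<sigma>) n) i) \<longlonglongrightarrow> (l(Suc k := m)) i" if "i \<le> Suc k" for i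
    using m(3) l(2) that LIMSEQ_subseq_LIMSEQ[OF _ m(2), of "\<lambda>n. f (\<rho> n) i" "l i"]
    by (cases "i = Suc k") (auto simp: o_def)
  then show ?case
    using l m by (intro exI[of _ "l(Suc k := m)"] exI[of _ "\<rho> \<circ> \<sigma>"]) (auto simp: strict_mono_o simp del: o_apply)
qed

section \<open>The order and the projective metric of an open convex cone\<close>

text \<open>The lower bound on w is a quantitative form of pointedness: w is positive on the closed
  cone away from 0 and the slice w = 1 is bounded, so limits of normalized vectors neither vanish
  nor escape.\<close>

locale pointed_cone =
  fixes C :: "'a::euclidean_space set" and w :: 'a and c :: real
  assumes open_C: "open C"
    and add_C: "\<lbrakk>x \<in> C; y \<in> C\<rbrakk> \<Longrightarrow> x + y \<in> C"
    and scale_C: "\<lbrakk>0 < s; x \<in> C\<rbrakk> \<Longrightarrow> s *\<^sub>R x \<in> C"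
    and zero_C: "0 \<notin> C"
    and ne_C: "C \<noteq> {}"
    and c_pos: "0 < c"
    and c_bound: "x \<in> C \<Longrightarrow> c * norm x \<le> w \<bullet> x"
begin

definition le :: "'a \<Rightarrow> 'a \<Rightarrow> bool" (infix "\<preceq>" 50)
  where "x \<preceq> y \<longleftrightarrow> y - x \<in> closure C"

lemma zero_le_iff: "0 \<preceq> x \<longleftrightarrow> x \<in> closure C"
  by (simp add: le_def)

lemma closure_C_scale: "0 \<le> s \<Longrightarrow> x \<in> closure C \<Longrightarrow> s *\<^sub>R x \<in> closure C"
proof -
  assume s: "0 \<le> s" and x: "x \<in> closure C"
  then obtain f where f: "\<And>n. f n \<in> C" "f \<longlonglongrightarrow> x"
    unfolding closure_sequential by blast
  have "(\<lambda>n. (s + inverse (real (Suc n))) *\<^sub>R f n) \<longlonglongrightarrow> (s + 0) *\<^sub>R x"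
    by (intro tendsto_intros f LIMSEQ_inverse_real_of_nat)
  moreover have "(s + inverse (real (Suc n))) *\<^sub>R f n \<in> C" for n
    using f s by (intro scale_C) (simp_all add: add_nonneg_pos)
  ultimately show ?thesis
    unfolding closure_sequential by (metis (no_types, lifting) add_0_right)
qed

lemma closure_C_add: "x \<in> closure C \<Longrightarrow> y \<in> closure C \<Longrightarrow> x + y \<in> closure C"
proof -
  assume x: "x \<in> closure C" and y: "y \<in> closure C"
  obtain f where f: "\<And>n. f n \<in> C" "f \<longlonglongrightarrow> x"
    using x unfolding closure_sequential by blast
  obtain g where g: "\<And>n. g n \<in> C" "g \<longlonglongrightarrow> y"
    using y unfolding closure_sequential by blast
  have "(\<lambda>n. f n + g n) \<longlonglongrightarrow> x + y" "\<And>n. f n + g n \<in> C"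
    using f g add_C by (auto intro: tendsto_intros)
  then show ?thesis
    unfolding closure_sequential by (intro exI[of _ "\<lambda>n. f n + g n"]) auto
qed

lemma C_le: "x \<in> C \<Longrightarrow> 0 \<preceq> x"
  using closure_subset[of C] by (auto simp: zero_le_iff)

lemma le_refl [simp]: "x \<preceq> x"
  using closure_C_scale[of 0] ne_C closure_subset[of C] by (auto simp: le_def)

lemma le_trans [trans]: "x \<preceq> y \<Longrightarrow> y \<preceq> z \<Longrightarrow> x \<preceq> z"
  using closure_C_add[of "y - x" "z - y"] by (simp add: le_def)

lemma le_add: "x \<preceq> y \<Longrightarrow> x' \<preceq> y' \<Longrightarrow> x + x' \<preceq> y + y'"
  using closure_C_add[of "y - x" "y' - x'"] by (simp add: le_def algebra_simps)

lemma le_scale: "0 \<le> s \<Longrightarrow> x \<preceq> y \<Longrightarrow> s *\<^sub>R x \<preceq> s *\<^sub>R y"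
  using closure_C_scale[of s "y - x"] by (simp add: le_def algebra_simps)

lemma le_scale_mono: "s \<le> t \<Longrightarrow> 0 \<preceq> x \<Longrightarrow> s *\<^sub>R x \<preceq> t *\<^sub>R x"
  using closure_C_scale[of "t - s" x] by (simp add: le_def algebra_simps)

lemma le_sum: "(\<And>i. i \<in> I \<Longrightarrow> f i \<preceq> g i) \<Longrightarrow> sum f I \<preceq> sum g I"
  by (induction I rule: infinite_finite_induct) (auto intro: le_add)

lemma le_lim:
  assumes "f \<longlonglongrightarrow> x" "g \<longlonglongrightarrow> y" "\<And>n. f n \<preceq> g n"
  shows "x \<preceq> y"
  unfolding le_def
  by (rule Lim_in_closed_set[OF closed_closure _ _ tendsto_diff[OF assms(2,1)]])
    (use assms(3) in \<open>auto simp: le_def\<close>)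

text \<open>Openness absorbs the error: if v \<in> C is close to y - x, then y - v is close to x,
  hence in C, and y = (y - v) + v.\<close>

lemma C_up: "x \<in> C \<Longrightarrow> x \<preceq> y \<Longrightarrow> y \<in> C"
proof -
  assume x: "x \<in> C" and xy: "x \<preceq> y"
  obtain e where e: "e > 0" "ball x e \<subseteq> C"
    using open_C x openE by blast
  obtain v where v: "v \<in> C" "dist v (y - x) < e"
    using xy e(1) unfolding le_def closure_approachable by blast
  have "y - v \<in> ball x e"
    using v(2) by (simp add: dist_norm algebra_simps norm_minus_commute)
  then have "(y - v) + v \<in> C"
    using add_C v e by blast
  then show ?thesis by simp
qed

lemma c_bound': "0 \<preceq> x \<Longrightarrow> c * norm x \<le> w \<bullet> x"
proof -
  assume "0 \<preceq> x"
  then obtain f where f: "\<And>n. f n \<in> C" "f \<longlonglongrightarrow> x"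
    unfolding zero_le_iff closure_sequential by blast
  have "(\<lambda>n. c * norm (f n)) \<longlonglongrightarrow> c * norm x" "(\<lambda>n. w \<bullet> f n) \<longlonglongrightarrow> w \<bullet> x"
    by (intro tendsto_intros f)+
  then show ?thesis
    using f c_bound by (intro LIMSEQ_le) auto
qed

lemma w_mono: "x \<preceq> y \<Longrightarrow> w \<bullet> x \<le> w \<bullet> y"
proof -
  assume "x \<preceq> y"
  then have "0 \<le> w \<bullet> (y - x)"
    using order.trans[OF _ c_bound'[of "y - x"], of 0] c_pos by (simp add: le_def)
  then show ?thesis
    by (simp add: inner_diff_right)
qed

lemma w_pos: "0 \<preceq> x \<Longrightarrow> x \<noteq> 0 \<Longrightarrow> 0 < w \<bullet> x"
proof -
  assume "0 \<preceq> x" "x \<noteq> 0"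
  moreover from this have "0 < c * norm x"
    using c_pos by simp
  ultimately show ?thesis
    using c_bound'[of x] by linarith
qed

lemma w_pos_C: "x \<in> C \<Longrightarrow> 0 < w \<bullet> x"
  using w_pos C_le zero_C by blast

text \<open>The factor \<alpha> makes the relation invariant under rescaling x and y separately. The
  least \<beta> is the best upper factor divided by the best lower factor, as in Birkhoff's
  projective metric; it is the exponential of twice the Hilbert distance.\<close>

definition rel :: "real \<Rightarrow> 'a \<Rightarrow> 'a \<Rightarrow> bool"
  where "rel \<beta> x y \<longleftrightarrow> (\<exists>\<alpha>>0. \<alpha> *\<^sub>R y \<preceq> x \<and> x \<preceq> (\<alpha> * \<beta>) *\<^sub>R y)"

lemma relI: "0 < \<alpha> \<Longrightarrow> \<alpha> *\<^sub>R y \<preceq> x \<Longrightarrow> x \<preceq> \<mu> *\<^sub>R y \<Longrightarrow> \<mu> = \<alpha> * \<beta> \<Longrightarrow> rel \<beta> x y"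
  unfolding rel_def by blast

lemma rel_refl: "1 \<le> \<beta> \<Longrightarrow> 0 \<preceq> x \<Longrightarrow> rel \<beta> x x"
  using le_scale_mono[of 1 \<beta> x] by (intro relI[of 1]) auto

lemma rel_sym:
  assumes "rel \<beta> x y" "0 < \<beta>"
  shows "rel \<beta> y x"
proof -
  obtain \<alpha> where a: "0 < \<alpha>" "\<alpha> *\<^sub>R y \<preceq> x" "x \<preceq> (\<alpha> * \<beta>) *\<^sub>R y"
    using assms unfolding rel_def by blast
  have "inverse (\<alpha> * \<beta>) *\<^sub>R x \<preceq> inverse (\<alpha> * \<beta>) *\<^sub>R ((\<alpha> * \<beta>) *\<^sub>R y)"
    using a assms by (intro le_scale) auto
  moreover have "inverse \<alpha> *\<^sub>R (\<alpha> *\<^sub>R y) \<preceq> inverse \<alpha> *\<^sub>R x"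
    using a by (intro le_scale) auto
  ultimately show ?thesis
    using a assms by (intro relI[of "inverse (\<alpha> * \<beta>)" _ _ "inverse \<alpha>"]) (auto simp: field_simps)
qed

lemma rel_trans:
  assumes "rel \<beta> x y" "rel \<gamma> y z" "0 \<le> \<beta>"
  shows "rel (\<beta> * \<gamma>) x z"
proof -
  obtain \<alpha> where a: "0 < \<alpha>" "\<alpha> *\<^sub>R y \<preceq> x" "x \<preceq> (\<alpha> * \<beta>) *\<^sub>R y"
    using assms unfolding rel_def by blast
  obtain \<delta> where d: "0 < \<delta>" "\<delta> *\<^sub>R z \<preceq> y" "y \<preceq> (\<delta> * \<gamma>) *\<^sub>R z"
    using assms unfolding rel_def by blast
  have "\<alpha> *\<^sub>R \<delta> *\<^sub>R z \<preceq> \<alpha> *\<^sub>R y" "(\<alpha> * \<beta>) *\<^sub>R y \<preceq> (\<alpha> * \<beta>) *\<^sub>R ((\<delta> * \<gamma>) *\<^sub>R z)"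
    using a d assms(3) by (intro le_scale; simp)+
  then have "(\<alpha> * \<delta>) *\<^sub>R z \<preceq> x" "x \<preceq> (\<alpha> * \<beta> * (\<delta> * \<gamma>)) *\<^sub>R z"
    using le_trans[OF _ a(2)] le_trans[OF a(3)] by simp_all
  then show ?thesis
    using a d by (intro relI[of "\<alpha> * \<delta>" _ _ "\<alpha> * \<beta> * (\<delta> * \<gamma>)"]) auto
qed

lemma rel_mono: "rel \<beta> x y \<Longrightarrow> \<beta> \<le> \<gamma> \<Longrightarrow> 0 \<preceq> y \<Longrightarrow> rel \<gamma> x y"
  unfolding rel_def
  by (meson le_trans le_scale_mono mult_left_mono less_imp_le)

lemma rel_scale: "0 < s \<Longrightarrow> 0 < t \<Longrightarrow> rel \<beta> x y \<Longrightarrow> rel \<beta> (s *\<^sub>R x) (t *\<^sub>R y)"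
proof -
  assume st: "0 < s" "0 < t" and "rel \<beta> x y"
  then obtain \<alpha> where a: "0 < \<alpha>" "\<alpha> *\<^sub>R y \<preceq> x" "x \<preceq> (\<alpha> * \<beta>) *\<^sub>R y"
    unfolding rel_def by blast
  then show ?thesis
    using le_scale[OF _ a(2), of s] le_scale[OF _ a(3), of s] st
    by (intro relI[of "s * \<alpha> / t" _ _ "s * \<alpha> * \<beta> / t"]) (auto simp: mult.assoc)
qed

text \<open>Finite distance from a point of the open cone keeps a vector off the boundary. This
  turns a bound on distances along a sequence into a contradiction once the limit is known to lie
  outside C.\<close>

lemma rel_C: "rel \<beta> x y \<Longrightarrow> x \<in> C \<Longrightarrow> 0 \<preceq> y \<Longrightarrow> y \<in> C"
proof -
  assume "rel \<beta> x y" "x \<in> C" and y: "0 \<preceq> y"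
  then obtain \<mu> where m: "\<mu> *\<^sub>R y \<in> C"
    unfolding rel_def using C_up by blast
  then have "0 < \<mu> * (w \<bullet> y)"
    using w_pos_C by fastforce
  then have "0 < \<mu>"
    using w_mono[OF y] by (simp add: zero_less_mult_iff)
  then show ?thesis
    using scale_C[OF _ m, of "inverse \<mu>"] by simp
qed

text \<open>Applying w to the lower inequality bounds the factors, so they converge along a
  subsequence; a limit factor 0 would force w \<bullet> x \<le> 0. The limits may lie on the
  boundary.\<close>

lemma rel_lim:
  assumes "f \<longlonglongrightarrow> x" "g \<longlonglongrightarrow> y" and rel: "\<And>n. rel \<beta> (f n) (g n)"
    and "0 \<preceq> x" "0 \<preceq> y" "x \<noteq> 0" "y \<noteq> 0" and pos: "\<And>n. 0 \<preceq> f n" "\<And>n. 0 \<preceq> g n"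
  shows "rel \<beta> x y"
proof -
  obtain \<alpha> where a: "\<And>n. 0 < \<alpha> n" "\<And>n. \<alpha> n *\<^sub>R g n \<preceq> f n" "\<And>n. f n \<preceq> (\<alpha> n * \<beta>) *\<^sub>R g n"
    using rel unfolding rel_def by metis
  have wx: "0 < w \<bullet> x" and wy: "0 < w \<bullet> y"
    using assms w_pos by auto
  have lim: "(\<lambda>n. w \<bullet> f n) \<longlonglongrightarrow> w \<bullet> x" "(\<lambda>n. w \<bullet> g n) \<longlonglongrightarrow> w \<bullet> y"
    by (intro tendsto_intros assms)+
  have "\<forall>\<^sub>F n in sequentially. (w \<bullet> y) / 2 < w \<bullet> g n \<and> w \<bullet> f n < w \<bullet> x + 1"
    using order_tendstoD(1)[OF lim(2), of "(w \<bullet> y) / 2"] order_tendstoD(2)[OF lim(1), of "w \<bullet> x + 1"] wy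
    by (auto intro: eventually_conj)
  then obtain N where N: "\<And>n. n \<ge> N \<Longrightarrow> (w \<bullet> y) / 2 < w \<bullet> g n \<and> w \<bullet> f n < w \<bullet> x + 1"
    unfolding eventually_sequentially by blast
  define B where "B = (w \<bullet> x + 1) / ((w \<bullet> y) / 2)"
  have "\<alpha> (n + N) \<in> {0..B}" for n
  proof -
    have "\<alpha> (n + N) * (w \<bullet> g (n + N)) \<le> w \<bullet> f (n + N)"
      using w_mono[OF a(2)[of "n + N"]] by simp
    moreover have "\<alpha> (n + N) * ((w \<bullet> y) / 2) \<le> \<alpha> (n + N) * (w \<bullet> g (n + N))"
      using N[of "n + N"] a(1)[of "n + N"] by (intro mult_left_mono) auto
    ultimately have "\<alpha> (n + N) * ((w \<bullet> y) / 2) \<le> w \<bullet> x + 1"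
      using N[of "n + N"] by simp
    then have "\<alpha> (n + N) \<le> B"
      using wy unfolding B_def by (simp add: pos_le_divide_eq)
    then show ?thesis
      using a(1)[of "n + N"] by auto
  qed
  then obtain l \<rho> where l: "l \<in> {0..B}" "strict_mono (\<rho> :: nat \<Rightarrow> nat)" "((\<lambda>n. \<alpha> (n + N)) \<circ> \<rho>) \<longlonglongrightarrow> l"
    using compact_Icc[of 0 B] unfolding compact_def by metis
  define \<sigma> where "\<sigma> n = \<rho> n + N" for n
  have \<sigma>: "strict_mono \<sigma>"
    using l(2) by (auto simp: strict_mono_def \<sigma>_def)
  have lims: "(\<lambda>n. \<alpha> (\<sigma> n)) \<longlonglongrightarrow> l" "(\<lambda>n. f (\<sigma> n)) \<longlonglongrightarrow> x" "(\<lambda>n. g (\<sigma> n)) \<longlonglongrightarrow> y"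
    using l(3) LIMSEQ_subseq_LIMSEQ[OF assms(1) \<sigma>] LIMSEQ_subseq_LIMSEQ[OF assms(2) \<sigma>]
    by (auto simp: o_def \<sigma>_def)
  have 1: "l *\<^sub>R y \<preceq> x"
    by (rule le_lim[OF tendsto_scaleR[OF lims(1,3)] lims(2) a(2)])
  have 2: "x \<preceq> (l * \<beta>) *\<^sub>R y"
    by (rule le_lim[OF lims(2) tendsto_scaleR[OF tendsto_mult[OF lims(1) tendsto_const] lims(3)] a(3)])
  have "0 < l"
  proof (rule ccontr)
    assume "\<not> 0 < l"
    then have "l = 0"
      using l by simp
    then show False
      using w_mono[OF 2] wx by simp
  qed
  then show ?thesis
    using 1 2 unfolding rel_def by blast
qed

text \<open>The weights are not normalized, so they absorb the factor \<alpha> of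
  \<open>rel\<close>. In this homogeneous form the vectors near a face form a convex cone, and
  \<beta> = 1 means lying in the cone over the vertices.\<close>

definition near :: "real \<Rightarrow> (nat \<Rightarrow> 'a) \<Rightarrow> nat set \<Rightarrow> 'a \<Rightarrow> bool"
  where "near \<beta> a I v \<longleftrightarrow> (\<exists>\<tau>. (\<forall>i\<in>I. 0 \<le> \<tau> i) \<and>
    (\<Sum>i\<in>I. \<tau> i *\<^sub>R a i) \<preceq> v \<and> v \<preceq> \<beta> *\<^sub>R (\<Sum>i\<in>I. \<tau> i *\<^sub>R a i))"

lemma near_add:
  assumes "near \<beta> a I x" "near \<beta> a I y" "0 \<le> s" "0 \<le> t"
  shows "near \<beta> a I (s *\<^sub>R x + t *\<^sub>R y)"
proof -
  obtain \<tau> \<sigma> where t: "\<forall>i\<in>I. 0 \<le> \<tau> i" "(\<Sum>i\<in>I. \<tau> i *\<^sub>R a i) \<preceq> x" "x \<preceq> \<beta> *\<^sub>R (\<Sum>i\<in>I. \<tau> i *\<^sub>R a i)"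
    and s: "\<forall>i\<in>I. 0 \<le> \<sigma> i" "(\<Sum>i\<in>I. \<sigma> i *\<^sub>R a i) \<preceq> y" "y \<preceq> \<beta> *\<^sub>R (\<Sum>i\<in>I. \<sigma> i *\<^sub>R a i)"
    using assms(1,2) unfolding near_def by blast
  have eq: "(\<Sum>i\<in>I. (s * \<tau> i + t * \<sigma> i) *\<^sub>R a i) =
    s *\<^sub>R (\<Sum>i\<in>I. \<tau> i *\<^sub>R a i) + t *\<^sub>R (\<Sum>i\<in>I. \<sigma> i *\<^sub>R a i)"
    by (simp add: scaleR_add_left sum.distrib scaleR_right.sum)
  show ?thesis
    unfolding near_def
  proof (intro exI[of _ "\<lambda>i. s * \<tau> i + t * \<sigma> i"] conjI)
    show "\<forall>i\<in>I. 0 \<le> s * \<tau> i + t * \<sigma> i"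
      using t s assms by auto
    show "(\<Sum>i\<in>I. (s * \<tau> i + t * \<sigma> i) *\<^sub>R a i) \<preceq> s *\<^sub>R x + t *\<^sub>R y"
      unfolding eq using t s assms by (intro le_add le_scale)
    show "s *\<^sub>R x + t *\<^sub>R y \<preceq> \<beta> *\<^sub>R (\<Sum>i\<in>I. (s * \<tau> i + t * \<sigma> i) *\<^sub>R a i)"
      using le_add[OF le_scale[OF assms(3) t(3)] le_scale[OF assms(4) s(3)]]
      by (simp add: eq scaleR_add_right mult.commute)
  qed
qed

lemma near_mono:
  assumes "near \<beta> a I v" "\<beta> \<le> \<gamma>" "\<And>i. i \<in> I \<Longrightarrow> 0 \<preceq> a i"
  shows "near \<gamma> a I v"
proof -
  obtain \<tau> where t: "\<forall>i\<in>I. 0 \<le> \<tau> i" "(\<Sum>i\<in>I. \<tau> i *\<^sub>R a i) \<preceq> v" "v \<preceq> \<beta> *\<^sub>R (\<Sum>i\<in>I. \<tau> i *\<^sub>R a i)"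
    using assms unfolding near_def by blast
  have "(\<Sum>i\<in>I. 0) \<preceq> (\<Sum>i\<in>I. \<tau> i *\<^sub>R a i)"
    by (rule le_sum) (use le_scale[of _ 0] t assms(3) in fastforce)
  then have "\<beta> *\<^sub>R (\<Sum>i\<in>I. \<tau> i *\<^sub>R a i) \<preceq> \<gamma> *\<^sub>R (\<Sum>i\<in>I. \<tau> i *\<^sub>R a i)"
    using assms(2) by (intro le_scale_mono) auto
  then show ?thesis
    unfolding near_def using t le_trans by blast
qed

text \<open>With vertices normalized by w, the weights sum to at most w \<bullet> u n; hence they
  are bounded and converge along a subsequence. Vertices and point may tend to the boundary.\<close>

lemma near_lim:
  assumes I: "finite I" and a: "\<And>i. i \<in> I \<Longrightarrow> (\<lambda>n. f n i) \<longlonglongrightarrow> a i" and v: "u \<longlonglongrightarrow> v"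
    and pos: "\<And>n i. i \<in> I \<Longrightarrow> w \<bullet> f n i = 1"
    and near: "\<And>n. near \<beta> (f n) I (u n)"
  shows "near \<beta> a I v"
proof -
  obtain \<tau> where t: "\<And>n. \<forall>i\<in>I. 0 \<le> \<tau> n i" "\<And>n. (\<Sum>i\<in>I. \<tau> n i *\<^sub>R f n i) \<preceq> u n"
    "\<And>n. u n \<preceq> \<beta> *\<^sub>R (\<Sum>i\<in>I. \<tau> n i *\<^sub>R f n i)"
    using near unfolding near_def by metis
  have "Bseq u"
    using v convergentI convergent_imp_Bseq by blast
  then obtain B where B: "\<And>n. norm (u n) \<le> B"
    unfolding Bseq_def by blast
  \<comment> \<open>Extension by zero provides weights for a full initial segment of indices, as
    \<open>convergent_subseq_family\<close> expects.\<close>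
  define \<tau>' where "\<tau>' n i = (if i \<in> I then \<tau> n i else 0)" for n i
  have bd: "\<tau>' n i \<in> {0..norm w * B}" for n i
  proof (cases "i \<in> I")
    case True
    have "\<tau> n i \<le> sum (\<tau> n) I"
      using True t I by (intro member_le_sum) auto
    also have "\<dots> = w \<bullet> (\<Sum>i\<in>I. \<tau> n i *\<^sub>R f n i)"
      using pos by (simp add: inner_sum_right)
    also have "\<dots> \<le> w \<bullet> u n"
      using w_mono t by blast
    also have "\<dots> \<le> norm w * norm (u n)"
      by (rule norm_cauchy_schwarz)
    also have "\<dots> \<le> norm w * B"
      using B by (intro mult_left_mono) auto
    finally show ?thesis
      using t True by (simp add: \<tau>'_def)
  next
    case False
    moreover have "0 \<le> B"
      using B norm_ge_zero order_trans by blast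
    ultimately show ?thesis
      by (simp add: \<tau>'_def)
  qed
  define m where "m = Max (insert 0 I)"
  have m: "i \<le> m" if "i \<in> I" for i
    using that I by (simp add: m_def)
  obtain l \<rho> where l: "strict_mono (\<rho> :: nat \<Rightarrow> nat)"
    "\<And>i. i \<le> m \<Longrightarrow> l i \<in> {0..norm w * B} \<and> (\<lambda>n. \<tau>' (\<rho> n) i) \<longlonglongrightarrow> l i"
    using convergent_subseq_family[OF compact_Icc, of m \<tau>'] bd by metis
  have l2: "(\<lambda>n. \<tau> (\<rho> n) i) \<longlonglongrightarrow> l i" if "i \<in> I" for i
    using l(2)[OF m[OF that]] that by (simp add: \<tau>'_def)
  have a2: "(\<lambda>n. f (\<rho> n) i) \<longlonglongrightarrow> a i" if "i \<in> I" for i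
    using LIMSEQ_subseq_LIMSEQ[OF a[OF that] l(1)] by (simp add: o_def)
  have v2: "(\<lambda>n. u (\<rho> n)) \<longlonglongrightarrow> v"
    using LIMSEQ_subseq_LIMSEQ[OF v l(1)] by (simp add: o_def)
  have s: "(\<lambda>n. \<Sum>i\<in>I. \<tau> (\<rho> n) i *\<^sub>R f (\<rho> n) i) \<longlonglongrightarrow> (\<Sum>i\<in>I. l i *\<^sub>R a i)"
    by (intro tendsto_intros l2 a2)
  have "(\<Sum>i\<in>I. l i *\<^sub>R a i) \<preceq> v"
    by (rule le_lim[OF s v2 t(2)])
  moreover have "v \<preceq> \<beta> *\<^sub>R (\<Sum>i\<in>I. l i *\<^sub>R a i)"
    by (rule le_lim[OF v2 tendsto_scaleR[OF tendsto_const s] t(3)])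
  ultimately show ?thesis
    unfolding near_def using l(2) m by (metis atLeastAtMost_iff)
qed

text \<open>At a point of C the weights can stay fixed. Shrinking them by a factor strictly between
  \<beta> / \<gamma> and 1 turns both inequalities into membership of a difference in the open cone,
  which survives small changes of the vertices and of the point.\<close>

lemma near_perturb:
  assumes I: "finite I" and a: "\<And>i. i \<in> I \<Longrightarrow> (\<lambda>n. f n i) \<longlonglongrightarrow> a i" and v: "u \<longlonglongrightarrow> v"
    and "v \<in> C" and "near \<beta> a I v" and "0 < \<beta>" "\<beta> < \<gamma>" and pos: "\<And>i. i \<in> I \<Longrightarrow> 0 \<preceq> a i"
  shows "\<forall>\<^sub>F n in sequentially. near \<gamma> (f n) I (u n)"
proof -
  obtain \<tau> where t: "\<forall>i\<in>I. 0 \<le> \<tau> i" "(\<Sum>i\<in>I. \<tau> i *\<^sub>R a i) \<preceq> v"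
    "v \<preceq> \<beta> *\<^sub>R (\<Sum>i\<in>I. \<tau> i *\<^sub>R a i)"
    using assms(5) unfolding near_def by blast
  define z where "z = (\<Sum>i\<in>I. \<tau> i *\<^sub>R a i)"
  have bz: "\<beta> *\<^sub>R z \<in> C"
    using C_up[OF assms(4) t(3)] by (simp add: z_def)
  then have z: "z \<in> C"
    using scale_C[of "inverse \<beta>" "\<beta> *\<^sub>R z"] assms by simp
  obtain \<theta> where th: "\<beta> / \<gamma> < \<theta>" "\<theta> < 1"
    using dense[of "\<beta> / \<gamma>" 1] assms by auto
  have "0 < \<beta> / \<gamma>"
    using assms by simp
  then have th0: "0 < \<theta>" "0 < \<gamma> * \<theta> - \<beta>"
    using th assms by (linarith, simp add: field_simps)
  have lz: "(\<lambda>n. \<Sum>i\<in>I. \<tau> i *\<^sub>R f n i) \<longlonglongrightarrow> z"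
    unfolding z_def by (intro tendsto_intros a)
  \<comment> \<open>This vector is (1 - \<theta>) v plus the nonnegative vector \<theta> (v -
    z).\<close>
  have 1: "v - \<theta> *\<^sub>R z \<in> C"
  proof -
    have "(1 - \<theta>) *\<^sub>R v \<in> C"
      using th assms by (intro scale_C) auto
    moreover have "(1 - \<theta>) *\<^sub>R v \<preceq> v - \<theta> *\<^sub>R z"
      using le_scale[of \<theta> z v] t th0 by (simp add: le_def z_def algebra_simps)
    ultimately show ?thesis by (rule C_up)
  qed
  have 2: "(\<gamma> * \<theta>) *\<^sub>R z - v \<in> C"
  proof -
    have "(\<gamma> * \<theta> - \<beta>) *\<^sub>R z \<in> C"
      using th0 z by (intro scale_C) auto
    moreover have "(\<gamma> * \<theta> - \<beta>) *\<^sub>R z \<preceq> (\<gamma> * \<theta>) *\<^sub>R z - v"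
      using t by (simp add: le_def z_def algebra_simps)
    ultimately show ?thesis by (rule C_up)
  qed
  have "\<forall>\<^sub>F n in sequentially. u n - \<theta> *\<^sub>R (\<Sum>i\<in>I. \<tau> i *\<^sub>R f n i) \<in> C"
    by (rule topological_tendstoD[OF _ open_C 1]) (intro tendsto_intros v lz)
  moreover have "\<forall>\<^sub>F n in sequentially. (\<gamma> * \<theta>) *\<^sub>R (\<Sum>i\<in>I. \<tau> i *\<^sub>R f n i) - u n \<in> C"
    by (rule topological_tendstoD[OF _ open_C 2]) (intro tendsto_intros v lz)
  ultimately show ?thesis
  proof eventually_elim
    case (elim n)
    have "(\<Sum>i\<in>I. (\<theta> * \<tau> i) *\<^sub>R f n i) = \<theta> *\<^sub>R (\<Sum>i\<in>I. \<tau> i *\<^sub>R f n i)"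
      by (simp add: scaleR_right.sum)
    moreover have "\<forall>i\<in>I. 0 \<le> \<theta> * \<tau> i"
      using th0 t by simp
    ultimately show ?case
      unfolding near_def using C_le[OF elim(1)] C_le[OF elim(2)]
      by (intro exI[of _ "\<lambda>i. \<theta> * \<tau> i"]) (simp add: le_def)
  qed
qed

lemma near_transform:
  assumes A: "linear A" "\<And>x y. x \<preceq> y \<Longrightarrow> A x \<preceq> A y"
    and s: "\<And>i. i \<in> I \<Longrightarrow> 0 < s i" and r: "0 < r" and near: "near \<beta> a I v"
  shows "near \<beta> (\<lambda>i. s i *\<^sub>R A (a i)) I (r *\<^sub>R A v)"
proof -
  obtain \<tau> where t: "\<forall>i\<in>I. 0 \<le> \<tau> i" "(\<Sum>i\<in>I. \<tau> i *\<^sub>R a i) \<preceq> v"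
    "v \<preceq> \<beta> *\<^sub>R (\<Sum>i\<in>I. \<tau> i *\<^sub>R a i)"
    using near unfolding near_def by blast
  have "(\<Sum>i\<in>I. (r * \<tau> i / s i) *\<^sub>R s i *\<^sub>R A (a i)) = (\<Sum>i\<in>I. (r * \<tau> i) *\<^sub>R A (a i))"
    using s by (intro sum.cong) (auto dest: order_less_imp_not_eq2)
  also have "\<dots> = r *\<^sub>R A (\<Sum>i\<in>I. \<tau> i *\<^sub>R a i)"
    using A(1) by (simp add: linear_sum linear_scale scaleR_right.sum)
  finally have eq: "(\<Sum>i\<in>I. (r * \<tau> i / s i) *\<^sub>R s i *\<^sub>R A (a i)) = r *\<^sub>R A (\<Sum>i\<in>I. \<tau> i *\<^sub>R a i)" .
  have "r *\<^sub>R A v \<preceq> \<beta> *\<^sub>R r *\<^sub>R A (\<Sum>i\<in>I. \<tau> i *\<^sub>R a i)"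
    using le_scale[OF _ A(2)[OF t(3)], of r] r A(1) by (simp add: linear_scale mult.commute)
  then show ?thesis
    unfolding near_def using t r s A(2) le_scale
    by (intro exI[of _ "\<lambda>i. r * \<tau> i / s i"])
      (auto simp: eq simp del: scaleR_scaleR intro!: divide_nonneg_pos less_imp_le[OF r])
qed

section \<open>The compact slice, automorphisms and points far from all facets\<close>

lemma convex_C: "convex C"
proof (rule convexI)
  fix x y and u v :: real
  assume "x \<in> C" "y \<in> C" "0 \<le> u" "0 \<le> v" "u + v = 1"
  then show "u *\<^sub>R x + v *\<^sub>R y \<in> C"
    by (cases "u = 0"; cases "v = 0") (auto intro!: add_C scale_C)
qed

lemma le_antisym: "x \<preceq> y \<Longrightarrow> y \<preceq> x \<Longrightarrow> x = y"
proof -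
  assume "x \<preceq> y" "y \<preceq> x"
  then have "0 \<preceq> y - x" "w \<bullet> (y - x) = 0"
    using w_mono[of x y] w_mono[of y x] by (auto simp: le_def inner_diff_right)
  then show ?thesis
    using w_pos[of "y - x"] by auto
qed

lemma zero_le_sum: "(\<And>i. i \<in> I \<Longrightarrow> 0 \<le> \<tau> i) \<Longrightarrow> (\<And>i. i \<in> I \<Longrightarrow> 0 \<preceq> a i) \<Longrightarrow> 0 \<preceq> (\<Sum>i\<in>I. \<tau> i *\<^sub>R a i)"
  using le_sum[of I "\<lambda>_. 0" "\<lambda>i. \<tau> i *\<^sub>R a i"] le_scale[of _ 0] by simp

lemma near_one_iff: "near 1 a I v \<longleftrightarrow> (\<exists>\<tau>. (\<forall>i\<in>I. 0 \<le> \<tau> i) \<and> v = (\<Sum>i\<in>I. \<tau> i *\<^sub>R a i))"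
  unfolding near_def using le_antisym by fastforce

definition base :: "'a set"
  where "base = {v. 0 \<preceq> v \<and> w \<bullet> v = 1}"

lemma compact_base: "compact base"
proof -
  have "base = closure C \<inter> {v. w \<bullet> v = 1}"
    by (auto simp: base_def zero_le_iff)
  then have "closed base"
    by (simp add: closed_Int closed_hyperplane)
  moreover have "norm v \<le> 1 / c" if "v \<in> base" for v
    using that c_bound'[of v] c_pos by (simp add: base_def field_simps)
  then have "bounded base"
    unfolding bounded_iff by blast
  ultimately show ?thesis
    by (simp add: compact_eq_bounded_closed)
qed

lemma base_D: "v \<in> base \<Longrightarrow> 0 \<preceq> v" "v \<in> base \<Longrightarrow> w \<bullet> v = 1" "v \<in> base \<Longrightarrow> v \<noteq> 0"
  by (auto simp: base_def)

lemma aut_le: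
  assumes "linear A" "inj A" "A ` C = C"
  shows "A x \<preceq> A y \<longleftrightarrow> x \<preceq> y"
proof -
  have "A ` closure C = closure C"
    using closure_injective_linear_image[OF assms(1,2), of C] assms(3) by simp
  then have "A v \<in> closure C \<longleftrightarrow> v \<in> closure C" for v
    using assms(2) by (metis inj_image_mem_iff)
  then show ?thesis
    using assms(1) by (simp add: le_def flip: linear_diff)
qed

text \<open>Each vertex may carry its own scalar because the weights absorb it. An automorphism of
  the cone need not preserve w, so these scalars are what returns the vertices to the slice w =
  1.\<close>

lemma near_transform_iff:
  assumes A: "linear A" "inj A" "A ` C = C" and s: "\<And>i. i \<in> I \<Longrightarrow> 0 < s i" and r: "0 < r"
  shows "near \<beta> (\<lambda>i. s i *\<^sub>R A (a i)) I (r *\<^sub>R A v) \<longleftrightarrow> near \<beta> a I v"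
proof
  assume n: "near \<beta> (\<lambda>i. s i *\<^sub>R A (a i)) I (r *\<^sub>R A v)"
  obtain B where B: "linear B" "\<And>x. B (A x) = x" "\<And>x. A (B x) = x"
    using linear_injective_isomorphism[OF A(1,2)] by blast
  have "B x \<preceq> B y" if "x \<preceq> y" for x y
    using aut_le[OF A, of "B x" "B y"] that B(3) by simp
  from near_transform[OF B(1) this _ _ n, of "\<lambda>i. inverse (s i)" "inverse r"]
  have "near \<beta> (\<lambda>i. inverse (s i) *\<^sub>R B (s i *\<^sub>R A (a i))) I (inverse r *\<^sub>R B (r *\<^sub>R A v))"
    using s r by simp
  moreover have "inverse (s i) *\<^sub>R B (s i *\<^sub>R A (a i)) = a i" if "i \<in> I" for i
    using s[OF that] B by (simp add: linear_scale)
  moreover have "inverse r *\<^sub>R B (r *\<^sub>R A v) = v"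
    using r B by (simp add: linear_scale)
  ultimately show "near \<beta> a I v"
    unfolding near_def by (simp cong: sum.cong)
next
  assume n: "near \<beta> a I v"
  have "A x \<preceq> A y" if "x \<preceq> y" for x y
    using that aut_le[OF A] by simp
  from near_transform[OF A(1) this, of I s r] s r n
  show "near \<beta> (\<lambda>i. s i *\<^sub>R A (a i)) I (r *\<^sub>R A v)"
    by blast
qed

lemma rel_transform:
  assumes A: "linear A" "inj A" "A ` C = C" and "rel \<beta> x y"
  shows "rel \<beta> (A x) (A y)"
proof -
  obtain \<alpha> where "0 < \<alpha>" "A (\<alpha> *\<^sub>R y) \<preceq> A x" "A x \<preceq> A ((\<alpha> * \<beta>) *\<^sub>R y)"
    using assms(4) aut_le[OF A] unfolding rel_def by blast
  then show ?thesis
    unfolding rel_def using A(1) by (auto simp: linear_scale)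
qed

lemma rel_transform_iff:
  assumes A: "linear A" "inj A" "A ` C = C" and st: "0 < s" "0 < t"
  shows "rel \<beta> (s *\<^sub>R A x) (t *\<^sub>R A y) \<longleftrightarrow> rel \<beta> x y"
proof
  assume "rel \<beta> (s *\<^sub>R A x) (t *\<^sub>R A y)"
  then obtain \<alpha> where a: "0 < \<alpha>" "\<alpha> *\<^sub>R t *\<^sub>R A y \<preceq> s *\<^sub>R A x" "s *\<^sub>R A x \<preceq> (\<alpha> * \<beta>) *\<^sub>R t *\<^sub>R A y"
    unfolding rel_def by blast
  then have "A ((\<alpha> * t) *\<^sub>R y) \<preceq> A (s *\<^sub>R x)" "A (s *\<^sub>R x) \<preceq> A ((\<alpha> * \<beta> * t) *\<^sub>R y)"
    using A(1) by (simp_all add: linear_scale)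
  then have "rel \<beta> (s *\<^sub>R x) (t *\<^sub>R y)"
    using a(1) st by (intro relI[of \<alpha> _ _ "\<alpha> * \<beta>"]) (simp_all add: aut_le[OF A])
  then show "rel \<beta> x y"
    using rel_scale[of "inverse s" "inverse t" \<beta> "s *\<^sub>R x" "t *\<^sub>R y"] st by simp
qed (use rel_transform[OF A] rel_scale st in blast)

text \<open>Two points of an open cone bound each other up to positive factors, so a single point of
  C in the cone over the face makes every point of C near that face.\<close>

lemma near_of_C:
  assumes "v \<in> C" "z \<in> C" "near 1 a I z"
  shows "\<exists>\<beta>\<ge>1. near \<beta> a I v"
proof -
  have small: "\<exists>e>0. y - e *\<^sub>R x \<in> C" if "y \<in> C" for x y
  proof -
    have "((\<lambda>e. y - e *\<^sub>R x) \<longlongrightarrow> y - 0 *\<^sub>R x) (at_right 0)"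
      by (intro tendsto_intros)
    then have "\<forall>\<^sub>F e in at_right 0. y - e *\<^sub>R x \<in> C"
      using open_C that by (intro topological_tendstoD) auto
    then have "\<forall>\<^sub>F e in at_right 0. y - e *\<^sub>R x \<in> C \<and> 0 < e"
      by (intro eventually_conj eventually_at_right_less)
    then show ?thesis
      using eventually_happens'[OF trivial_limit_at_right_real] by blast
  qed
  obtain d where d: "0 < d" "v - d *\<^sub>R z \<in> C"
    using small[OF assms(1)] by blast
  obtain e where e: "0 < e" "z - e *\<^sub>R v \<in> C"
    using small[OF assms(2)] by blast
  obtain \<tau> where t: "\<forall>i\<in>I. 0 \<le> \<tau> i" "z = (\<Sum>i\<in>I. \<tau> i *\<^sub>R a i)"
    using assms(3) unfolding near_one_iff by blast
  \<comment> \<open>From d z \<preceq> v \<preceq> (1 / e) z: with the weights of d z, the upper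
    bound is 1 / (d e) times the lower one.\<close>
  define \<beta> where "\<beta> = max 1 (1 / (d * e))"
  have sum: "(\<Sum>i\<in>I. (d * \<tau> i) *\<^sub>R a i) = d *\<^sub>R z"
    by (simp add: t scaleR_right.sum)
  have "(1 / e) *\<^sub>R e *\<^sub>R v \<preceq> (1 / e) *\<^sub>R z"
    using e C_le[OF e(2)] by (intro le_scale) (auto simp: le_def)
  also have "(1 / e) *\<^sub>R z \<preceq> (\<beta> * d) *\<^sub>R z"
  proof (rule le_scale_mono)
    have "1 / (d * e) * d \<le> \<beta> * d"
      using d by (intro mult_right_mono) (auto simp: \<beta>_def)
    then show "1 / e \<le> \<beta> * d"
      using d by simp
  qed (use C_le assms in blast)
  finally have "v \<preceq> \<beta> *\<^sub>R d *\<^sub>R z"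
    using e by simp
  moreover have "d *\<^sub>R z \<preceq> v"
    using C_le[OF d(2)] by (simp add: le_def)
  ultimately show ?thesis
    using d t unfolding near_def
    by (intro exI[of _ \<beta>] conjI exI[of _ "\<lambda>i. d * \<tau> i"]) (auto simp: \<beta>_def sum simp del: scaleR_scaleR)
qed

text \<open>If every point of the simplex were near some facet, the sets \<open>F j\<close> would
  cover it; they are closed and contain their facets, so \<open>KKM_facets\<close> would yield a
  point near all of them.\<close>

lemma center_or_far_point:
  assumes k: "1 \<le> k" and a: "\<And>i. i \<le> k \<Longrightarrow> a i \<in> C" and \<beta>: "1 \<le> \<beta>"
    and no: "\<not> (\<exists>x\<in>C. \<forall>j\<le>k. near \<beta> a ({..k} - {j}) x)"
  shows "\<exists>x\<in>C. near 1 a {..k} x \<and> (\<forall>j\<le>k. \<not> near \<beta> a ({..k} - {j}) x)"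
proof (rule ccontr)
  assume contr: "\<not> ?thesis"
  \<comment> \<open>Normalized vertices satisfy the hypothesis w = 1 of \<open>near_lim\<close>,
    from which the closedness of \<open>F j\<close> follows.\<close>
  define b where "b i = inverse (w \<bullet> a i) *\<^sub>R a i" for i
  have wb: "w \<bullet> b i = 1" if "i \<le> k" for i
    using w_pos_C[OF a[OF that]] by (simp add: b_def)
  have bC: "b i \<in> C" if "i \<le> k" for i
    using w_pos_C[OF a[OF that]] a[OF that] by (simp add: b_def scale_C)
  have nb: "near \<gamma> b I v \<longleftrightarrow> near \<gamma> a I v" if "I \<subseteq> {..k}" for \<gamma> I v
    using near_transform_iff[of id I "\<lambda>i. inverse (w \<bullet> a i)" 1 \<gamma> a v] w_pos_C[OF a] that
    by (auto simp: b_def[abs_def] linear_id subset_iff)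
  define S where "S = convex hull (b ` {..k})"
  define F where "F j = {x \<in> S. near \<beta> b ({..k} - {j}) x}" for j
  have SC: "S \<subseteq> C"
    unfolding S_def using bC convex_C by (intro hull_minimal) auto
  have hull: "near 1 b I x" if "x \<in> convex hull (b ` I)" "finite I" for I x
    using that unfolding near_one_iff by (auto simp: convex_hull_indexed)
  have facet: "convex hull (b ` ({..k} - {j})) \<subseteq> F j" if "j \<le> k" for j
  proof
    fix x assume x: "x \<in> convex hull (b ` ({..k} - {j}))"
    then have "near \<beta> b ({..k} - {j}) x"
      using near_mono[OF hull[OF x] \<beta>] C_le bC by simp
    moreover have "x \<in> S"
      unfolding S_def using x hull_mono[of "b ` ({..k} - {j})" "b ` {..k}"] by blast
    ultimately show "x \<in> F j"
      by (simp add: F_def)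
  qed
  have closed: "closed (F j)" if "j \<le> k" for j
    unfolding closed_sequential_limits
  proof (intro allI impI, elim conjE)
    fix f l assume f: "\<forall>n. f n \<in> F j" "f \<longlonglongrightarrow> l"
    have "closed S"
      unfolding S_def by (intro compact_imp_closed finite_imp_compact_convex_hull) auto
    then have "l \<in> S"
      using f closed_sequentially[of S f l] by (auto simp: F_def)
    moreover have "near \<beta> b ({..k} - {j}) l"
      by (rule near_lim[where f = "\<lambda>_. b"]) (use f wb in \<open>auto simp: F_def\<close>)
    ultimately show "l \<in> F j"
      by (simp add: F_def)
  qed
  have ne: "F j \<noteq> {}" if "j \<le> k" for j
  proof -
    obtain i where i: "i \<le> k" "i \<noteq> j"
      using k that by (cases "j = 0") auto
    then have "b i \<in> convex hull (b ` ({..k} - {j}))"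
      by (intro hull_inc) auto
    then show ?thesis
      using facet[OF that] by blast
  qed
  have cover: "S \<subseteq> (\<Union>j\<le>k. F j)"
  proof
    fix x assume x: "x \<in> S"
    then obtain j where "j \<le> k" "near \<beta> b ({..k} - {j}) x"
      using contr SC hull[of x "{..k}"] nb unfolding S_def
      by (metis (no_types, lifting) Diff_subset finite_atMost order_refl subsetD)
    then show "x \<in> (\<Union>j\<le>k. F j)"
      using x by (auto simp: F_def)
  qed
  obtain x where "x \<in> S" "\<forall>j\<le>k. x \<in> F j"
    using KKM_facets[OF closed facet _ ne] cover unfolding S_def by blast
  then show False
    using no SC nb by (auto simp: F_def)
qed

section \<open>Rays ending on the boundary and faces of codimension two\<close>

lemma scale_C_D:
  assumes "m *\<^sub>R x \<in> C" "0 \<preceq> x"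
  shows "x \<in> C"
proof -
  have "0 < m * (w \<bullet> x)"
    using w_pos_C[OF assms(1)] by simp
  then have "0 < m"
    using w_mono[OF assms(2)] by (simp add: zero_less_mult_iff)
  then show ?thesis
    using scale_C[OF _ assms(1), of "inverse m"] by simp
qed

lemma nearI:
  assumes "\<And>i. i \<in> I \<Longrightarrow> 0 \<le> \<tau> i" "(\<Sum>i\<in>I. \<tau> i *\<^sub>R a i) \<preceq> r *\<^sub>R v" "0 < r"
    "v \<preceq> \<mu> *\<^sub>R (\<Sum>i\<in>I. \<tau> i *\<^sub>R a i)"
  shows "near (\<mu> * r) a I v"
proof -
  have eq: "(\<Sum>i\<in>I. (\<tau> i / r) *\<^sub>R a i) = inverse r *\<^sub>R (\<Sum>i\<in>I. \<tau> i *\<^sub>R a i)"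
    by (simp add: scaleR_right.sum field_simps)
  have "inverse r *\<^sub>R (\<Sum>i\<in>I. \<tau> i *\<^sub>R a i) \<preceq> inverse r *\<^sub>R r *\<^sub>R v"
    using assms by (intro le_scale) auto
  then show ?thesis
    unfolding near_def using assms
    by (intro exI[of _ "\<lambda>i. \<tau> i / r"]) (auto simp: eq mult.assoc)
qed

text \<open>Lets \<open>near_perturb\<close>, applied to a face with one vertex, control the
  distance between two moving points.\<close>

lemma near_singleton_rel:
  assumes "near \<beta> a {i} x" "x \<in> C"
  shows "rel \<beta> x (a i)"
proof -
  obtain \<tau> where t: "0 \<le> \<tau> i" "\<tau> i *\<^sub>R a i \<preceq> x" "x \<preceq> (\<tau> i * \<beta>) *\<^sub>R a i"
    using assms(1) unfolding near_def by (auto simp: mult.commute)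
  have "\<tau> i \<noteq> 0"
    using C_up[OF assms(2) t(3)] zero_C by auto
  then show ?thesis
    unfolding rel_def using t by (intro exI[of _ "\<tau> i"]) auto
qed

lemma term_le_sum:
  assumes "finite I" "i \<in> I" "\<And>i. i \<in> I \<Longrightarrow> 0 \<le> \<tau> i" "\<And>i. i \<in> I \<Longrightarrow> 0 \<preceq> a i"
  shows "\<tau> i *\<^sub>R a i \<preceq> (\<Sum>i\<in>I. \<tau> i *\<^sub>R a i)"
proof -
  have "0 \<preceq> (\<Sum>i\<in>I - {i}. \<tau> i *\<^sub>R a i)"
    using assms by (intro zero_le_sum) auto
  then have "\<tau> i *\<^sub>R a i + 0 \<preceq> \<tau> i *\<^sub>R a i + (\<Sum>i\<in>I - {i}. \<tau> i *\<^sub>R a i)"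
    by (intro le_add) auto
  then show ?thesis
    using assms by (simp add: sum.remove)
qed

text \<open>The vertices dominated by \<open>\<xi>\<close> (predicate \<open>dom\<close> below) are those in the smallest closed
  face of the cone containing \<open>\<xi>\<close>.\<close>

lemma ray_near_codim2:
  assumes a: "\<And>i. i \<le> k \<Longrightarrow> a i \<in> base" and \<xi>: "\<xi> \<in> base" "\<xi> \<notin> C" and x: "x \<in> C"
    and \<beta>: "1 \<le> \<beta>"
    and near_x: "\<And>j. j \<le> k \<Longrightarrow> near \<beta> a ({..k} - {j}) x"
    and near_\<xi>: "\<And>j. j \<le> k \<Longrightarrow> near \<beta> a ({..k} - {j}) \<xi>"
  shows "\<exists>i j t. i \<le> k \<and> j \<le> k \<and> i \<noteq> j \<and> (\<forall>m. 0 < t m) \<and> t \<longlonglongrightarrow> 0 \<and>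
    (\<forall>m. near (3 * \<beta>\<^sup>2) a ({..k} - {i, j}) (\<xi> + t m *\<^sub>R x))"
proof -
  define dom where "dom i \<longleftrightarrow> (\<exists>b\<ge>0. a i \<preceq> b *\<^sub>R \<xi>)" for i
  define b where "b i = (SOME b. 0 \<le> b \<and> a i \<preceq> b *\<^sub>R \<xi>)" for i
  have b: "0 \<le> b i" "a i \<preceq> b i *\<^sub>R \<xi>" if "dom i" for i
    using someI_ex[of "\<lambda>b. 0 \<le> b \<and> a i \<preceq> b *\<^sub>R \<xi>"] that unfolding dom_def b_def by blast+
  have \<xi>0: "0 \<preceq> \<xi>" and x0: "0 \<preceq> x" and a0: "\<And>i. i \<le> k \<Longrightarrow> 0 \<preceq> a i"
    using \<xi> x a base_D C_le by auto
  \<comment> \<open>If \<xi> dominated every vertex, the footpoint of x in a facet would give x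
    \<preceq> r \<xi>, and \<xi> would lie in C together with x.\<close>
  have "\<exists>j\<^sub>0\<le>k. \<not> dom j\<^sub>0"
  proof (rule ccontr)
    assume "\<not> ?thesis"
    then have d: "dom i" if "i \<le> k" for i
      using that by blast
    obtain \<tau> where t: "\<And>i. i \<in> {..k} - {0} \<Longrightarrow> 0 \<le> \<tau> i"
      "x \<preceq> \<beta> *\<^sub>R (\<Sum>i\<in>{..k} - {0}. \<tau> i *\<^sub>R a i)"
      using near_x[of 0] unfolding near_def by blast
    have "(\<Sum>i\<in>{..k} - {0}. \<tau> i *\<^sub>R a i) \<preceq> (\<Sum>i\<in>{..k} - {0}. \<tau> i *\<^sub>R b i *\<^sub>R \<xi>)"
      using t b d by (intro le_sum le_scale) auto
    also have "\<dots> = (\<Sum>i\<in>{..k} - {0}. \<tau> i * b i) *\<^sub>R \<xi>"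
      by (simp add: scaleR_left.sum)
    finally have "x \<preceq> \<beta> *\<^sub>R (\<Sum>i\<in>{..k} - {0}. \<tau> i * b i) *\<^sub>R \<xi>"
      using \<beta> t(2) by (meson le_trans le_scale order.trans zero_le_one)
    then have "(\<beta> * (\<Sum>i\<in>{..k} - {0}. \<tau> i * b i)) *\<^sub>R \<xi> \<in> C"
      using C_up[OF x] by simp
    then show False
      using scale_C_D \<xi>0 \<xi>(2) by blast
  qed
  then obtain j\<^sub>0 where j0: "j\<^sub>0 \<le> k" "\<not> dom j\<^sub>0"
    by blast
  have supp: "dom i" if i: "i \<in> I" "0 < \<tau> i" and le: "(\<Sum>i\<in>I. \<tau> i *\<^sub>R a i) \<preceq> \<xi>"
    and I: "I \<subseteq> {..k}" "\<And>i. i \<in> I \<Longrightarrow> 0 \<le> \<tau> i" for i I \<tau>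
  proof -
    have "\<tau> i *\<^sub>R a i \<preceq> \<xi>"
      using le_trans[OF term_le_sum le] i I a0 finite_subset[OF I(1)] by blast
    then have "inverse (\<tau> i) *\<^sub>R \<tau> i *\<^sub>R a i \<preceq> inverse (\<tau> i) *\<^sub>R \<xi>"
      using i by (intro le_scale) auto
    then show ?thesis
      unfolding dom_def using i by (intro exI[of _ "inverse (\<tau> i)"]) auto
  qed
  \<comment> \<open>The footpoint of \<xi> in a facet is nonzero, and every vertex that it uses is
    dominated by \<xi>.\<close>
  have "\<exists>i\<^sub>0\<le>k. dom i\<^sub>0"
  proof -
    obtain \<tau> where t: "\<And>i. i \<in> {..k} - {0} \<Longrightarrow> 0 \<le> \<tau> i"
      "(\<Sum>i\<in>{..k} - {0}. \<tau> i *\<^sub>R a i) \<preceq> \<xi>" "\<xi> \<preceq> \<beta> *\<^sub>R (\<Sum>i\<in>{..k} - {0}. \<tau> i *\<^sub>R a i)"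
      using near_\<xi>[of 0] unfolding near_def by blast
    have "\<exists>i\<in>{..k} - {0}. \<tau> i \<noteq> 0"
    proof (rule ccontr)
      assume "\<not> ?thesis"
      then have "\<xi> \<preceq> 0"
        using t(3) by (simp add: sum.neutral)
      then show False
        using w_mono \<xi>(1) base_D(2) by fastforce
    qed
    then show ?thesis
      using supp[OF _ _ t(2)] t(1) by (metis Diff_iff Diff_subset atMost_iff order_less_le)
  qed
  then obtain i\<^sub>0 where i0: "i\<^sub>0 \<le> k" "dom i\<^sub>0"
    by blast
  have ij: "i\<^sub>0 \<noteq> j\<^sub>0"
    using i0 j0 by blast
  define G where "G = {..k} - {i\<^sub>0, j\<^sub>0}"
  obtain \<sigma> where s: "\<And>i. i \<in> {..k} - {i\<^sub>0} \<Longrightarrow> 0 \<le> \<sigma> i"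
    "(\<Sum>i\<in>{..k} - {i\<^sub>0}. \<sigma> i *\<^sub>R a i) \<preceq> \<xi>" "\<xi> \<preceq> \<beta> *\<^sub>R (\<Sum>i\<in>{..k} - {i\<^sub>0}. \<sigma> i *\<^sub>R a i)"
    using near_\<xi>[OF i0(1)] unfolding near_def by blast
  \<comment> \<open>The footpoint of \<xi> in the facet omitting \<open>i\<^sub>0\<close> cannot use
    the vertex \<open>j\<^sub>0\<close>, which \<xi> does not dominate. So this footpoint is y and
    lies in the face of codimension two.\<close>
  define y where "y = (\<Sum>i\<in>G. \<sigma> i *\<^sub>R a i)"
  have "j\<^sub>0 \<in> {..k} - {i\<^sub>0}"
    using j0 ij by auto
  then have "\<not> 0 < \<sigma> j\<^sub>0" "0 \<le> \<sigma> j\<^sub>0"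
    using supp[OF _ _ s(2), of j\<^sub>0] s(1) j0(2) by blast+
  then have "\<sigma> j\<^sub>0 = 0"
    by simp
  then have y: "(\<Sum>i\<in>{..k} - {i\<^sub>0}. \<sigma> i *\<^sub>R a i) = y"
    unfolding y_def G_def by (intro sum.mono_neutral_right) auto
  define t where "t m = inverse (real (Suc m))" for m
  have tpos: "0 < t m" "t m \<le> 1" for m
    by (auto simp: t_def field_simps)
  have tlim: "t \<longlonglongrightarrow> 0"
    unfolding t_def by (rule LIMSEQ_inverse_real_of_nat)
  define v where "v m = \<xi> + t m *\<^sub>R x" for m
  have v0: "0 \<preceq> t m *\<^sub>R x" for m
    using x0 le_scale[of "t m" 0 x] tpos(1)[of m] by simp
  have \<xi>v: "\<xi> \<preceq> v m" for m
    using le_add[OF le_refl v0[of m], of \<xi>] by (simp add: v_def)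
  have vlim: "v \<longlonglongrightarrow> \<xi>"
    using tendsto_add[OF tendsto_const tendsto_scaleR[OF tlim tendsto_const], of \<xi> x]
    by (simp add: v_def[abs_def])
  have "near \<beta> a ({..k} - {j\<^sub>0}) (v m)" for m
    using near_add[OF near_\<xi>[OF j0(1)] near_x[OF j0(1)], of 1 "t m"] tpos(1)[of m] by (simp add: v_def)
  then obtain \<tau> where \<tau>: "\<And>m i. i \<in> {..k} - {j\<^sub>0} \<Longrightarrow> 0 \<le> \<tau> m i"
    "\<And>m. (\<Sum>i\<in>{..k} - {j\<^sub>0}. \<tau> m i *\<^sub>R a i) \<preceq> v m"
    "\<And>m. v m \<preceq> \<beta> *\<^sub>R (\<Sum>i\<in>{..k} - {j\<^sub>0}. \<tau> m i *\<^sub>R a i)"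
    unfolding near_def by metis
  have bd: "(if i = j\<^sub>0 then 0 else \<tau> m i) \<in> {0..1 + w \<bullet> x}" if "i \<le> k" for m i
  proof (cases "i = j\<^sub>0")
    case False
    have "\<tau> m i *\<^sub>R a i \<preceq> v m"
      by (rule le_trans[OF term_le_sum \<tau>(2)]) (use \<tau> that False a0 in auto)
    then have "\<tau> m i \<le> w \<bullet> v m"
      using w_mono[of "\<tau> m i *\<^sub>R a i"] base_D(2)[OF a[OF that]] by simp
    also have "\<dots> = 1 + t m * (w \<bullet> x)"
      using base_D(2)[OF \<xi>(1)] by (simp add: v_def inner_add_right)
    also have "\<dots> \<le> 1 + w \<bullet> x"
      using tpos[of m] w_pos_C[OF x] by (simp add: mult_left_le_one_le)
    finally show ?thesis
      using \<tau>(1)[of i m] that False by simp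
  qed (use w_pos_C[OF x] in simp)
  have "\<exists>l \<rho>. strict_mono (\<rho> :: nat \<Rightarrow> nat) \<and>
      (\<forall>i\<le>k. l i \<in> {0..1 + w \<bullet> x} \<and> (\<lambda>n. (if i = j\<^sub>0 then 0 else \<tau> (\<rho> n) i)) \<longlonglongrightarrow> l i)"
    by (rule convergent_subseq_family[OF compact_Icc, where f = "\<lambda>m i. if i = j\<^sub>0 then 0 else \<tau> m i"])
      (rule bd)
  then obtain l \<rho> where \<rho>: "strict_mono (\<rho> :: nat \<Rightarrow> nat)"
    and L: "\<And>i. i \<le> k \<Longrightarrow> (\<lambda>n. (if i = j\<^sub>0 then 0 else \<tau> (\<rho> n) i)) \<longlonglongrightarrow> l i"
    by blast
  have l: "(\<lambda>n. \<tau> (\<rho> n) i) \<longlonglongrightarrow> l i" if "i \<le> k" "i \<noteq> j\<^sub>0" for i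
    using L[OF that(1)] that(2) by simp
  define P where "P = {i. i \<le> k \<and> i \<noteq> j\<^sub>0 \<and> dom i}"
  define Q where "Q = {i. i \<le> k \<and> i \<noteq> j\<^sub>0 \<and> \<not> dom i}"
  have PQ: "{..k} - {j\<^sub>0} = P \<union> Q" "P \<inter> Q = {}" "finite P" "finite Q" "Q \<subseteq> G"
    using i0 by (auto simp: P_def Q_def G_def)
  define p where "p m = (\<Sum>i\<in>P. \<tau> m i *\<^sub>R a i)" for m
  define q where "q m = (\<Sum>i\<in>Q. \<tau> m i *\<^sub>R a i)" for m
  have split: "(\<Sum>i\<in>{..k} - {j\<^sub>0}. \<tau> m i *\<^sub>R a i) = p m + q m" for m
    unfolding PQ(1) p_def q_def by (rule sum.union_disjoint) (use PQ in auto)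
  have p0: "0 \<preceq> p m" for m
    unfolding p_def by (intro zero_le_sum \<tau>(1) a0) (auto simp: P_def)
  have q0: "0 \<preceq> q m" for m
    unfolding q_def by (intro zero_le_sum \<tau>(1) a0) (auto simp: Q_def)
  have qv: "q m \<preceq> v m" and pv: "p m \<preceq> v m" for m
    using le_trans[OF le_add[OF p0 le_refl, of "q m" m]] le_trans[OF le_add[OF le_refl q0, of "p m" m]]
      \<tau>(2)[of m] by (auto simp: split)
  define p' where "p' = (\<Sum>i\<in>P. l i *\<^sub>R a i)"
  have "(\<lambda>m. p (\<rho> m)) \<longlonglongrightarrow> p'"
    unfolding p_def p'_def by (intro tendsto_intros l) (auto simp: P_def)
  moreover have "(\<lambda>m. v (\<rho> m)) \<longlonglongrightarrow> \<xi>"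
    using LIMSEQ_subseq_LIMSEQ[OF vlim \<rho>] by (simp add: o_def)
  ultimately have p': "p' \<preceq> \<xi>"
    by (rule le_lim) (rule pv)
  \<comment> \<open>Convergence alone gives no order estimate against \<xi>, which lies on the
    boundary. For dominated vertices, however, a change of weights costs at most a multiple of
    \<xi>, so p is eventually below p' + \<xi> \<preceq> 2 \<xi>.\<close>
  have "(\<lambda>m. \<Sum>i\<in>P. \<bar>\<tau> (\<rho> m) i - l i\<bar> * b i) \<longlonglongrightarrow> (\<Sum>i\<in>P. \<bar>l i - l i\<bar> * b i)"
    by (intro tendsto_intros l) (auto simp: P_def)
  then have "\<forall>\<^sub>F m in sequentially. (\<Sum>i\<in>P. \<bar>\<tau> (\<rho> m) i - l i\<bar> * b i) < 1"
    by (rule order_tendstoD) simp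
  then obtain N where N: "\<And>m. N \<le> m \<Longrightarrow> (\<Sum>i\<in>P. \<bar>\<tau> (\<rho> m) i - l i\<bar> * b i) < 1"
    unfolding eventually_sequentially by blast
  have p2: "p (\<rho> m) \<preceq> 2 *\<^sub>R \<xi>" if "N \<le> m" for m
  proof -
    have "p (\<rho> m) - p' = (\<Sum>i\<in>P. (\<tau> (\<rho> m) i - l i) *\<^sub>R a i)"
      by (simp add: p_def p'_def sum_subtractf scaleR_diff_left)
    also have "\<dots> \<preceq> (\<Sum>i\<in>P. (\<bar>\<tau> (\<rho> m) i - l i\<bar> * b i) *\<^sub>R \<xi>)"
    proof (rule le_sum)
      fix i assume i: "i \<in> P"
      have "(\<tau> (\<rho> m) i - l i) *\<^sub>R a i \<preceq> \<bar>\<tau> (\<rho> m) i - l i\<bar> *\<^sub>R a i"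
        using i a0 by (intro le_scale_mono) (auto simp: P_def)
      also have "\<dots> \<preceq> \<bar>\<tau> (\<rho> m) i - l i\<bar> *\<^sub>R b i *\<^sub>R \<xi>"
        using i b by (intro le_scale) (auto simp: P_def)
      finally show "(\<tau> (\<rho> m) i - l i) *\<^sub>R a i \<preceq> (\<bar>\<tau> (\<rho> m) i - l i\<bar> * b i) *\<^sub>R \<xi>"
        by simp
    qed
    also have "\<dots> = (\<Sum>i\<in>P. \<bar>\<tau> (\<rho> m) i - l i\<bar> * b i) *\<^sub>R \<xi>"
      by (simp add: scaleR_left.sum)
    also have "\<dots> \<preceq> 1 *\<^sub>R \<xi>"
      using N[OF that] \<xi>0 by (intro le_scale_mono) auto
    finally show ?thesis
      using le_add[OF _ p', of "p (\<rho> m) - p'"] by (simp add: scaleR_2)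
  qed
  have main: "near (3 * \<beta>\<^sup>2) a G (v (\<rho> m))" if "N \<le> m" for m
  proof -
    \<comment> \<open>The dominated part p \<preceq> 2 \<xi> \<preceq> 2 \<beta> y is replaced by 2
      \<beta> y. In the other direction, y \<preceq> \<xi> \<preceq> v and q \<preceq> v give z
      \<preceq> (2 \<beta> + 1) v, whence the constant \<beta> (2 \<beta> + 1) \<le> 3
      \<beta>^2.\<close>
    define z where "z = (2 * \<beta>) *\<^sub>R y + q (\<rho> m)"
    define \<zeta> where "\<zeta> i = 2 * \<beta> * \<sigma> i + (if i \<in> Q then \<tau> (\<rho> m) i else 0)" for i
    have z: "z = (\<Sum>i\<in>G. \<zeta> i *\<^sub>R a i)"
    proof -
      have "q (\<rho> m) = (\<Sum>i\<in>G. (if i \<in> Q then \<tau> (\<rho> m) i else 0) *\<^sub>R a i)"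
        unfolding q_def using PQ(5)
        by (intro sum.mono_neutral_cong_left) (auto simp: G_def)
      then show ?thesis
        by (simp add: z_def \<zeta>_def y_def scaleR_right.sum scaleR_add_left sum.distrib)
    qed
    have \<zeta>: "0 \<le> \<zeta> i" if "i \<in> G" for i
      using that \<beta> s(1)[of i] \<tau>(1)[of i "\<rho> m"] by (auto simp: \<zeta>_def G_def)
    have "2 *\<^sub>R \<xi> \<preceq> 2 *\<^sub>R \<beta> *\<^sub>R y"
      using s(3) by (intro le_scale) (auto simp: y)
    then have "p (\<rho> m) + q (\<rho> m) \<preceq> z"
      unfolding z_def using p2[OF that] by (intro le_add) (auto intro: le_trans)
    then have 1: "v (\<rho> m) \<preceq> \<beta> *\<^sub>R z"
      using \<tau>(3)[of "\<rho> m"] \<beta> unfolding split by (meson le_trans le_scale order.trans zero_le_one)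
    have "(2 * \<beta>) *\<^sub>R y \<preceq> (2 * \<beta>) *\<^sub>R v (\<rho> m)"
      using \<beta> s(2) \<xi>v le_trans by (intro le_scale) (auto simp: y)
    then have "z \<preceq> (2 * \<beta>) *\<^sub>R v (\<rho> m) + v (\<rho> m)"
      unfolding z_def using qv by (intro le_add)
    then have 2: "z \<preceq> (2 * \<beta> + 1) *\<^sub>R v (\<rho> m)"
      by (simp add: scaleR_add_left)
    have "near (\<beta> * (2 * \<beta> + 1)) a G (v (\<rho> m))"
      by (rule nearI[of G \<zeta>]) (use 1 2 z \<zeta> \<beta> in auto)
    moreover have "\<beta> * (2 * \<beta> + 1) \<le> 3 * \<beta>\<^sup>2"
      using \<beta> by (simp add: power2_eq_square algebra_simps)
    ultimately show ?thesis
      by (rule near_mono) (use a0 in \<open>auto simp: G_def\<close>)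
  qed
  have "(\<lambda>m. t (\<rho> (m + N))) \<longlonglongrightarrow> 0"
    using LIMSEQ_ignore_initial_segment[OF LIMSEQ_subseq_LIMSEQ[OF tlim \<rho>], of N] by (simp add: o_def)
  then show ?thesis
    using main i0(1) j0(1) ij tpos unfolding G_def v_def
    by (intro exI[of _ i\<^sub>0] exI[of _ j\<^sub>0] exI[of _ "\<lambda>m. t (\<rho> (m + N))"]) auto
qed

section \<open>Chords of the cone and the cross ratio\<close>

lemma line_ends:
  assumes x: "x \<in> C" "w \<bullet> x = 1" and y: "y \<in> C" "w \<bullet> y = 1" and ne: "x \<noteq> y"
  obtains s t where "s < 0" "1 < t" "\<And>u. x + u *\<^sub>R (y - x) \<in> closure C \<longleftrightarrow> s \<le> u \<and> u \<le> t"
    "x + s *\<^sub>R (y - x) \<notin> C" "x + t *\<^sub>R (y - x) \<notin> C"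
proof -
  define l where "l u = x + u *\<^sub>R (y - x)" for u
  define T where "T = {u. l u \<in> closure C}"
  have contl: "continuous_on UNIV l"
    unfolding l_def by (intro continuous_intros)
  have "closed T"
    using continuous_closed_vimage[OF closed_closure, of l C] contl
    by (simp add: T_def vimage_def continuous_on_eq_continuous_at)
  moreover have bd: "\<bar>u\<bar> \<le> (1 / c + norm x) / norm (y - x)" if "u \<in> T" for u
  proof -
    have "c * norm (l u) \<le> 1"
      using c_bound'[of "l u"] that x y by (simp add: T_def zero_le_iff l_def inner_add_right inner_diff_right)
    then have "norm (l u) \<le> 1 / c"
      using c_pos by (simp add: field_simps)
    moreover have "\<bar>u\<bar> * norm (y - x) = norm (l u - x)"
      by (simp add: l_def)
    ultimately have "\<bar>u\<bar> * norm (y - x) \<le> 1 / c + norm x"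
      using norm_triangle_ineq4[of "l u" x] by linarith
    then show ?thesis
      using ne by (simp add: field_simps)
  qed
  then have "bounded T"
    unfolding bounded_iff real_norm_def by blast
  ultimately have "compact T"
    by (simp add: compact_eq_bounded_closed)
  moreover have "convex T"
  proof (rule convexI)
    fix p q and u v :: real
    assume pq: "p \<in> T" "q \<in> T" and uv: "0 \<le> u" "0 \<le> v" "u + v = 1"
    have u: "u = 1 - v"
      using uv by simp
    have "l (u *\<^sub>R p + v *\<^sub>R q) = u *\<^sub>R l p + v *\<^sub>R l q"
      unfolding l_def u by (simp add: algebra_simps)
    then show "u *\<^sub>R p + v *\<^sub>R q \<in> T"
      using pq uv by (simp add: T_def closure_C_add closure_C_scale)
  qed
  ultimately obtain s t where st: "T = {s..t}"
    using connected_compact_interval_1 convex_connected by metis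
  \<comment> \<open>A parameter with l u \<in> C is interior to T. This puts 0 and 1 strictly
    between the ends and keeps both ends out of C.\<close>
  have ext: "\<exists>e>0. u - e \<in> T \<and> u + e \<in> T" if u: "l u \<in> C" for u
  proof -
    have op: "open {u. l u \<in> C}"
      using open_vimage[OF open_C contl] by (simp add: vimage_def)
    have "\<exists>e'>0. ball u e' \<subseteq> {u. l u \<in> C}"
      by (rule openE[OF op, of u]) (use u in auto)
    then obtain e' where e': "e' > 0" "ball u e' \<subseteq> {u. l u \<in> C}"
      by blast
    define e where "e = e' / 2"
    have e: "e > 0" "u - e \<in> ball u e'" "u + e \<in> ball u e'"
      using e'(1) by (auto simp: dist_real_def e_def)
    then have "l (u - e) \<in> C" "l (u + e) \<in> C"
      using e'(2) by blast+
    then show ?thesis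
      using closure_subset[of C] e(1) unfolding T_def by blast
  qed
  have "s < 0"
    using ext[of 0] x unfolding st by (auto simp: l_def)
  moreover have "1 < t"
    using ext[of 1] y unfolding st by (auto simp: l_def)
  moreover have "l s \<notin> C"
    using ext[of s] unfolding st by fastforce
  moreover have "l t \<notin> C"
    using ext[of t] unfolding st by fastforce
  moreover have "l u \<in> closure C \<longleftrightarrow> s \<le> u \<and> u \<le> t" for u
    using st by (auto simp: T_def)
  ultimately show thesis
    using that by (simp add: l_def)
qed

text \<open>For \<alpha> < 1 < \<mu>, the vectors x - \<alpha> y and \<mu> y - x are positive
  multiples of the points of the line with parameters - \<alpha> / (1 - \<alpha>) and \<mu> / (\<mu>
  - 1). So s determines the largest \<alpha>, t the smallest \<mu>, and their quotient is the cross
  ratio.\<close>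

lemma rel_iff_cross_ratio:
  assumes x: "w \<bullet> x = 1" and y: "w \<bullet> y = 1" and ne: "x \<noteq> y" and st: "s < 0" "1 < t"
    and ends: "\<And>u. x + u *\<^sub>R (y - x) \<in> closure C \<longleftrightarrow> s \<le> u \<and> u \<le> t"
  shows "rel \<beta> x y \<longleftrightarrow> ((1 - s) * t) / ((- s) * (t - 1)) \<le> \<beta>"
proof -
  have scl: "r *\<^sub>R v \<in> closure C \<longleftrightarrow> v \<in> closure C" if "0 < r" for r v
    using closure_C_scale[of r v] closure_C_scale[of "inverse r" "r *\<^sub>R v"] that by auto
  have lower: "\<alpha> *\<^sub>R y \<preceq> x \<longleftrightarrow> \<alpha> \<le> - s / (1 - s)" if "0 < \<alpha>" for \<alpha>
  proof (cases "\<alpha> < 1")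
    case True
    have "(1 - \<alpha>) * (- \<alpha> / (1 - \<alpha>)) = - \<alpha>"
      using True by simp
    then have "x - \<alpha> *\<^sub>R y = (1 - \<alpha>) *\<^sub>R (x + (- \<alpha> / (1 - \<alpha>)) *\<^sub>R (y - x))"
      unfolding scaleR_add_right scaleR_scaleR by (simp add: algebra_simps)
    then have "\<alpha> *\<^sub>R y \<preceq> x \<longleftrightarrow> x + (- \<alpha> / (1 - \<alpha>)) *\<^sub>R (y - x) \<in> closure C"
      using scl[of "1 - \<alpha>"] True by (simp only: le_def diff_gt_0_iff_gt)
    then have "\<alpha> *\<^sub>R y \<preceq> x \<longleftrightarrow> s \<le> - \<alpha> / (1 - \<alpha>) \<and> - \<alpha> / (1 - \<alpha>) \<le> t"
      by (simp only: ends)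
    moreover have "- \<alpha> / (1 - \<alpha>) \<le> 0"
      using True that by (intro divide_nonpos_pos) auto
    then have "- \<alpha> / (1 - \<alpha>) \<le> t"
      using st by linarith
    moreover have "s \<le> - \<alpha> / (1 - \<alpha>) \<longleftrightarrow> \<alpha> \<le> - s / (1 - s)"
    proof -
      have "s \<le> - \<alpha> / (1 - \<alpha>) \<longleftrightarrow> s * (1 - \<alpha>) \<le> - \<alpha>"
        by (rule pos_le_divide_eq) (use True in simp)
      moreover have "\<alpha> \<le> - s / (1 - s) \<longleftrightarrow> \<alpha> * (1 - s) \<le> - s"
        by (rule pos_le_divide_eq) (use st in simp)
      ultimately show ?thesis
        by (simp add: algebra_simps)
    qed
    ultimately show ?thesis
      by blast
  next
    case False
    \<comment> \<open>Applying w leaves only \<alpha> = 1, and then x - y would be a nonzero vector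
      of the closed cone on which w vanishes.\<close>
    have "\<not> \<alpha> *\<^sub>R y \<preceq> x"
    proof
      assume le: "\<alpha> *\<^sub>R y \<preceq> x"
      then have "\<alpha> = 1"
        using w_mono[OF le] x y False by simp
      then show False
        using w_pos[of "x - y"] le x y ne by (simp add: le_def inner_diff_right)
    qed
    moreover have "- s / (1 - s) < 1"
      using st by (simp add: field_simps)
    ultimately show ?thesis
      using False by auto
  qed
  have upper: "x \<preceq> \<mu> *\<^sub>R y \<longleftrightarrow> t / (t - 1) \<le> \<mu>" for \<mu>
  proof (cases "1 < \<mu>")
    case True
    have "(\<mu> - 1) * (\<mu> / (\<mu> - 1)) = \<mu>"
      using True by simp
    then have "\<mu> *\<^sub>R y - x = (\<mu> - 1) *\<^sub>R (x + (\<mu> / (\<mu> - 1)) *\<^sub>R (y - x))"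
      unfolding scaleR_add_right scaleR_scaleR by (simp add: algebra_simps)
    then have "x \<preceq> \<mu> *\<^sub>R y \<longleftrightarrow> s \<le> \<mu> / (\<mu> - 1) \<and> \<mu> / (\<mu> - 1) \<le> t"
      using scl[of "\<mu> - 1"] True by (simp add: le_def ends)
    moreover have "0 \<le> \<mu> / (\<mu> - 1)"
      using True by simp
    then have "s \<le> \<mu> / (\<mu> - 1)"
      using st by linarith
    moreover have "\<mu> / (\<mu> - 1) \<le> t \<longleftrightarrow> t / (t - 1) \<le> \<mu>"
      using True st by (simp add: pos_divide_le_eq algebra_simps)
    ultimately show ?thesis
      by blast
  next
    case False
    have "\<not> x \<preceq> \<mu> *\<^sub>R y"
    proof
      assume le: "x \<preceq> \<mu> *\<^sub>R y"
      then have "\<mu> = 1"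
        using w_mono[OF le] x y False by simp
      then show False
        using w_pos[of "y - x"] le x y ne by (simp add: le_def inner_diff_right)
    qed
    moreover have "1 < t / (t - 1)"
      using st by (simp add: field_simps)
    ultimately show ?thesis
      using False by auto
  qed
  define \<alpha>\<^sub>0 where "\<alpha>\<^sub>0 = - s / (1 - s)"
  define \<mu>\<^sub>0 where "\<mu>\<^sub>0 = t / (t - 1)"
  have pos: "0 < \<alpha>\<^sub>0" "0 < \<mu>\<^sub>0"
    unfolding \<alpha>\<^sub>0_def \<mu>\<^sub>0_def using st by (intro divide_pos_pos; simp)+
  have "rel \<beta> x y \<longleftrightarrow> (\<exists>\<alpha>>0. \<alpha> \<le> \<alpha>\<^sub>0 \<and> \<mu>\<^sub>0 \<le> \<alpha> * \<beta>)"
    unfolding rel_def \<alpha>\<^sub>0_def \<mu>\<^sub>0_def using lower upper by blast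
  also have "\<dots> \<longleftrightarrow> \<mu>\<^sub>0 \<le> \<alpha>\<^sub>0 * \<beta>"
  proof
    assume "\<exists>\<alpha>>0. \<alpha> \<le> \<alpha>\<^sub>0 \<and> \<mu>\<^sub>0 \<le> \<alpha> * \<beta>"
    then obtain \<alpha> where a: "0 < \<alpha>" "\<alpha> \<le> \<alpha>\<^sub>0" "\<mu>\<^sub>0 \<le> \<alpha> * \<beta>"
      by blast
    then have "0 < \<alpha> * \<beta>"
      using pos by linarith
    then have "\<alpha> * \<beta> \<le> \<alpha>\<^sub>0 * \<beta>"
      using a by (intro mult_right_mono) (auto simp: zero_less_mult_iff)
    then show "\<mu>\<^sub>0 \<le> \<alpha>\<^sub>0 * \<beta>"
      using a by simp
  qed (use pos in blast)
  also have "\<dots> \<longleftrightarrow> \<mu>\<^sub>0 / \<alpha>\<^sub>0 \<le> \<beta>"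
    using pos by (simp add: pos_divide_le_eq mult.commute)
  also have "\<mu>\<^sub>0 / \<alpha>\<^sub>0 = ((1 - s) * t) / ((- s) * (t - 1))"
    using st by (simp add: \<alpha>\<^sub>0_def \<mu>\<^sub>0_def mult.commute)
  finally show ?thesis .
qed

end

section \<open>Cones with a cocompact automorphism group\<close>

text \<open>Cocompactness concerns the action on rays: A moves the ray of x to one that meets
  \<open>K\<^sub>0\<close>, and s selects the vector on it.\<close>

locale cocompact_cone = pointed_cone +
  fixes K\<^sub>0 :: "'a set"
  assumes compact_K: "compact K\<^sub>0" and K_subset: "K\<^sub>0 \<subseteq> C"
    and cocompact: "x \<in> C \<Longrightarrow> \<exists>A s. linear A \<and> inj A \<and> A ` C = C \<and> 0 < s \<and> s *\<^sub>R A x \<in> K\<^sub>0"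
begin

lemma normalize:
  assumes "x \<in> C" and a: "\<And>i. i \<le> k \<Longrightarrow> a i \<in> C"
  obtains A s r where "linear A" "inj A" "A ` C = C" "\<And>i. i \<le> k \<Longrightarrow> 0 < s i"
    "\<And>i. i \<le> k \<Longrightarrow> s i *\<^sub>R A (a i) \<in> base" "0 < r" "r *\<^sub>R A x \<in> K\<^sub>0"
proof -
  obtain A r where A: "linear A" "inj A" "A ` C = C" "0 < r" "r *\<^sub>R A x \<in> K\<^sub>0"
    using cocompact[OF assms(1)] by blast
  have AC: "A (a i) \<in> C" if "i \<le> k" for i
    using a[OF that] A(3) by blast
  show thesis
  proof (rule that[of A "\<lambda>i. inverse (w \<bullet> A (a i))" r])
    fix i assume "i \<le> k"
    note 1 = AC[OF this] w_pos_C[OF AC[OF this]]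
    then show "0 < inverse (w \<bullet> A (a i))"
      by simp
    show "inverse (w \<bullet> A (a i)) *\<^sub>R A (a i) \<in> base"
      using 1 scale_C[OF _ 1(1), of "inverse (w \<bullet> A (a i))"] by (auto simp: base_def intro: C_le)
  qed (use A in auto)
qed

text \<open>The second alternative is a properly embedded simplex in vector form: the cone over all
  vertices meets C, while no cone over a facet does. It arises as a limit of far points when \<beta>
  tends to infinity.\<close>

theorem center_or_simplex:
  assumes k: "1 \<le> k"
  shows "(\<exists>\<beta>\<ge>1. \<forall>a. (\<forall>i\<le>k. a i \<in> C) \<longrightarrow> (\<exists>x\<in>C. \<forall>j\<le>k. near \<beta> a ({..k} - {j}) x)) \<or>
    (\<exists>a. (\<forall>i\<le>k. a i \<in> base) \<and> (\<exists>x\<in>C. near 1 a {..k} x) \<and>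
      (\<forall>j\<le>k. \<forall>x\<in>C. \<not> near 1 a ({..k} - {j}) x))"
proof (rule disjCI)
  assume no: "\<not> (\<exists>a. (\<forall>i\<le>k. a i \<in> base) \<and> (\<exists>x\<in>C. near 1 a {..k} x) \<and>
      (\<forall>j\<le>k. \<forall>x\<in>C. \<not> near 1 a ({..k} - {j}) x))"
  show "\<exists>\<beta>\<ge>1. \<forall>a. (\<forall>i\<le>k. a i \<in> C) \<longrightarrow> (\<exists>x\<in>C. \<forall>j\<le>k. near \<beta> a ({..k} - {j}) x)"
  proof (rule ccontr)
    assume contr: "\<not> ?thesis"
    have "\<exists>a x. (\<forall>i\<le>k. a i \<in> base) \<and> x \<in> K\<^sub>0 \<and> near 1 a {..k} x \<and>
        (\<forall>j\<le>k. \<not> near (real (Suc n)) a ({..k} - {j}) x)" for n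
    proof -
      have 1: "1 \<le> real (Suc n)" by simp
      then obtain a where a: "\<And>i. i \<le> k \<Longrightarrow> a i \<in> C"
        "\<not> (\<exists>x\<in>C. \<forall>j\<le>k. near (real (Suc n)) a ({..k} - {j}) x)"
        using contr by blast
      obtain x where x: "x \<in> C" "near 1 a {..k} x"
        "\<forall>j\<le>k. \<not> near (real (Suc n)) a ({..k} - {j}) x"
        using center_or_far_point[OF k a(1) 1 a(2)] by blast
      obtain A s r where A: "linear A" "inj A" "A ` C = C" "\<And>i. i \<le> k \<Longrightarrow> 0 < s i"
        "\<And>i. i \<le> k \<Longrightarrow> s i *\<^sub>R A (a i) \<in> base" "0 < r" "r *\<^sub>R A x \<in> K\<^sub>0"
        using normalize[OF x(1), of k a] a(1) by blast
      have "near \<gamma> (\<lambda>i. s i *\<^sub>R A (a i)) I (r *\<^sub>R A x) \<longleftrightarrow> near \<gamma> a I x" if "I \<subseteq> {..k}" for \<gamma> I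
        by (rule near_transform_iff[OF A(1-3) _ A(6)]) (use A(4) that in blast)
      then show ?thesis
        using A x by (intro exI[of _ "\<lambda>i. s i *\<^sub>R A (a i)"] exI[of _ "r *\<^sub>R A x"]) simp
    qed
    then obtain f u where f: "\<And>n i. i \<le> k \<Longrightarrow> f n i \<in> base" and u: "\<And>n. u n \<in> K\<^sub>0"
      and n1: "\<And>n. near 1 (f n) {..k} (u n)"
      and nn: "\<And>n j. j \<le> k \<Longrightarrow> \<not> near (real (Suc n)) (f n) ({..k} - {j}) (u n)"
      by metis
    have "\<exists>a \<rho>. strict_mono (\<rho> :: nat \<Rightarrow> nat) \<and>
        (\<forall>i\<le>k. a i \<in> base \<and> (\<lambda>n. f (\<rho> n) i) \<longlonglongrightarrow> a i)"
      by (rule convergent_subseq_family[OF compact_base f])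
    then obtain a \<rho> where r: "strict_mono (\<rho> :: nat \<Rightarrow> nat)"
      and a: "\<And>i. i \<le> k \<Longrightarrow> a i \<in> base" "\<And>i. i \<le> k \<Longrightarrow> (\<lambda>n. f (\<rho> n) i) \<longlonglongrightarrow> a i"
      by blast
    obtain x \<sigma> where x: "x \<in> K\<^sub>0" "strict_mono (\<sigma> :: nat \<Rightarrow> nat)" "((\<lambda>n. u (\<rho> n)) \<circ> \<sigma>) \<longlonglongrightarrow> x"
      using compact_K u unfolding compact_def by metis
    define \<pi> where "\<pi> = \<rho> \<circ> \<sigma>"
    have \<pi>: "n \<le> \<pi> n" for n
      using r x(2) strict_mono_o[of \<rho> \<sigma>] seq_suble unfolding \<pi>_def by blast
    have la: "(\<lambda>n. f (\<pi> n) i) \<longlonglongrightarrow> a i" if "i \<le> k" for i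
      using LIMSEQ_subseq_LIMSEQ[OF a(2)[OF that] x(2)] by (simp add: o_def \<pi>_def)
    have lx: "(\<lambda>n. u (\<pi> n)) \<longlonglongrightarrow> x"
      using x(3) by (simp add: o_def \<pi>_def)
    have xC: "x \<in> C"
      using x K_subset by blast
    have "near 1 a {..k} x"
      by (rule near_lim[OF _ _ lx _ n1]) (use la f base_D in auto)
    \<comment> \<open>By assumption some facet of the limit simplex meets C. Then x is at finite
      distance from it and, by perturbation, the points \<open>u (\<pi> n)\<close> are near the
      corresponding facets with one constant for all large n.\<close>
    then obtain j z where z: "j \<le> k" "z \<in> C" "near 1 a ({..k} - {j}) z"
      using no a xC by blast
    obtain \<beta> where b: "1 \<le> \<beta>" "near \<beta> a ({..k} - {j}) x"
      using near_of_C[OF xC z(2,3)] by blast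
    have "\<forall>\<^sub>F n in sequentially. near (\<beta> + 1) (f (\<pi> n)) ({..k} - {j}) (u (\<pi> n))"
      by (rule near_perturb[OF _ _ lx xC b(2)]) (use la a b base_D in auto)
    moreover have "\<forall>\<^sub>F n in sequentially. nat \<lceil>\<beta>\<rceil> \<le> n"
      by (rule eventually_ge_at_top)
    ultimately have "\<forall>\<^sub>F n in sequentially. False"
    proof eventually_elim
      case (elim n)
      have "\<beta> + 1 \<le> real (Suc (\<pi> n))"
        using elim(2) \<pi>[of n] by linarith
      then have "near (real (Suc (\<pi> n))) (f (\<pi> n)) ({..k} - {j}) (u (\<pi> n))"
        using near_mono[OF elim(1)] f base_D by simp
      then show False
        using nn[OF z(1)] by blast
    qed
    then show False
      by simp
  qed
qed

text \<open>By compactness: in counterexamples for M = n + 1, x is kept in \<open>K\<^sub>0\<close>,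
  so that y can only tend to a boundary vector \<xi>, and \<open>ray_near_codim2\<close> applies to
  the limit. The strict inequality 3 \<beta>^2 < \<gamma> is the room needed to return from the
  limit to the n-th configuration.\<close>

theorem far_points_near_codim2:
  assumes \<beta>: "1 \<le> \<beta>" "3 * \<beta>\<^sup>2 < \<gamma>"
  shows "\<exists>M. \<forall>a x y. (\<forall>i\<le>k. a i \<in> C) \<longrightarrow> x \<in> C \<longrightarrow> y \<in> C \<longrightarrow>
    (\<forall>j\<le>k. near \<beta> a ({..k} - {j}) x \<and> near \<beta> a ({..k} - {j}) y) \<longrightarrow> \<not> rel M x y \<longrightarrow>
    (\<exists>i j v v'. i \<le> k \<and> j \<le> k \<and> i \<noteq> j \<and> v \<in> C \<and> v' \<in> C \<and>
      (\<forall>l\<le>k. near \<beta> a ({..k} - {l}) v \<and> near \<beta> a ({..k} - {l}) v') \<and>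
      near \<gamma> a ({..k} - {i, j}) v \<and> near \<gamma> a ({..k} - {i, j}) v' \<and> \<not> rel D v v')"
    (is "\<exists>M. \<forall>a x y. ?P M a x y")
proof (rule ccontr)
  assume contr: "\<not> ?thesis"
  \<comment> \<open>The point y is stored as \<open>a (Suc k)\<close>, so that normalization and the
    choice of a subsequence treat it like a vertex.\<close>
  define Q where "Q n a x \<longleftrightarrow> (\<forall>i\<le>Suc k. a i \<in> base) \<and> x \<in> K\<^sub>0 \<and>
      (\<forall>j\<le>k. near \<beta> a ({..k} - {j}) x \<and> near \<beta> a ({..k} - {j}) (a (Suc k))) \<and>
      \<not> rel (real (Suc n)) x (a (Suc k)) \<and>
      (\<forall>i j v v'. i \<le> k \<longrightarrow> j \<le> k \<longrightarrow> i \<noteq> j \<longrightarrow> v \<in> C \<longrightarrow> v' \<in> C \<longrightarrow>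
        (\<forall>l\<le>k. near \<beta> a ({..k} - {l}) v \<and> near \<beta> a ({..k} - {l}) v') \<longrightarrow>
        near \<gamma> a ({..k} - {i, j}) v \<longrightarrow> near \<gamma> a ({..k} - {i, j}) v' \<longrightarrow> rel D v v')" for n a x
  have "\<exists>a x. Q n a x" for n
  proof -
    have "\<not> (\<forall>a x y. ?P (real (Suc n)) a x y)"
      using contr by (rule contrapos_nn) (rule exI)
    then obtain a x y where "\<not> ?P (real (Suc n)) a x y"
      unfolding not_all by (elim exE)
    then have a: "\<And>i. i \<le> k \<Longrightarrow> a i \<in> C" and xy: "x \<in> C" "y \<in> C" "\<not> rel (real (Suc n)) x y"
      and nf: "\<And>j. j \<le> k \<Longrightarrow> near \<beta> a ({..k} - {j}) x" "\<And>j. j \<le> k \<Longrightarrow> near \<beta> a ({..k} - {j}) y"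
      and bad: "\<And>i j v v'. \<lbrakk>i \<le> k; j \<le> k; i \<noteq> j; v \<in> C; v' \<in> C;
        \<forall>l\<le>k. near \<beta> a ({..k} - {l}) v \<and> near \<beta> a ({..k} - {l}) v';
        near \<gamma> a ({..k} - {i, j}) v; near \<gamma> a ({..k} - {i, j}) v'\<rbrakk> \<Longrightarrow> rel D v v'"
      by blast+
    have a': "(a(Suc k := y)) i \<in> C" if "i \<le> Suc k" for i
      using a xy that by auto
    obtain A s r where A: "linear A" "inj A" "A ` C = C" "\<And>i. i \<le> Suc k \<Longrightarrow> 0 < s i"
      "\<And>i. i \<le> Suc k \<Longrightarrow> s i *\<^sub>R A ((a(Suc k := y)) i) \<in> base" "0 < r" "r *\<^sub>R A x \<in> K\<^sub>0"
      using normalize[of x "Suc k" "a(Suc k := y)"] xy(1) a' by blast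
    define a2 where "a2 i = s i *\<^sub>R A ((a(Suc k := y)) i)" for i
    have tr: "near \<mu> a2 I (\<theta> *\<^sub>R A v) \<longleftrightarrow> near \<mu> a I v" if "I \<subseteq> {..k}" "0 < \<theta>" for \<mu> I \<theta> v
    proof -
      have "near \<mu> a2 I (\<theta> *\<^sub>R A v) \<longleftrightarrow> near \<mu> (a(Suc k := y)) I v"
        unfolding a2_def by (rule near_transform_iff[OF A(1-3) _ that(2)]) (use A(4) that(1) in force)
      moreover have "(\<Sum>i\<in>I. \<tau> i *\<^sub>R (a(Suc k := y)) i) = (\<Sum>i\<in>I. \<tau> i *\<^sub>R a i)" for \<tau>
        using that(1) by (intro sum.cong) auto
      ultimately show ?thesis
        unfolding near_def by simp
    qed
    have y: "a2 (Suc k) = s (Suc k) *\<^sub>R A y"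
      by (simp add: a2_def)
    have "rel D v v'" if H: "i \<le> k" "j \<le> k" "i \<noteq> j" "v \<in> C" "v' \<in> C"
      "\<forall>l\<le>k. near \<beta> a2 ({..k} - {l}) v \<and> near \<beta> a2 ({..k} - {l}) v'"
      "near \<gamma> a2 ({..k} - {i, j}) v" "near \<gamma> a2 ({..k} - {i, j}) v'" for i j v v'
    proof -
      obtain u u' where u: "u \<in> C" "v = A u" "u' \<in> C" "v' = A u'"
        using A(3) H(4,5) by (metis imageE)
      have "near \<mu> a I u \<longleftrightarrow> near \<mu> a2 I v" "near \<mu> a I u' \<longleftrightarrow> near \<mu> a2 I v'" if "I \<subseteq> {..k}" for \<mu> I
        using tr[OF that, of 1] u by auto
      then have "rel D u u'"
        using H by (intro bad[OF H(1-3) u(1,3)]) auto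
      then show ?thesis
        using rel_transform[OF A(1-3)] u by blast
    qed
    moreover have "\<not> rel (real (Suc n)) (r *\<^sub>R A x) (a2 (Suc k))"
      using xy(3) rel_transform_iff[OF A(1-3,6)] A(4)[of "Suc k"] by (simp add: y)
    moreover have "near \<beta> a2 ({..k} - {j}) (r *\<^sub>R A x) \<and> near \<beta> a2 ({..k} - {j}) (a2 (Suc k))" if "j \<le> k" for j
      using tr[of "{..k} - {j}"] nf[OF that] A(4)[of "Suc k"] A(6) by (auto simp: y)
    moreover have "a2 i \<in> base" if "i \<le> Suc k" for i
      using A(5)[OF that] by (simp add: a2_def)
    ultimately show ?thesis
      unfolding Q_def using A(7) by (intro exI[of _ a2] exI[of _ "r *\<^sub>R A x"]) blast
  qed
  then obtain f u where "\<And>n. Q n (f n) (u n)"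
    by metis
  then have f: "\<And>n i. i \<le> Suc k \<Longrightarrow> f n i \<in> base" and u: "\<And>n. u n \<in> K\<^sub>0"
    and nu: "\<And>n j. j \<le> k \<Longrightarrow> near \<beta> (f n) ({..k} - {j}) (u n)"
    and nf: "\<And>n j. j \<le> k \<Longrightarrow> near \<beta> (f n) ({..k} - {j}) (f n (Suc k))"
    and nrel: "\<And>n. \<not> rel (real (Suc n)) (u n) (f n (Suc k))"
    and bad: "\<And>n i j v v'. \<lbrakk>i \<le> k; j \<le> k; i \<noteq> j; v \<in> C; v' \<in> C;
        \<forall>l\<le>k. near \<beta> (f n) ({..k} - {l}) v \<and> near \<beta> (f n) ({..k} - {l}) v';
        near \<gamma> (f n) ({..k} - {i, j}) v; near \<gamma> (f n) ({..k} - {i, j}) v'\<rbrakk> \<Longrightarrow> rel D v v'"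
    unfolding Q_def by blast+
  have "\<exists>a \<rho>. strict_mono (\<rho> :: nat \<Rightarrow> nat) \<and>
      (\<forall>i\<le>Suc k. a i \<in> base \<and> (\<lambda>n. f (\<rho> n) i) \<longlonglongrightarrow> a i)"
    by (rule convergent_subseq_family[OF compact_base f])
  then obtain a \<rho> where r: "strict_mono (\<rho> :: nat \<Rightarrow> nat)"
    and a: "\<And>i. i \<le> Suc k \<Longrightarrow> a i \<in> base" "\<And>i. i \<le> Suc k \<Longrightarrow> (\<lambda>n. f (\<rho> n) i) \<longlonglongrightarrow> a i"
    by blast
  obtain x \<sigma> where x: "x \<in> K\<^sub>0" "strict_mono (\<sigma> :: nat \<Rightarrow> nat)" "((\<lambda>n. u (\<rho> n)) \<circ> \<sigma>) \<longlonglongrightarrow> x"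
    using compact_K u unfolding compact_def by metis
  define \<pi> where "\<pi> = \<rho> \<circ> \<sigma>"
  have \<pi>: "n \<le> \<pi> n" for n
    using r x(2) strict_mono_o[of \<rho> \<sigma>] seq_suble unfolding \<pi>_def by blast
  have la: "(\<lambda>n. f (\<pi> n) i) \<longlonglongrightarrow> a i" if "i \<le> Suc k" for i
    using LIMSEQ_subseq_LIMSEQ[OF a(2)[OF that] x(2)] by (simp add: o_def \<pi>_def)
  have lx: "(\<lambda>n. u (\<pi> n)) \<longlonglongrightarrow> x"
    using x(3) by (simp add: o_def \<pi>_def)
  have xC: "x \<in> C"
    using x K_subset by blast
  define \<xi> where "\<xi> = a (Suc k)"
  define y where "y n = f (\<pi> n) (Suc k)" for n
  have \<xi>: "\<xi> \<in> base"
    using a(1) by (simp add: \<xi>_def)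
  have ly: "y \<longlonglongrightarrow> \<xi>"
    using la[of "Suc k"] by (simp add: y_def[abs_def] \<xi>_def)
  have uC: "u n \<in> C" for n
    using u K_subset by blast
  \<comment> \<open>Otherwise x and \<xi> are at finite distance, and by perturbation one constant
    bounds the distances from \<open>u (\<pi> n)\<close> to \<open>y n\<close>, against
    \<open>nrel\<close>.\<close>
  have \<xi>C: "\<xi> \<notin> C"
  proof
    assume "\<xi> \<in> C"
    moreover have "near 1 (\<lambda>_. \<xi>) {0} \<xi>"
      unfolding near_one_iff by (auto intro: exI[of _ "\<lambda>_. 1"])
    ultimately obtain \<mu> where m: "1 \<le> \<mu>" "near \<mu> (\<lambda>_. \<xi>) {0} x"
      using near_of_C[OF xC] by blast
    have "\<forall>\<^sub>F n in sequentially. near (\<mu> + 1) (\<lambda>_. y n) {0} (u (\<pi> n))"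
      by (rule near_perturb[OF _ _ lx xC m(2)]) (use m ly \<xi> base_D in auto)
    moreover have "\<forall>\<^sub>F n in sequentially. nat \<lceil>\<mu>\<rceil> \<le> n"
      by (rule eventually_ge_at_top)
    ultimately have "\<forall>\<^sub>F n in sequentially. False"
    proof eventually_elim
      case (elim n)
      have "\<mu> + 1 \<le> real (Suc (\<pi> n))"
        using elim(2) \<pi>[of n] by linarith
      moreover have "rel (\<mu> + 1) (u (\<pi> n)) (y n)"
        using near_singleton_rel[OF elim(1) uC] .
      ultimately have "rel (real (Suc (\<pi> n))) (u (\<pi> n)) (y n)"
        using rel_mono f base_D unfolding y_def by blast
      then show False
        using nrel by (simp add: y_def)
    qed
    then show False
      by simp
  qed
  have nx: "near \<beta> a ({..k} - {j}) x" and n\<xi>: "near \<beta> a ({..k} - {j}) \<xi>" if "j \<le> k" for j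
  proof -
    show "near \<beta> a ({..k} - {j}) x"
      by (rule near_lim[OF _ _ lx _ nu]) (use la f base_D that in auto)
    show "near \<beta> a ({..k} - {j}) \<xi>"
      by (rule near_lim[OF _ _ ly, where f = "\<lambda>n. f (\<pi> n)"])
        (use la f base_D that nf in \<open>auto simp: y_def\<close>)
  qed
  obtain i j t where ij: "i \<le> k" "j \<le> k" "i \<noteq> j" and t: "\<And>m. 0 < t m" "t \<longlonglongrightarrow> 0"
    and nG: "\<And>m. near (3 * \<beta>\<^sup>2) a ({..k} - {i, j}) (\<xi> + t m *\<^sub>R x)"
    using ray_near_codim2[OF _ \<xi> \<xi>C xC \<beta>(1) nx n\<xi>] a(1) by auto
  \<comment> \<open>These points approximate the ray within the n-th configuration. As sums of
    vectors near all facets they keep the constant \<beta>; near the face omitting i and j they have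
    the constant \<gamma>, by perturbation.\<close>
  define v where "v m n = y n + t m *\<^sub>R u (\<pi> n)" for m n
  have lv: "v m \<longlonglongrightarrow> \<xi> + t m *\<^sub>R x" for m
    unfolding v_def by (intro tendsto_intros ly lx)
  have vC: "y + t m *\<^sub>R z \<in> C" if "0 \<preceq> y" "z \<in> C" for m y z
    using C_up[OF scale_C[OF t(1) that(2)], of m] that(1) by (simp add: le_def)
  have vnC: "v m n \<in> C" for m n
    unfolding v_def y_def by (rule vC) (use f base_D uC in auto)
  have limC: "\<xi> + t m *\<^sub>R x \<in> C" for m
    by (rule vC) (use \<xi> base_D xC in auto)
  have limC0: "0 \<preceq> \<xi> + t m *\<^sub>R x" "\<xi> + t m *\<^sub>R x \<noteq> 0" for m
    using C_le[OF limC] zero_C limC[of m] by auto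
  have vnear: "\<forall>l\<le>k. near \<beta> (f (\<pi> n)) ({..k} - {l}) (v m n)" for m n
    using near_add[OF nf[where n = "\<pi> n"] nu[where n = "\<pi> n"], where s = 1 and t = "t m"] t(1)[of m] by (simp add: v_def y_def)
  have nv: "\<forall>\<^sub>F n in sequentially. near \<gamma> (f (\<pi> n)) ({..k} - {i, j}) (v m n)" for m
    by (rule near_perturb[OF _ _ lv limC nG]) (use \<beta> la a(1) base_D in auto)
  have ev: "\<forall>\<^sub>F n in sequentially. rel D (v 0 n) (v m n)" for m
    using nv[of 0] nv[of m]
    by eventually_elim (use bad[OF ij vnC vnC] vnear in blast)
  \<comment> \<open>First n tends to infinity with m fixed, then m does. A distance bound along the
    whole ray would put its end \<xi> into C.\<close>
  have "rel D (\<xi> + t 0 *\<^sub>R x) (\<xi> + t m *\<^sub>R x)" for m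
  proof -
    obtain N where N: "\<And>n. N \<le> n \<Longrightarrow> rel D (v 0 n) (v m n)"
      using ev unfolding eventually_sequentially by blast
    show ?thesis
      by (rule rel_lim[OF LIMSEQ_ignore_initial_segment[OF lv, of _ N]
            LIMSEQ_ignore_initial_segment[OF lv, of _ N]])
        (use N limC0 C_le[OF vnC] in auto)
  qed
  note rel0 = this
  have "(\<lambda>m. \<xi> + t m *\<^sub>R x) \<longlonglongrightarrow> \<xi>"
    using tendsto_add[OF tendsto_const tendsto_scaleR[OF t(2) tendsto_const], of \<xi> x] by simp
  from rel_lim[OF tendsto_const this rel0 limC0(1) base_D(1)[OF \<xi>] limC0(2) base_D(3)[OF \<xi>] limC0(1) limC0(1)]
  have "\<xi> \<in> C"
    by (rule rel_C[OF _ limC base_D(1)[OF \<xi>]])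
  then show False
    using \<xi>C by blast
qed

end

section \<open>Charts and the cone over a properly convex domain\<close>

lemma line_of_proj_pt: "v \<noteq> 0 \<Longrightarrow> line_of (proj_pt v) = span {v}"
  by (simp add: proj_pt_def Abs_rproj_inverse dim_eq_card_independent)

lemma rproj_obtain:
  obtains v where "v \<noteq> 0" "p = proj_pt v"
proof -
  have L: "subspace (line_of p)" "dim (line_of p) = 1"
    using line_of[of p] by auto
  then obtain v where v: "v \<in> line_of p" "v \<noteq> 0"
    by (metis dim_eq_0 subset_singletonD subsetI singletonI zero_neq_one)
  have "dim (span {v}) = 1"
    using v by (simp add: dim_eq_card_independent)
  then have "span {v} = line_of p"
    using L v by (intro subspace_dim_equal) (auto simp: span_minimal)
  then have "p = proj_pt v"
    by (simp add: proj_pt_def line_of_inverse)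
  with v show thesis
    using that by blast
qed

lemma proj_pt_scale: "c \<noteq> 0 \<Longrightarrow> proj_pt (c *\<^sub>R v) = proj_pt v"
proof -
  assume "c \<noteq> 0"
  then have "span {c *\<^sub>R v} = span {v}"
    using span_image_scale[of "{v}" "\<lambda>_. c"] by simp
  then show ?thesis
    by (simp add: proj_pt_def)
qed

lemma proj_pt_eqD:
  assumes "u \<noteq> 0" "v \<noteq> 0" "proj_pt u = proj_pt v"
  shows "\<exists>c. c \<noteq> 0 \<and> u = c *\<^sub>R v"
proof -
  have "u \<in> span {v}"
    using line_of_proj_pt[OF assms(1)] line_of_proj_pt[OF assms(2)] assms(3) by (metis insertI1 span_base)
  then show ?thesis
    using assms by (auto simp: span_singleton)
qed

lemma proj_pt_in_chart_dom: "v \<noteq> 0 \<Longrightarrow> proj_pt v \<in> chart_dom w \<longleftrightarrow> w \<bullet> v \<noteq> 0"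
  by (auto simp: chart_dom_def line_of_proj_pt span_singleton)

lemma chart_proj_pt:
  assumes "w \<bullet> v \<noteq> 0"
  shows "chart w (proj_pt v) = inverse (w \<bullet> v) *\<^sub>R v"
proof -
  have "v \<noteq> 0"
    using assms by auto
  then show ?thesis
    unfolding chart_def using assms
    by (intro the_equality) (auto simp: line_of_proj_pt span_singleton field_simps)
qed

lemma chart_props:
  assumes "p \<in> chart_dom w"
  shows "w \<bullet> chart w p = 1" "proj_pt (chart w p) = p" "chart w p \<in> line_of p"
proof -
  obtain v where v: "v \<noteq> 0" "p = proj_pt v"
    by (rule rproj_obtain)
  then have wv: "w \<bullet> v \<noteq> 0"
    using assms by (simp add: proj_pt_in_chart_dom)
  show "w \<bullet> chart w p = 1" "proj_pt (chart w p) = p"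
    using wv by (simp_all add: v chart_proj_pt proj_pt_scale)
  show "chart w p \<in> line_of p"
    using wv v by (simp add: chart_proj_pt line_of_proj_pt span_scale span_base)
qed

lemma chart_inj: "p \<in> chart_dom w \<Longrightarrow> q \<in> chart_dom w \<Longrightarrow> chart w p = chart w q \<Longrightarrow> p = q"
  by (metis chart_props(2))

text \<open>By the quotient topology this concerns sets of vectors, where the chart is the map v /
  (w \<bullet> v), continuous off the kernel of w.\<close>

lemma open_chart_vimage:
  assumes "open B"
  shows "open {p \<in> chart_dom w. chart w p \<in> B}"
proof -
  have "{v. v \<noteq> 0 \<and> proj_pt v \<in> {p \<in> chart_dom w. chart w p \<in> B}} =
    {v. w \<bullet> v \<noteq> 0} \<inter> (\<lambda>v. inverse (w \<bullet> v) *\<^sub>R v) -` B" (is "_ = ?R")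
  proof -
    have "v \<noteq> 0 \<and> proj_pt v \<in> chart_dom w \<and> chart w (proj_pt v) \<in> B \<longleftrightarrow>
      w \<bullet> v \<noteq> 0 \<and> inverse (w \<bullet> v) *\<^sub>R v \<in> B" for v
      using proj_pt_in_chart_dom[of v w] chart_proj_pt[of w v] by (cases "v = 0") auto
    then show ?thesis
      by auto
  qed
  moreover have op: "open {v. w \<bullet> v \<noteq> 0}"
    by (intro open_Collect_neq continuous_intros)
  have "open ?R"
    by (rule continuous_open_preimage[OF _ op assms]) (auto intro!: continuous_intros)
  ultimately show ?thesis
    unfolding open_rproj_def by simp
qed

lemma proj_map_proj_pt: "proj_map A (proj_pt v) = proj_pt (A *v v)" if "v \<noteq> 0"
  using linear_span_image[of "(*v) A" "{v}"]
  by (simp add: proj_map_def line_of_proj_pt[OF that] proj_pt_def[of "A *v v"])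

lemma closed_segment_line:
  fixes x d :: "'a::real_vector"
  shows "closed_segment (x + s *\<^sub>R d) (x + t *\<^sub>R d) = (\<lambda>u. x + u *\<^sub>R d) ` closed_segment s t"
proof -
  have "closed_segment (s *\<^sub>R d) (t *\<^sub>R d) = (\<lambda>u. u *\<^sub>R d) ` closed_segment s t"
    by (rule closed_segment_linear_image) (simp add: linear_iff scaleR_add_left)
  then show ?thesis
    by (simp add: closed_segment_translation image_image)
qed

text \<open>The covector w is tied to the chart that \<open>some_chart\<close> picks, because hulls
  and distances are defined through that choice.\<close>

locale projective_domain =
  fixes \<Omega> :: "'n::finite rproj set" and w :: "real ^ 'n"
  assumes open_\<Omega>: "open \<Omega>" and ne_\<Omega>: "\<Omega> \<noteq> {}" and convex_chart: "convex_chart \<Omega> w"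
    and some_chart: "some_chart \<Omega> = chart w"
begin

abbreviation "\<phi> \<equiv> chart w"

text \<open>The vectors over \<Omega> form a double cone; the sign of w selects one half.\<close>

definition cone :: "(real ^ 'n) set"
  where "cone = {v. 0 < w \<bullet> v \<and> proj_pt v \<in> \<Omega>}"

text \<open>The constant is fixed by choice so that it can be a parameter of the sublocale
  below.\<close>

definition cbound :: real
  where "cbound = (SOME c. 0 < c \<and> (\<forall>v\<in>cone. c * norm v \<le> w \<bullet> v))"

lemma closure_chart_dom: "p \<in> closure \<Omega> \<Longrightarrow> p \<in> chart_dom w"
  using convex_chart by (auto simp: convex_chart_def)

lemma \<Omega>_chart_dom: "p \<in> \<Omega> \<Longrightarrow> p \<in> chart_dom w"
  using closure_chart_dom closure_subset by blast

lemma chart_in_cone: "p \<in> \<Omega> \<Longrightarrow> \<phi> p \<in> cone"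
  using chart_props[OF \<Omega>_chart_dom] by (simp add: cone_def)

lemma cone_scaled: "v \<in> cone \<longleftrightarrow> 0 < w \<bullet> v \<and> inverse (w \<bullet> v) *\<^sub>R v \<in> \<phi> ` \<Omega>"
proof
  assume v: "v \<in> cone"
  then show "0 < w \<bullet> v \<and> inverse (w \<bullet> v) *\<^sub>R v \<in> \<phi> ` \<Omega>"
    using chart_proj_pt[of w v] by (auto simp: cone_def image_iff intro!: bexI[of _ "proj_pt v"])
next
  assume v: "0 < w \<bullet> v \<and> inverse (w \<bullet> v) *\<^sub>R v \<in> \<phi> ` \<Omega>"
  then have "inverse (w \<bullet> v) *\<^sub>R v \<in> cone"
    using chart_in_cone by auto
  then show "v \<in> cone"
    using v by (auto simp: cone_def proj_pt_scale)
qed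

lemma open_cone: "open cone"
proof -
  have "cone = {v. v \<noteq> 0 \<and> proj_pt v \<in> \<Omega>} \<inter> {v. 0 < w \<bullet> v}"
    by (auto simp: cone_def)
  moreover have "open {v. 0 < w \<bullet> v}"
    by (simp add: open_halfspace_gt)
  ultimately show ?thesis
    using open_\<Omega> unfolding open_rproj_def by (simp add: open_Int)
qed

lemma cone_scale: "0 < s \<Longrightarrow> v \<in> cone \<Longrightarrow> s *\<^sub>R v \<in> cone"
  by (simp add: cone_def proj_pt_scale)

text \<open>The normalization of x + y is the convex combination of the normalized vectors with
  weights proportional to w \<bullet> x and w \<bullet> y.\<close>

lemma cone_add:
  assumes "x \<in> cone" "y \<in> cone"
  shows "x + y \<in> cone"
proof -
  let ?a = "w \<bullet> x" and ?b = "w \<bullet> y"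
  have ab: "0 < ?a" "0 < ?b"
    using assms by (auto simp: cone_def)
  have "convex (\<phi> ` \<Omega>)"
    using convex_chart by (simp add: convex_chart_def)
  then have "(?a / (?a + ?b)) *\<^sub>R inverse ?a *\<^sub>R x + (?b / (?a + ?b)) *\<^sub>R inverse ?b *\<^sub>R y \<in> \<phi> ` \<Omega>"
    using assms ab by (intro convexD) (auto simp: cone_scaled simp flip: add_divide_distrib)
  also have "(?a / (?a + ?b)) *\<^sub>R inverse ?a *\<^sub>R x + (?b / (?a + ?b)) *\<^sub>R inverse ?b *\<^sub>R y =
      inverse (w \<bullet> (x + y)) *\<^sub>R (x + y)"
    using ab by (simp add: inner_add_right scaleR_add_right field_simps)
  finally show ?thesis
    unfolding cone_scaled using ab by (simp add: inner_add_right)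
qed

lemma cbound: "0 < cbound" "v \<in> cone \<Longrightarrow> cbound * norm v \<le> w \<bullet> v"
proof -
  obtain B where B: "0 < B" "\<And>u. u \<in> \<phi> ` \<Omega> \<Longrightarrow> norm u \<le> B"
    using convex_chart unfolding convex_chart_def bounded_pos by blast
  have "inverse B * norm v \<le> w \<bullet> v" if "v \<in> cone" for v
  proof -
    have "norm (inverse (w \<bullet> v) *\<^sub>R v) \<le> B" "0 < w \<bullet> v"
      using B(2) that unfolding cone_scaled by blast+
    then show ?thesis
      using B(1) by (simp add: field_simps)
  qed
  then have "\<exists>c. 0 < c \<and> (\<forall>v\<in>cone. c * norm v \<le> w \<bullet> v)"
    using B(1) by (intro exI[of _ "inverse B"]) auto
  from someI_ex[OF this] show "0 < cbound" "v \<in> cone \<Longrightarrow> cbound * norm v \<le> w \<bullet> v"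
    unfolding cbound_def by blast+
qed

sublocale pointed_cone cone w cbound
proof
  show "cone \<noteq> {}"
    using ne_\<Omega> chart_in_cone by blast
  show "0 \<notin> cone"
    by (simp add: cone_def)
qed (use open_cone cone_add cone_scale cbound in auto)

notation le (infix "\<preceq>" 50)

lemma \<Omega>_iff: "p \<in> chart_dom w \<Longrightarrow> p \<in> \<Omega> \<longleftrightarrow> \<phi> p \<in> cone"
  using chart_props[of p w] by (simp add: cone_def)

text \<open>Links the closure in projective space to the closure of the cone. In each direction an
  open set that separates the point is transported, either back through the chart or through the
  projection from vectors to lines.\<close>

lemma closure_\<Omega>_iff: "p \<in> closure \<Omega> \<longleftrightarrow> p \<in> chart_dom w \<and> 0 \<preceq> \<phi> p"
proof
  assume p: "p \<in> closure \<Omega>"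
  show "p \<in> chart_dom w \<and> 0 \<preceq> \<phi> p"
  proof (rule ccontr)
    assume "\<not> ?thesis"
    then have "p \<in> {p \<in> chart_dom w. \<phi> p \<in> - closure cone}" (is "_ \<in> ?N")
      using closure_chart_dom[OF p] by (simp add: zero_le_iff)
    moreover have "open ?N"
      by (rule open_chart_vimage) (rule open_Compl[OF closed_closure])
    moreover have "\<Omega> \<inter> ?N = {}"
      using chart_in_cone closure_subset by blast
    ultimately show False
      using p open_Int_closure_eq_empty[of ?N \<Omega>] by blast
  qed
next
  assume p: "p \<in> chart_dom w \<and> 0 \<preceq> \<phi> p"
  show "p \<in> closure \<Omega>"
  proof (rule ccontr)
    assume "p \<notin> closure \<Omega>"
    define N where "N = {v. v \<noteq> 0 \<and> proj_pt v \<in> - closure \<Omega>}"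
    have op: "open N"
      using open_rproj_def[of "- closure \<Omega>"] open_Compl[OF closed_closure, of \<Omega>] by (simp add: N_def)
    have "\<phi> p \<noteq> 0"
      using chart_props(1)[of p w] p by auto
    then have "\<phi> p \<in> N"
      using chart_props(2)[of p w] p \<open>p \<notin> closure \<Omega>\<close> by (simp add: N_def)
    moreover have "cone \<inter> N = {}"
      using closure_subset[of \<Omega>] by (auto simp: cone_def N_def)
    ultimately show False
      using p open_Int_closure_eq_empty[OF op, of cone] by (auto simp: zero_le_iff)
  qed
qed

lemma \<phi>_base: "p \<in> closure \<Omega> \<Longrightarrow> \<phi> p \<in> base"
  using chart_props[of p w] by (simp add: base_def closure_\<Omega>_iff)

lemma \<phi>_proj_pt_base: "v \<in> base \<Longrightarrow> \<phi> (proj_pt v) = v"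
  by (simp add: base_def chart_proj_pt)

lemma proj_pt_base: "v \<in> base \<Longrightarrow> proj_pt v \<in> closure \<Omega>"
  using \<phi>_proj_pt_base[of v] base_D[of v] by (simp add: closure_\<Omega>_iff proj_pt_in_chart_dom)

lemma proj_pt_cone: "v \<in> cone \<Longrightarrow> proj_pt v \<in> \<Omega>" "v \<in> cone \<Longrightarrow> \<phi> (proj_pt v) = inverse (w \<bullet> v) *\<^sub>R v"
  by (auto simp: cone_def chart_proj_pt)

lemma bdry_iff: "p \<in> bdry \<Omega> \<longleftrightarrow> p \<in> closure \<Omega> \<and> \<phi> p \<notin> cone"
  using \<Omega>_iff closure_chart_dom by (auto simp: bdry_def)

section \<open>The Hilbert metric as the projective metric of the cone\<close>

lemma hilbert_dist_line:
  assumes p: "p \<in> \<Omega>" and q: "q \<in> \<Omega>" and ne: "p \<noteq> q" and st: "s < 0" "1 < t"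
    and ends: "\<And>u. \<phi> p + u *\<^sub>R (\<phi> q - \<phi> p) \<in> closure cone \<longleftrightarrow> s \<le> u \<and> u \<le> t"
    and out: "\<phi> p + s *\<^sub>R (\<phi> q - \<phi> p) \<notin> cone" "\<phi> p + t *\<^sub>R (\<phi> q - \<phi> p) \<notin> cone"
  shows "hilbert_dist \<Omega> p q = 1 / 2 * ln (((1 - s) * t) / ((- s) * (t - 1)))"
proof -
  define x where "x = \<phi> p"
  define y where "y = \<phi> q"
  define d where "d = y - x"
  define l where "l u = x + u *\<^sub>R d" for u
  have wx: "w \<bullet> x = 1" and wy: "w \<bullet> y = 1" and lx: "x \<in> line_of p" and ly: "y \<in> line_of q"
    using chart_props[OF \<Omega>_chart_dom] p q by (auto simp: x_def y_def)
  have px: "p = proj_pt x" "q = proj_pt y"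
    using chart_props(2)[OF \<Omega>_chart_dom] p q by (simp_all add: x_def y_def)
  have xy: "x \<noteq> 0" "y \<noteq> 0"
    using wx wy by auto
  have d: "d \<noteq> 0"
    using ne px by (auto simp: d_def)
  have wl: "w \<bullet> l u = 1" for u
    by (simp add: l_def d_def inner_add_right inner_diff_right wx wy)
  have lbase: "l u \<in> base \<longleftrightarrow> s \<le> u \<and> u \<le> t" for u
    using ends[of u] wl[of u] by (simp add: base_def zero_le_iff l_def d_def x_def y_def)
  have lout: "l s \<notin> cone" "l t \<notin> cone"
    using out by (simp_all add: l_def d_def x_def y_def)
  have l01: "l 0 = x" "l 1 = y"
    by (simp_all add: l_def d_def)
  have seg: "closed_segment (l u) (l v) = l ` closed_segment u v" for u v
    unfolding l_def by (rule closed_segment_line)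
  have linj: "l u = l v \<longleftrightarrow> u = v" for u v
    using d by (simp add: l_def)
  have lseg: "l c \<in> closed_segment (l u) (l v) \<longleftrightarrow> c \<in> closed_segment u v" for c u v
    unfolding seg using linj by auto
  let ?a = "proj_pt (l s)" and ?b = "proj_pt (l t)"
  have ab: "\<phi> ?a = l s" "\<phi> ?b = l t"
    using lbase st by (simp_all add: \<phi>_proj_pt_base)
  have abb: "?a \<in> bdry \<Omega>" "?b \<in> bdry \<Omega>"
    unfolding bdry_iff ab using lbase lout st by (simp_all add: proj_pt_base)
  have line: "\<phi> ` (proj_line p q \<inter> closure \<Omega>) = closed_segment (l s) (l t)"
  proof (intro equalityI subsetI)
    fix z assume "z \<in> \<phi> ` (proj_line p q \<inter> closure \<Omega>)"
    then obtain r where r: "r \<in> proj_line p q" "r \<in> closure \<Omega>" "z = \<phi> r"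
      by blast
    have z: "z \<in> base" "z \<in> line_of r"
      using r \<phi>_base chart_props(3) closure_chart_dom by auto
    then have "z \<in> span (span {x} \<union> span {y})"
      using r(1) xy px by (auto simp: proj_line_def line_of_proj_pt)
    then obtain \<alpha> \<beta> where ab: "z = \<alpha> *\<^sub>R x + \<beta> *\<^sub>R y"
      unfolding span_Un span_span by (auto simp: span_singleton)
    then have "\<alpha> + \<beta> = 1"
      using base_D(2)[OF z(1)] by (simp add: inner_add_right wx wy)
    then have \<alpha>: "\<alpha> = 1 - \<beta>"
      by simp
    have "z = l \<beta>"
      unfolding ab l_def d_def \<alpha> by (simp add: algebra_simps)
    then show "z \<in> closed_segment (l s) (l t)"
      using z(1) st lbase lseg by (simp add: closed_segment_eq_real_ivl)
  next
    fix z assume "z \<in> closed_segment (l s) (l t)"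
    then obtain u where u: "z = l u" "s \<le> u" "u \<le> t"
      unfolding seg using st by (auto simp: closed_segment_eq_real_ivl)
    then have z: "z \<in> base"
      using lbase by blast
    have "z \<in> span (span {x} \<union> span {y})"
      unfolding u(1) l_def d_def
      by (intro span_add span_scale span_diff; intro span_base) (auto intro: span_base)
    then have "proj_pt z \<in> proj_line p q"
      using base_D(3)[OF z] xy
      by (auto simp: proj_line_def line_of_proj_pt px span_singleton[of z] intro: span_scale)
    then show "z \<in> \<phi> ` (proj_line p q \<inter> closure \<Omega>)"
      using \<phi>_proj_pt_base[OF z] proj_pt_base[OF z] by (metis IntI imageI)
  qed
  have "hilbert_ends \<Omega> p q = (?a, ?b)"
    unfolding hilbert_ends_def Let_def some_chart
  proof (rule the_equality, goal_cases)
    case 1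
    have "x \<in> closed_segment (l s) y" "y \<in> closed_segment x (l t)"
      unfolding l01[symmetric] lseg using st by (auto simp: closed_segment_eq_real_ivl)
    then show ?case
      using abb line ab by (simp add: x_def y_def)
  next
    case (2 ab')
    obtain a' b' where ab': "ab' = (a', b')"
      by (cases ab')
    have H: "a' \<in> bdry \<Omega>" "b' \<in> bdry \<Omega>" "closed_segment (l s) (l t) = closed_segment (\<phi> a') (\<phi> b')"
      "x \<in> closed_segment (\<phi> a') y"
      using 2 line by (auto simp: ab' x_def y_def)
    have "{\<phi> a', \<phi> b'} = {l s, l t}"
      using H(3) closed_segment_eq by metis
    \<comment> \<open>A segment determines its ends only as a set; the order condition at x rules
      out the exchange.\<close>
    moreover have "\<phi> a' \<noteq> l t"
      using H(4) lseg[of 0 t 1] l01 st by (auto simp: closed_segment_eq_real_ivl)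
    ultimately have "\<phi> a' = \<phi> ?a" "\<phi> b' = \<phi> ?b"
      unfolding ab by (auto simp: doubleton_eq_iff)
    then show ?case
      using H(1,2) abb chart_inj closure_chart_dom unfolding bdry_iff ab' by blast
  qed
  moreover have dl: "dist (l u) (l v) = \<bar>u - v\<bar> * norm d" for u v
    unfolding dist_norm l_def by (simp flip: scaleR_diff_left)
  moreover have "\<bar>1 - s\<bar> = 1 - s" "\<bar>t\<bar> = t" "\<bar>s\<bar> = - s" "\<bar>1 - t\<bar> = t - 1"
    using st by auto
  ultimately show ?thesis
    using p q ne d unfolding hilbert_dist_def Let_def some_chart
    by (simp add: ab flip: x_def y_def l01)
qed

lemma hilbert_ends_exist:
  assumes "p \<in> \<Omega>" "q \<in> \<Omega>" "p \<noteq> q"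
  obtains s t where "s < 0" "1 < t"
    "\<And>u. \<phi> p + u *\<^sub>R (\<phi> q - \<phi> p) \<in> closure cone \<longleftrightarrow> s \<le> u \<and> u \<le> t"
    "\<phi> p + s *\<^sub>R (\<phi> q - \<phi> p) \<notin> cone" "\<phi> p + t *\<^sub>R (\<phi> q - \<phi> p) \<notin> cone"
proof -
  have "\<phi> p \<noteq> \<phi> q"
    using assms chart_inj \<Omega>_chart_dom by blast
  then show thesis
    using line_ends[OF chart_in_cone[OF assms(1)] _ chart_in_cone[OF assms(2)]] that
      chart_props(1)[OF \<Omega>_chart_dom] assms by blast
qed

text \<open>The passage from the metric to the order. It includes equal points, where the distance
  is 0 and \<open>rel\<close> holds from the constant 1 = exp 0 on.\<close>

lemma hilbert_dist_le_iff:
  assumes "p \<in> \<Omega>" "q \<in> \<Omega>" "0 \<le> D"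
  shows "hilbert_dist \<Omega> p q \<le> D \<longleftrightarrow> rel (exp (2 * D)) (\<phi> p) (\<phi> q)"
proof (cases "p = q")
  case True
  then show ?thesis
    using assms rel_refl C_le chart_in_cone by (simp add: hilbert_dist_def)
next
  case False
  obtain s t where st: "s < 0" "1 < t"
    "\<And>u. \<phi> p + u *\<^sub>R (\<phi> q - \<phi> p) \<in> closure cone \<longleftrightarrow> s \<le> u \<and> u \<le> t"
    "\<phi> p + s *\<^sub>R (\<phi> q - \<phi> p) \<notin> cone" "\<phi> p + t *\<^sub>R (\<phi> q - \<phi> p) \<notin> cone"
    using hilbert_ends_exist[OF assms(1,2) False] by blast
  let ?\<rho> = "((1 - s) * t) / ((- s) * (t - 1))"
  have "0 < ?\<rho>"
    using st by (intro divide_pos_pos mult_pos_pos) auto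
  then have "ln ?\<rho> \<le> ln (exp (2 * D)) \<longleftrightarrow> ?\<rho> \<le> exp (2 * D)"
    by (intro ln_le_cancel_iff) auto
  then have "1 / 2 * ln ?\<rho> \<le> D \<longleftrightarrow> ?\<rho> \<le> exp (2 * D)"
    unfolding ln_exp by linarith
  moreover have "rel (exp (2 * D)) (\<phi> p) (\<phi> q) \<longleftrightarrow> ?\<rho> \<le> exp (2 * D)"
    by (rule rel_iff_cross_ratio[OF _ _ _ st(1-3)])
      (use chart_props(1)[OF \<Omega>_chart_dom] assms False chart_inj \<Omega>_chart_dom in blast)+
  ultimately show ?thesis
    unfolding hilbert_dist_line[OF assms(1,2) False st] by blast
qed

lemma hilbert_dist_pos:
  assumes "p \<in> \<Omega>" "q \<in> \<Omega>" "p \<noteq> q"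
  shows "0 < hilbert_dist \<Omega> p q"
proof -
  obtain s t where st: "s < 0" "1 < t"
    "\<And>u. \<phi> p + u *\<^sub>R (\<phi> q - \<phi> p) \<in> closure cone \<longleftrightarrow> s \<le> u \<and> u \<le> t"
    "\<phi> p + s *\<^sub>R (\<phi> q - \<phi> p) \<notin> cone" "\<phi> p + t *\<^sub>R (\<phi> q - \<phi> p) \<notin> cone"
    using hilbert_ends_exist[OF assms] by blast
  have "0 < (- s) * (t - 1)"
    using st by (intro mult_pos_pos) auto
  then have "1 < ((1 - s) * t) / ((- s) * (t - 1))"
    using st by (subst less_divide_eq_1_pos) (auto simp: algebra_simps)
  from ln_gt_zero[OF this] show ?thesis
    unfolding hilbert_dist_line[OF assms st] by linarith
qed

lemma hilbert_nonneg: "0 \<le> hilbert_dist \<Omega> p q"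
  using hilbert_dist_pos[of p q] by (cases "p \<in> \<Omega> \<and> q \<in> \<Omega> \<and> p \<noteq> q") (auto simp: hilbert_dist_def)

lemma hilbert_sym: "hilbert_dist \<Omega> p q = hilbert_dist \<Omega> q p"
proof (cases "p \<in> \<Omega> \<and> q \<in> \<Omega>")
  case True
  have "hilbert_dist \<Omega> q p \<le> hilbert_dist \<Omega> p q" if "p \<in> \<Omega>" "q \<in> \<Omega>" for p q
    using hilbert_dist_le_iff[OF that hilbert_nonneg] hilbert_dist_le_iff[OF that(2,1) hilbert_nonneg]
      rel_sym exp_gt_zero by blast
  then show ?thesis
    using True by (metis order_antisym)
qed (auto simp: hilbert_dist_def)

lemma hilbert_metric: "Metric_space \<Omega> (hilbert_dist \<Omega>)"
proof
  fix x y z assume xyz: "x \<in> \<Omega>" "y \<in> \<Omega>" "z \<in> \<Omega>"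
  let ?D = "hilbert_dist \<Omega> x y" and ?E = "hilbert_dist \<Omega> y z"
  have "rel (exp (2 * ?D)) (\<phi> x) (\<phi> y)" "rel (exp (2 * ?E)) (\<phi> y) (\<phi> z)"
    using hilbert_dist_le_iff xyz hilbert_nonneg by blast+
  \<comment> \<open>Constants multiply under composition, so their logarithms satisfy the triangle
    inequality.\<close>
  then have "rel (exp (2 * (?D + ?E))) (\<phi> x) (\<phi> z)"
    using rel_trans[of "exp (2 * ?D)" _ _ "exp (2 * ?E)"] by (simp add: distrib_left exp_add)
  then show "hilbert_dist \<Omega> x z \<le> ?D + ?E"
    using hilbert_dist_le_iff xyz hilbert_nonneg by simp
next
  fix x y assume "x \<in> \<Omega>" "y \<in> \<Omega>"
  then show "hilbert_dist \<Omega> x y = 0 \<longleftrightarrow> x = y"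
    using hilbert_dist_pos[of x y] by (auto simp: hilbert_dist_def)
qed (use hilbert_nonneg hilbert_sym in auto)

end

section \<open>Convex hulls as a coarse filling\<close>

text \<open>Radius 0 is excluded: there \<open>nbhd\<close> is the set itself, not the empty set
  that the strict inequality would give.\<close>

lemma nbhd_pos:
  assumes "\<And>x y. 0 \<le> d x y" "0 < s"
  shows "nbhd X d s A = {x \<in> X. \<exists>a\<in>A. d x a < s}"
  using assms by (auto simp: nbhd_def pt_dist_def INF_less_iff ennreal_less_iff)

lemma hausdorff_dist_self:
  assumes "\<And>x. x \<in> A \<Longrightarrow> d x x = 0"
  shows "hausdorff_dist d A A = 0"
proof -
  have "pt_dist d x A = 0" if "x \<in> A" for x
    using INF_lower[OF that, of "\<lambda>a. ennreal (d x a)"] assms[OF that] by (simp add: pt_dist_def)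
  then show ?thesis
    by (cases "A = {}") (simp_all add: hausdorff_dist_def bot_ennreal)
qed

lemma is_PES_le_r_PES: "is_PES \<Omega> k S \<Longrightarrow> enat k \<le> r_PES \<Omega>"
  unfolding r_PES_def by (rule SUP_upper) blast

lemma set_nths_Int: "length as = Suc k \<Longrightarrow> set (nths as I) = (\<lambda>i. as ! i) ` ({..k} \<inter> I)"
  by (auto simp: set_nths less_Suc_eq_le)

context projective_domain
begin

lemma convex_base: "convex base"
proof -
  have "base = closure cone \<inter> {v. w \<bullet> v = 1}"
    by (auto simp: base_def zero_le_iff)
  then show ?thesis
    by (simp add: convex_Int convex_closure convex_C convex_hyperplane)
qed

definition hull_fill :: "'n rproj list \<Rightarrow> 'n rproj set"
  where "hull_fill as = {p \<in> \<Omega>. \<phi> p \<in> convex hull (\<phi> ` set as)}"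

text \<open>The footpoint z has w \<bullet> z equal to the sum of its weights, so normalizing z
  turns the weights into convex coefficients. Conversely, the factor \<alpha> of \<open>rel\<close>
  is multiplied into the coefficients of q.\<close>

lemma near_iff_hilbert_dist:
  assumes I: "finite I" and a: "\<And>i. i \<in> I \<Longrightarrow> a i \<in> base" and p: "p \<in> \<Omega>" and D: "0 \<le> D"
  shows "near (exp (2 * D)) a I (\<phi> p) \<longleftrightarrow>
    (\<exists>q\<in>\<Omega>. \<phi> q \<in> convex hull (a ` I) \<and> hilbert_dist \<Omega> p q \<le> D)"
proof
  assume "near (exp (2 * D)) a I (\<phi> p)"
  then obtain \<tau> where t: "\<And>i. i \<in> I \<Longrightarrow> 0 \<le> \<tau> i" "(\<Sum>i\<in>I. \<tau> i *\<^sub>R a i) \<preceq> \<phi> p"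
    "\<phi> p \<preceq> exp (2 * D) *\<^sub>R (\<Sum>i\<in>I. \<tau> i *\<^sub>R a i)"
    unfolding near_def by blast
  define z where "z = (\<Sum>i\<in>I. \<tau> i *\<^sub>R a i)"
  have z0: "0 \<preceq> z"
    unfolding z_def using t a base_D by (intro zero_le_sum) auto
  then have z: "z \<in> cone"
    using scale_C_D C_up[OF chart_in_cone[OF p]] t(3) unfolding z_def by blast
  have "rel (exp (2 * D)) (\<phi> p) z"
    using t by (intro relI[of 1 _ _ "exp (2 * D)"]) (auto simp: z_def)
  then have "rel (exp (2 * D)) (\<phi> p) (\<phi> (proj_pt z))"
    using rel_scale[of 1 "inverse (w \<bullet> z)"] w_pos_C[OF z] by (simp add: proj_pt_cone(2)[OF z])
  then have "hilbert_dist \<Omega> p (proj_pt z) \<le> D"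
    using hilbert_dist_le_iff p D proj_pt_cone(1)[OF z] by blast
  moreover have "\<phi> (proj_pt z) \<in> convex hull (a ` I)"
  proof -
    have "\<phi> (proj_pt z) = (\<Sum>i\<in>I. (\<tau> i / (w \<bullet> z)) *\<^sub>R a i)"
      unfolding proj_pt_cone(2)[OF z] by (subst (2) z_def) (simp add: scaleR_right.sum divide_inverse mult.commute)
    moreover have "w \<bullet> z = sum \<tau> I"
      using a base_D(2) by (simp add: z_def inner_sum_right)
    then have "(\<Sum>i\<in>I. \<tau> i / (w \<bullet> z)) = 1"
      using w_pos_C[OF z] by (simp flip: sum_divide_distrib)
    ultimately show ?thesis
      unfolding convex_hull_indexed[OF I] using t(1) w_pos_C[OF z]
      by (intro CollectI exI[of _ "\<lambda>i. \<tau> i / (w \<bullet> z)"]) auto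
  qed
  ultimately show "\<exists>q\<in>\<Omega>. \<phi> q \<in> convex hull (a ` I) \<and> hilbert_dist \<Omega> p q \<le> D"
    using proj_pt_cone(1)[OF z] by blast
next
  assume "\<exists>q\<in>\<Omega>. \<phi> q \<in> convex hull (a ` I) \<and> hilbert_dist \<Omega> p q \<le> D"
  then obtain q where q: "q \<in> \<Omega>" "\<phi> q \<in> convex hull (a ` I)" "hilbert_dist \<Omega> p q \<le> D"
    by blast
  then obtain t where t: "\<And>i. i \<in> I \<Longrightarrow> 0 \<le> t i" "\<phi> q = (\<Sum>i\<in>I. t i *\<^sub>R a i)"
    unfolding convex_hull_indexed[OF I] by blast
  obtain \<alpha> where \<alpha>: "0 < \<alpha>" "\<alpha> *\<^sub>R \<phi> q \<preceq> \<phi> p" "\<phi> p \<preceq> (\<alpha> * exp (2 * D)) *\<^sub>R \<phi> q"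
    using q p D hilbert_dist_le_iff unfolding rel_def by blast
  have "(\<Sum>i\<in>I. (\<alpha> * t i) *\<^sub>R a i) = \<alpha> *\<^sub>R \<phi> q"
    by (simp add: t(2) scaleR_right.sum)
  then show "near (exp (2 * D)) a I (\<phi> p)"
    unfolding near_def using \<alpha> t(1) by (intro exI[of _ "\<lambda>i. \<alpha> * t i"]) (simp add: mult.commute)
qed

text \<open>Metric neighbourhoods of hulls are convex: scaling the footpoint \<open>z\<close> of \<open>x\<close> by the
  constant \<open>\<alpha>\<close> in \<open>\<alpha> z \<preceq> x \<preceq> \<alpha> \<beta> z\<close> makes the comparison compatible with convex combinations.\<close>

lemma hull_fill_update:
  assumes as: "set as \<subseteq> \<Omega>" "as \<noteq> []" and x: "x \<in> \<Omega>" and z: "z \<in> hull_fill as"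
    and p: "p \<in> hull_fill (as[j := x])"
  shows "\<exists>q\<in>hull_fill as. hilbert_dist \<Omega> p q \<le> hilbert_dist \<Omega> x z"
proof -
  define D where "D = hilbert_dist \<Omega> x z"
  define S where "S = \<phi> ` set as"
  have D: "0 \<le> D"
    by (simp add: D_def hilbert_nonneg)
  have z': "z \<in> \<Omega>" "\<phi> z \<in> convex hull S"
    using z by (auto simp: hull_fill_def S_def)
  have p': "p \<in> \<Omega>" "\<phi> p \<in> convex hull (\<phi> ` set (as[j := x]))"
    using p by (auto simp: hull_fill_def)
  have "\<phi> ` set (as[j := x]) \<subseteq> insert (\<phi> x) S"
    using set_update_subset_insert[of as j x] by (auto simp: S_def)
  then have hp: "\<phi> p \<in> convex hull (insert (\<phi> x) S)"
    using p'(2) hull_mono by blast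
  have "S \<noteq> {}"
    using as by (simp add: S_def)
  from hp[unfolded convex_hull_insert[OF this]] obtain u v b where uv: "0 \<le> u" "0 \<le> v" "u + v = 1" "b \<in> convex hull S"
    "\<phi> p = u *\<^sub>R \<phi> x + v *\<^sub>R b"
    by blast
  have "S \<subseteq> base"
    using as \<phi>_base closure_subset by (auto simp: S_def)
  then have hb: "convex hull S \<subseteq> base"
    using convex_base by (simp add: hull_minimal)
  obtain \<alpha> where \<alpha>: "0 < \<alpha>" "\<alpha> *\<^sub>R \<phi> z \<preceq> \<phi> x" "\<phi> x \<preceq> (\<alpha> * exp (2 * D)) *\<^sub>R \<phi> z"
    using hilbert_dist_le_iff[OF x z'(1) D] unfolding D_def rel_def by auto
  define y where "y = (u * \<alpha>) *\<^sub>R \<phi> z + v *\<^sub>R b"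
  have b0: "0 \<preceq> b" "w \<bullet> b = 1" and z0: "0 \<preceq> \<phi> z" "w \<bullet> \<phi> z = 1"
    using hb uv(4) z'(2) base_D by blast+
  have "u *\<^sub>R \<alpha> *\<^sub>R \<phi> z \<preceq> u *\<^sub>R \<phi> x"
    using \<alpha> uv by (intro le_scale)
  then have yp: "y \<preceq> \<phi> p"
    unfolding y_def uv(5) by (intro le_add) auto
  have "u *\<^sub>R \<phi> x + v *\<^sub>R b \<preceq> u *\<^sub>R (\<alpha> * exp (2 * D)) *\<^sub>R \<phi> z + (v * exp (2 * D)) *\<^sub>R b"
    using \<alpha> uv D b0 mult_left_mono[of 1 "exp (2 * D)" v] by (intro le_add le_scale le_scale_mono) auto
  then have py: "\<phi> p \<preceq> exp (2 * D) *\<^sub>R y"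
    unfolding y_def uv(5) by (simp add: scaleR_add_right mult_ac)
  have "0 \<preceq> (u * \<alpha>) *\<^sub>R \<phi> z + v *\<^sub>R b"
    using le_add[OF le_scale[OF _ z0(1), of "u * \<alpha>"] le_scale[OF uv(2) b0(1)]] uv(1) \<alpha>(1) by simp
  then have y: "y \<in> cone"
    using scale_C_D C_up[OF chart_in_cone[OF p'(1)] py] unfolding y_def by blast
  have "rel (exp (2 * D)) (\<phi> p) y"
    using yp py by (intro relI[of 1 _ _ "exp (2 * D)"]) auto
  then have "rel (exp (2 * D)) (\<phi> p) (\<phi> (proj_pt y))"
    using rel_scale[of 1 "inverse (w \<bullet> y)"] w_pos_C[OF y] by (simp add: proj_pt_cone(2)[OF y])
  then have "hilbert_dist \<Omega> p (proj_pt y) \<le> D"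
    using hilbert_dist_le_iff p' D proj_pt_cone(1)[OF y] by blast
  moreover have "\<phi> (proj_pt y) \<in> convex hull S"
  proof -
    have wy: "w \<bullet> y = u * \<alpha> + v"
      by (simp add: y_def inner_add_right b0 z0)
    have "(u * \<alpha> / (w \<bullet> y)) *\<^sub>R \<phi> z + (v / (w \<bullet> y)) *\<^sub>R b \<in> convex hull S"
      using uv(1,2,4) z'(2) \<alpha>(1) w_pos_C[OF y] wy
      by (intro convexD[OF convex_convex_hull]) (auto simp flip: add_divide_distrib)
    then show ?thesis
      unfolding proj_pt_cone(2)[OF y] by (subst (2) y_def) (simp add: scaleR_add_right divide_inverse mult.commute)
  qed
  ultimately show ?thesis
    using proj_pt_cone(1)[OF y] by (auto simp: hull_fill_def S_def D_def)
qed

text \<open>Hulls satisfy the axioms before (F4) without error, which gives \<Lambda> 0 = 0. In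
  (F4), \<open>hull_fill_update\<close> does not enlarge the distance from x to the hull, which
  gives \<Lambda> R = R.\<close>

lemma hull_fill_filling: "coarse_filling \<Omega> (hilbert_dist \<Omega>) r (\<lambda>_. hull_fill) (\<lambda>R. R)"
proof -
  have self: "hilbert_dist \<Omega> x x = 0" for x
    by (simp add: hilbert_dist_def)
  have mono: "hull_fill xs \<subseteq> hull_fill ys" if "set xs \<subseteq> set ys" for xs ys
    using hull_mono[of "\<phi> ` set xs" "\<phi> ` set ys"] that by (auto simp: hull_fill_def image_mono)
  have F0: "hull_fill [a] = {a}" if "a \<in> \<Omega>" for a
    using that chart_inj \<Omega>_chart_dom by (auto simp: hull_fill_def)
  have F4: "hull_fill (as[j := x]) \<subseteq> nbhd \<Omega> (hilbert_dist \<Omega>) R (hull_fill as)"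
    if as: "as \<in> tuples \<Omega> (k + 1)" and R: "0 \<le> R"
      and x: "x \<in> nbhd \<Omega> (hilbert_dist \<Omega>) R (hull_fill as)" for as j x R k
  proof
    fix p assume p: "p \<in> hull_fill (as[j := x])"
    have as': "set as \<subseteq> \<Omega>" "as \<noteq> []"
      using as by (auto simp: tuples_def)
    \<comment> \<open>The disjunction covers both readings of \<open>nbhd\<close>: membership for R
      = 0 and a strict inequality for R > 0.\<close>
    have "\<exists>z\<in>hull_fill as. hilbert_dist \<Omega> x z \<le> 0 \<or> hilbert_dist \<Omega> x z < R" "x \<in> \<Omega>"
      using x R self by (cases "R = 0"; auto simp: nbhd_pos[OF hilbert_nonneg] nbhd_def[of _ _ 0] hull_fill_def)+
    then obtain q where q: "q \<in> hull_fill as" "hilbert_dist \<Omega> p q \<le> 0 \<or> hilbert_dist \<Omega> p q < R"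
      using hull_fill_update[OF as' _ _ p] by fastforce
    show "p \<in> nbhd \<Omega> (hilbert_dist \<Omega>) R (hull_fill as)"
    proof (cases "R = 0")
      case True
      have "p \<in> \<Omega>" "q \<in> \<Omega>"
        using p q by (auto simp: hull_fill_def)
      then have "p = q"
        using q(2) True hilbert_dist_pos[of p q] by force
      then show ?thesis
        using q True by (simp add: nbhd_def)
    next
      case False
      then have "hilbert_dist \<Omega> p q < R"
        using q(2) R by linarith
      then show ?thesis
        using False R q p by (auto simp: nbhd_pos[OF hilbert_nonneg] hull_fill_def)
    qed
  qed
  have nb0: "nbhd \<Omega> (hilbert_dist \<Omega>) 0 A = A" for A
    by (simp add: nbhd_def)
  have last: "set (as @ [last as]) \<subseteq> set as" if "as \<in> tuples \<Omega> (k + 1)" for as k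
    using that by (cases as rule: rev_cases) (auto simp: tuples_def)
  have perm: "hull_fill (permute_list \<sigma> as) = hull_fill as"
    if "as \<in> tuples \<Omega> (k + 1)" "\<sigma> permutes {..<k + 1}" for as \<sigma> k
    using that set_permute_list[of \<sigma> as] by (simp add: tuples_def hull_fill_def)
  have nths: "hull_fill (nths as I) \<subseteq> hull_fill as" for as I
    by (rule mono) (rule set_nths_subset)
  show ?thesis
    unfolding coarse_filling_def nb0
  proof (intro conjI allI ballI impI)
    show "mono_on {0..} (\<lambda>R :: real. R)"
      by (simp add: mono_on_def)
    show "hull_fill as \<subseteq> \<Omega>" for as
      by (auto simp: hull_fill_def)
    show "hausdorff_dist (hilbert_dist \<Omega>) {a} (hull_fill [a]) \<le> ennreal 0" if "a \<in> \<Omega>" for a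
      using hausdorff_dist_self[of "{a}" "hilbert_dist \<Omega>"] self by (simp add: F0[OF that])
    show "hausdorff_dist (hilbert_dist \<Omega>) (hull_fill as) (hull_fill (permute_list \<sigma> as)) \<le> ennreal 0"
      if "as \<in> tuples \<Omega> (k + 1)" "\<sigma> permutes {..<k + 1}" for as \<sigma> k
      using hausdorff_dist_self[of "hull_fill as" "hilbert_dist \<Omega>"] self by (simp add: perm[OF that])
    show "hull_fill (as @ [last as]) \<subseteq> hull_fill as" if "as \<in> tuples \<Omega> (k + 1)" for as k
      using mono last[OF that] by blast
  qed (use nths F4 in blast)+
qed

section \<open>Linear lifts of automorphisms\<close>

lemma aut_lift:
  assumes "g \<in> Aut \<Omega>"
  shows "\<exists>A. linear A \<and> inj A \<and> A ` cone = cone \<and> (\<forall>v\<in>cone. proj_pt (A v) = g (proj_pt v))"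
proof -
  obtain M where M: "g = proj_map M" "invertible M" "g ` \<Omega> = \<Omega>"
    using assms by (auto simp: Aut_def PGL_def)
  have inj: "inj ((*v) M)"
    using M(2) by (simp add: invertible_eq_bij bij_is_inj)
  have cz: "v \<noteq> 0" if "v \<in> cone" for v
    using that zero_C by blast
  have gp: "proj_pt (M *v v) = g (proj_pt v)" if "v \<in> cone" for v
    using proj_map_proj_pt[OF cz[OF that]] by (simp add: M(1))
  have Mz: "M *v v \<noteq> 0" if "v \<in> cone" for v
    using inj cz[OF that] by (metis injD matrix_vector_mult_0_right)
  have gin: "g (proj_pt v) \<in> \<Omega>" if "v \<in> cone" for v
    using M(3) proj_pt_cone(1)[OF that] by blast
  have wz: "w \<bullet> (M *v v) \<noteq> 0" if "v \<in> cone" for v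
    using \<Omega>_chart_dom[OF gin[OF that]] proj_pt_in_chart_dom[OF Mz[OF that]] gp[OF that] by metis
  \<comment> \<open>The matrix maps the cone into itself or into its negative: if w changed sign
    between two images, it would vanish at the image of some x + t y in the cone, although this
    image lies over \<Omega>.\<close>
  have sign: "0 < w \<bullet> (M *v x) \<longleftrightarrow> 0 < w \<bullet> (M *v y)" if xy: "x \<in> cone" "y \<in> cone" for x y
  proof -
    have False if xy: "x \<in> cone" "y \<in> cone" and "0 < w \<bullet> (M *v x)" "\<not> 0 < w \<bullet> (M *v y)" for x y
    proof -
      have neg: "w \<bullet> (M *v y) < 0"
        using that wz[OF xy(2)] by linarith
      define t where "t = - (w \<bullet> (M *v x)) / (w \<bullet> (M *v y))"
      have "0 < t"
        unfolding t_def using neg that by (intro divide_neg_neg) auto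
      then have "x + t *\<^sub>R y \<in> cone"
        using xy by (intro add_C scale_C)
      moreover have "w \<bullet> (M *v (x + t *\<^sub>R y)) = w \<bullet> (M *v x) + t * (w \<bullet> (M *v y))"
        by (simp add: matrix_vector_right_distrib matrix_vector_mult_scaleR inner_add_right)
      then have "w \<bullet> (M *v (x + t *\<^sub>R y)) = 0"
        using neg by (simp add: t_def)
      ultimately show False
        using wz by blast
    qed
    then show ?thesis
      using that by blast
  qed
  obtain v\<^sub>0 where v0: "v\<^sub>0 \<in> cone"
    using ne_C by blast
  define \<sigma> :: real where "\<sigma> = (if 0 < w \<bullet> (M *v v\<^sub>0) then 1 else - 1)"
  have \<sigma>: "\<sigma> \<noteq> 0"
    by (simp add: \<sigma>_def)
  define A where "A v = \<sigma> *\<^sub>R (M *v v)" for v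
  have wA: "0 < w \<bullet> A v" if "v \<in> cone" for v
    using sign[OF v0 that] wz[OF that] by (auto simp: A_def \<sigma>_def)
  have gA: "proj_pt (A v) = g (proj_pt v)" if "v \<in> cone" for v
    unfolding A_def proj_pt_scale[OF \<sigma>] by (rule gp[OF that])
  have lin: "linear A"
    unfolding A_def by (intro linear_compose_scale_right matrix_vector_mul_linear)
  moreover have "inj A"
    using inj \<sigma> by (auto simp: A_def inj_def)
  moreover have "A ` cone = cone"
  proof (intro equalityI subsetI)
    fix u assume "u \<in> A ` cone"
    then obtain v where v: "v \<in> cone" "u = A v"
      by blast
    then show "u \<in> cone"
      using gin[OF v(1)] gA[OF v(1)] wA[OF v(1)] by (simp add: cone_def)
  next
    fix u assume u: "u \<in> cone"
    then obtain q where q: "q \<in> \<Omega>" "proj_pt u = g q"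
      using M(3) proj_pt_cone(1) by blast
    define v where "v = \<phi> q"
    have v: "v \<in> cone" "proj_pt v = q"
      using chart_in_cone[OF q(1)] chart_props(2)[OF \<Omega>_chart_dom[OF q(1)]] by (simp_all add: v_def)
    have "A v \<noteq> 0"
      using wA[OF v(1)] by auto
    then obtain c where c: "c \<noteq> 0" "A v = c *\<^sub>R u"
      using proj_pt_eqD[of "A v" u] gA[OF v(1)] v q wA[OF v(1)] cz[OF u] by auto
    have "0 < c"
      using wA[OF v(1)] w_pos_C[OF u] by (simp add: c zero_less_mult_iff)
    then have "u = A (inverse c *\<^sub>R v)" "inverse c *\<^sub>R v \<in> cone"
      using c lin v by (simp_all add: linear_scale scale_C)
    then show "u \<in> A ` cone"
      by blast
  qed
  ultimately show ?thesis
    using gA by blast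
qed

lemma cocompact_chart:
  assumes K: "compact K" "K \<subseteq> \<Omega>" "(\<Union>g\<in>Aut \<Omega>. g ` K) = \<Omega>"
  shows "cocompact_cone cone w cbound (\<phi> ` K)"
proof
  have "continuous_on K \<phi>"
    unfolding continuous_on_open_invariant
  proof (intro allI impI)
    fix B :: "(real ^ 'n) set" assume "open B"
    then show "\<exists>A. open A \<and> A \<inter> K = \<phi> -` B \<inter> K"
      using open_chart_vimage[of B w] K(2) \<Omega>_chart_dom
      by (intro exI[of _ "{p \<in> chart_dom w. \<phi> p \<in> B}"]) auto
  qed
  then show "compact (\<phi> ` K)"
    using K(1) by (rule compact_continuous_image)
  show "\<phi> ` K \<subseteq> cone"
    using K(2) chart_in_cone by blast
  fix x assume x: "x \<in> cone"
  then obtain g q where gq: "g \<in> Aut \<Omega>" "q \<in> K" "proj_pt x = g q"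
    using proj_pt_cone(1) K(3) by blast
  obtain A where A: "linear A" "inj A" "A ` cone = cone" "\<forall>v\<in>cone. proj_pt (A v) = g (proj_pt v)"
    using aut_lift[OF gq(1)] by blast
  \<comment> \<open>The automorphism g carries a point of K to the line of x, so the inverse of its
    lift carries x back over K.\<close>
  obtain B where B: "linear B" "\<And>x. B (A x) = x" "\<And>x. A (B x) = x"
    using linear_injective_isomorphism[OF A(1,2)] by blast
  have BC: "B ` cone = cone"
    using A(3) B(2) by (metis (no_types, lifting) image_image image_cong image_ident)
  define v where "v = \<phi> q"
  have v: "v \<in> cone" "proj_pt v = q" "w \<bullet> v = 1"
    using gq(2) K(2) chart_in_cone chart_props[OF \<Omega>_chart_dom] by (auto simp: v_def)
  have "proj_pt (A v) = proj_pt x"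
    using A(4) v gq(3) by simp
  moreover have "A v \<noteq> 0" "x \<noteq> 0"
    using A(3) v(1) x zero_C by (metis image_eqI)+
  ultimately obtain c where c: "c \<noteq> 0" "x = c *\<^sub>R A v"
    using proj_pt_eqD by metis
  have "B x = c *\<^sub>R v"
    using c B by (simp add: linear_scale)
  moreover have "0 < w \<bullet> B x"
    using BC x w_pos_C by blast
  ultimately have "0 < c" "inverse c *\<^sub>R B x = v"
    using v(3) by auto
  then show "\<exists>A s. linear A \<and> inj A \<and> A ` cone = cone \<and> 0 < s \<and> s *\<^sub>R A x \<in> \<phi> ` K"
    using B(1,3) BC gq(2) unfolding v_def
    by (intro exI[of _ B] exI[of _ "inverse c"]) (auto intro: inj_on_inverseI)
qed

text \<open>A linear relation among the vertices would let the weights of x move along it until one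
  of them vanishes, and x would lie in the cone over a facet.\<close>

lemma independent_of_facets:
  assumes x: "near 1 a {..k} x" and facets: "\<And>j. j \<le> k \<Longrightarrow> \<not> near 1 a ({..k} - {j}) x"
  shows "inj_on a {..k}" "independent (a ` {..k})"
proof -
  obtain t where t: "\<And>i. i \<le> k \<Longrightarrow> 0 \<le> t i" "x = (\<Sum>i\<le>k. t i *\<^sub>R a i)"
    using x unfolding near_one_iff by auto
  have np: False if s: "(\<Sum>i\<le>k. c i *\<^sub>R a i) = 0" and m: "m \<le> k" "0 < c m" for c m
  proof -
    define P where "P = {i. i \<le> k \<and> 0 < c i}"
    have P: "finite P" "P \<noteq> {}"
      using m by (auto simp: P_def)
    \<comment> \<open>The first time at which a decreasing weight t i - \<theta> c i reaches zero;
      all other weights are still nonnegative.\<close>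
    define \<theta> where "\<theta> = Min ((\<lambda>i. t i / c i) ` P)"
    obtain j where j: "j \<in> P" "\<theta> = t j / c j"
      using Min_in[of "(\<lambda>i. t i / c i) ` P"] P unfolding \<theta>_def by blast
    have \<theta>0: "0 \<le> \<theta>"
      using j t(1) by (simp add: P_def)
    have nn: "0 \<le> t i - \<theta> * c i" if "i \<le> k" for i
    proof (cases "0 < c i")
      case True
      then have "\<theta> \<le> t i / c i"
        unfolding \<theta>_def using P that by (intro Min_le) (auto simp: P_def)
      then show ?thesis
        using True by (simp add: pos_le_divide_eq)
    next
      case False
      then have "\<theta> * c i \<le> 0"
        using \<theta>0 by (simp add: mult_nonneg_nonpos)
      then show ?thesis
        using t(1)[OF that] by linarith
    qed
    have "x = (\<Sum>i\<le>k. (t i - \<theta> * c i) *\<^sub>R a i)"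
      using s by (simp add: t(2) scaleR_diff_left sum_subtractf flip: scaleR_scaleR scaleR_right.sum)
    also have "\<dots> = (\<Sum>i\<in>{..k} - {j}. (t i - \<theta> * c i) *\<^sub>R a i)"
      using j by (intro sum.mono_neutral_right) (auto simp: P_def)
    finally have "near 1 a ({..k} - {j}) x"
      unfolding near_one_iff using nn by (intro exI[of _ "\<lambda>i. t i - \<theta> * c i"]) auto
    then show False
      using facets[of j] j by (simp add: P_def)
  qed
  have zero: "c m = 0" if "(\<Sum>i\<le>k. c i *\<^sub>R a i) = 0" "m \<le> k" for c m
    using np[OF that] np[of "\<lambda>i. - c i", OF _ that(2)] that(1)
    by (simp add: sum_negf) (use linorder_less_linear in blast)
  show inj: "inj_on a {..k}"
  proof (rule inj_onI)
    fix i j assume ij: "i \<in> {..k}" "j \<in> {..k}" "a i = a j"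
    \<comment> \<open>If two vertices coincide, the difference of their unit weights is a
      relation.\<close>
    have "(\<Sum>l\<le>k. ((if l = i then 1 else 0) - (if l = j then 1 else 0)) *\<^sub>R a l) = 0"
      using ij by (simp add: scaleR_diff_left sum_subtractf if_distrib[of "\<lambda>c. c *\<^sub>R _"] sum.delta cong: if_cong)
    from zero[OF this, of i] ij show "i = j"
      by (auto split: if_splits)
  qed
  show "independent (a ` {..k})"
  proof (rule independent_if_scalars_zero)
    fix f v assume "(\<Sum>v\<in>a ` {..k}. f v *\<^sub>R v) = 0" "v \<in> a ` {..k}"
    then show "f v = 0"
      using zero[of "f \<circ> a"] by (auto simp: sum.reindex[OF inj])
  qed simp
qed

lemma PES_of_vectors:
  assumes k: "1 \<le> k" and a: "\<And>i. i \<le> k \<Longrightarrow> a i \<in> base" and x: "x \<in> cone" "near 1 a {..k} x"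
    and facets: "\<And>j x. j \<le> k \<Longrightarrow> x \<in> cone \<Longrightarrow> \<not> near 1 a ({..k} - {j}) x"
  shows "\<exists>S. is_PES \<Omega> k S"
proof -
  define v where "v i = proj_pt (a i)" for i
  have ind: "inj_on a {..k}" "independent (a ` {..k})"
    using independent_of_facets[OF x(2)] facets x(1) by blast+
  have \<phi>v: "\<phi> (v i) = a i" and cl: "v i \<in> closure \<Omega>" if "i \<le> k" for i
    using \<phi>_proj_pt_base proj_pt_base a[OF that] by (simp_all add: v_def)
  have img: "\<phi> ` v ` I = a ` I" if "I \<subseteq> {..k}" for I
    using \<phi>v that by (force simp: image_iff)
  have "span (\<Union>i\<le>k. line_of (v i)) = span (a ` {..k})"
  proof (rule span_eq[THEN iffD2], intro conjI)
    have l: "line_of (v i) = span {a i}" if "i \<le> k" for i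
      unfolding v_def by (rule line_of_proj_pt[OF base_D(3)[OF a[OF that]]])
    show "(\<Union>i\<le>k. line_of (v i)) \<subseteq> span (a ` {..k})"
      using l span_mono[of "{a _}" "a ` {..k}"] by fastforce
    show "a ` {..k} \<subseteq> span (\<Union>i\<le>k. line_of (v i))"
      using l by (auto intro!: span_base simp: span_base)
  qed
  then have dim: "dim (span (\<Union>i\<le>k. line_of (v i))) = k + 1"
    using dim_eq_card_independent[OF ind(2)] card_image[OF ind(1)] by simp
  have facet: "proj_hull \<Omega> (v ` ({..k} - {i})) \<subseteq> bdry \<Omega>" if "i \<le> k" for i
  proof
    fix p assume "p \<in> proj_hull \<Omega> (v ` ({..k} - {i}))"
    then have p: "p \<in> closure \<Omega>" "\<phi> p \<in> convex hull (a ` ({..k} - {i}))"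
      using img[of "{..k} - {i}"] by (auto simp: proj_hull_def some_chart)
    then have "near 1 a ({..k} - {i}) (\<phi> p)"
      unfolding near_one_iff by (auto simp: convex_hull_indexed)
    then show "p \<in> bdry \<Omega>"
      using facets[OF that] p(1) unfolding bdry_iff by blast
  qed
  have vb: "v ` {..k} \<subseteq> bdry \<Omega>"
  proof
    fix p assume "p \<in> v ` {..k}"
    then obtain i where i: "i \<le> k" "p = v i"
      by auto
    \<comment> \<open>As 1 \<le> k, some facet contains the given vertex.\<close>
    obtain j where j: "j \<le> k" "j \<noteq> i"
      using k by (cases "i = 0") auto
    have "p \<in> proj_hull \<Omega> (v ` ({..k} - {j}))"
      using i j cl by (auto simp: proj_hull_def some_chart intro!: hull_inc)
    then show "p \<in> bdry \<Omega>"
      using facet[OF j(1)] by blast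
  qed
  have meets: "proj_hull \<Omega> (v ` {..k}) \<inter> \<Omega> \<noteq> {}"
  proof -
    have px: "proj_pt x \<in> \<Omega>"
      using proj_pt_cone(1)[OF x(1)] .
    have "near 1 a {..k} (inverse (w \<bullet> x) *\<^sub>R x + 0 *\<^sub>R x)"
      using w_pos_C[OF x(1)] by (intro near_add x(2)) auto
    \<comment> \<open>Distance 0 in \<open>near_iff_hilbert_dist\<close> extracts a point of the
      hull.\<close>
    then have "near (exp (2 * 0)) a {..k} (\<phi> (proj_pt x))"
      by (simp add: proj_pt_cone(2)[OF x(1)])
    then obtain q where "q \<in> \<Omega>" "\<phi> q \<in> convex hull (a ` {..k})"
      using near_iff_hilbert_dist[of "{..k}" a "proj_pt x" 0] a px by auto
    then have "q \<in> proj_hull \<Omega> (v ` {..k}) \<inter> \<Omega>"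
      using closure_subset[of \<Omega>] img[of "{..k}"] by (auto simp: proj_hull_def some_chart)
    then show ?thesis
      by blast
  qed
  show ?thesis
    unfolding is_PES_def nondeg_vertices_def
    using k cl dim vb meets facet by (intro exI[of _ "proj_hull \<Omega> (v ` {..k})"] exI[of _ v]) auto
qed

text \<open>A chord of \<Omega> is a properly embedded simplex of dimension one, its facets being
  its ends. This supplies the condition r \<ge> 1 in the definition of a coarse median
  structure.\<close>

lemma r_PES_ge_1:
  assumes "2 \<le> CARD('n)"
  shows "enat 1 \<le> r_PES \<Omega>"
proof -
  obtain x where x: "x \<in> base" "x \<in> cone"
    using ne_\<Omega> chart_in_cone \<phi>_base closure_subset by blast
  \<comment> \<open>Dimension at least two leaves a direction in the kernel of w, along which the
    slice w = 1 is preserved.\<close>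
  obtain e where e: "e \<noteq> 0" "w \<bullet> e = 0"
    using orthogonal_to_vector_exists[of w] assms by (auto simp: orthogonal_def)
  have "((\<lambda>t. x + t *\<^sub>R e) \<longlongrightarrow> x + 0 *\<^sub>R e) (at_right 0)"
    by (intro tendsto_intros)
  then have "\<forall>\<^sub>F t in at_right 0. x + t *\<^sub>R e \<in> cone"
    using open_cone x(2) by (intro topological_tendstoD) auto
  then have "\<forall>\<^sub>F t in at_right 0. x + t *\<^sub>R e \<in> cone \<and> 0 < t"
    by (intro eventually_conj eventually_at_right_less)
  then obtain t where t: "x + t *\<^sub>R e \<in> cone" "0 < t"
    using eventually_happens'[OF trivial_limit_at_right_real] by blast
  define y where "y = x + t *\<^sub>R e"
  have y: "y \<in> cone" "w \<bullet> y = 1" "x \<noteq> y"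
    using t e base_D(2)[OF x(1)] by (auto simp: y_def inner_add_right)
  obtain s u where su: "s < 0" "1 < u" "\<And>r. x + r *\<^sub>R (y - x) \<in> closure cone \<longleftrightarrow> s \<le> r \<and> r \<le> u"
    "x + s *\<^sub>R (y - x) \<notin> cone" "x + u *\<^sub>R (y - x) \<notin> cone"
    using line_ends[OF x(2) base_D(2)[OF x(1)] y] by blast
  define a where "a i = x + (if i = 0 then s else u) *\<^sub>R (y - x)" for i :: nat
  have ab: "a i \<in> base" and an: "a i \<notin> cone" for i
    using su y(2) base_D(2)[OF x(1)]
    by (auto simp: a_def base_def zero_le_iff inner_add_right inner_diff_right)
  have "\<exists>S. is_PES \<Omega> 1 S"
  proof (rule PES_of_vectors)
    \<comment> \<open>Barycentric coordinates of the parameter 0 between s and u.\<close>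
    have "x = (u / (u - s)) *\<^sub>R a 0 + (- s / (u - s)) *\<^sub>R a 1"
    proof -
      have "u / (u - s) + - s / (u - s) = (u - s) / (u - s)"
        by (simp only: add_divide_distrib[symmetric]) simp
      then have e: "u / (u - s) + - s / (u - s) = 1" "u / (u - s) * s + - s / (u - s) * u = 0"
        using su(1,2) by (simp_all add: mult.commute)
      have "p *\<^sub>R (x + s *\<^sub>R d) + q *\<^sub>R (x + u *\<^sub>R d) = (p + q) *\<^sub>R x + (p * s + q * u) *\<^sub>R d" for p q d
        by (simp add: algebra_simps)
      from this[of "u / (u - s)" "y - x" "- s / (u - s)", unfolded e] show ?thesis
        by (simp add: a_def)
    qed
    moreover have "0 \<le> u / (u - s)" "0 \<le> - s / (u - s)"
      using su by (intro divide_nonneg_pos; simp)+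
    ultimately show "near 1 a {..1} x"
      unfolding near_one_iff
      by (intro exI[of _ "\<lambda>i. if i = 0 then u / (u - s) else - s / (u - s)"]) (auto simp: atMost_Suc)
  next
    fix j z assume j: "j \<le> (1::nat)" and z: "z \<in> cone"
    have "{..1} - {j} = {1 - j}"
      using j by (auto simp: le_Suc_eq)
    moreover have "\<tau> *\<^sub>R a i \<notin> cone" for \<tau> i
      using an scale_C_D base_D(1)[OF ab] by blast
    ultimately show "\<not> near 1 a ({..1} - {j}) z"
      using z unfolding near_one_iff by auto
  qed (use x ab in auto)
  then show ?thesis
    using is_PES_le_r_PES by blast
qed

section \<open>The coarse median\<close>

lemma hull_fill_nths:
  assumes "length as = Suc k"
  shows "hull_fill (nths as I) = {p \<in> \<Omega>. \<phi> p \<in> convex hull ((\<lambda>i. \<phi> (as ! i)) ` ({..k} \<inter> I))}"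
  using set_nths_Int[OF assms, of I] by (simp add: hull_fill_def image_image)

lemma near_hull_fill:
  assumes as: "as \<in> tuples \<Omega> (Suc k)" and p: "p \<in> \<Omega>" and D: "0 \<le> D" and I: "{..k} \<inter> I = J"
  shows "near (exp (2 * D)) (\<lambda>i. \<phi> (as ! i)) J (\<phi> p) \<longleftrightarrow>
    (\<exists>q\<in>hull_fill (nths as I). hilbert_dist \<Omega> p q \<le> D)"
proof -
  have len: "length as = Suc k"
    using as by (simp add: tuples_def)
  have "\<phi> (as ! i) \<in> base" if "i \<in> J" for i
  proof -
    have "as ! i \<in> \<Omega>"
      using as that I nth_mem[of i as] by (auto simp: tuples_def)
    then show ?thesis
      using \<phi>_base closure_subset by blast
  qed
  moreover have "finite J"
    using I by auto
  ultimately show ?thesis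
    using near_iff_hilbert_dist[OF _ _ p D, of J "\<lambda>i. \<phi> (as ! i)"]
    by (auto simp: hull_fill_nths[OF len] I)
qed

lemma tuple_in_cone: "as \<in> tuples \<Omega> (Suc k) \<Longrightarrow> i \<le> k \<Longrightarrow> \<phi> (as ! i) \<in> cone"
  by (auto simp: tuples_def intro!: chart_in_cone dest: subsetD[OF _ nth_mem])

lemma center_exists:
  assumes cc: "cocompact_cone cone w cbound K" and r: "1 \<le> r" and PES: "r_PES \<Omega> \<le> enat r"
  shows "\<exists>b\<ge>0. \<forall>as\<in>tuples \<Omega> (r + 2). \<exists>p\<in>\<Omega>. \<forall>j\<le>r + 1.
    \<exists>q\<in>hull_fill (nths as (- {j})). hilbert_dist \<Omega> p q \<le> b"
proof -
  interpret cc: cocompact_cone cone w cbound K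
    by (rule cc)
  have "\<not> (\<exists>a. (\<forall>i\<le>r + 1. a i \<in> base) \<and> (\<exists>x\<in>cone. near 1 a {..r + 1} x) \<and>
      (\<forall>j\<le>r + 1. \<forall>x\<in>cone. \<not> near 1 a ({..r + 1} - {j}) x))"
  proof
    assume "\<exists>a. (\<forall>i\<le>r + 1. a i \<in> base) \<and> (\<exists>x\<in>cone. near 1 a {..r + 1} x) \<and>
      (\<forall>j\<le>r + 1. \<forall>x\<in>cone. \<not> near 1 a ({..r + 1} - {j}) x)"
    then obtain a x where "\<And>i. i \<le> r + 1 \<Longrightarrow> a i \<in> base" "x \<in> cone" "near 1 a {..r + 1} x"
      "\<And>j x. j \<le> r + 1 \<Longrightarrow> x \<in> cone \<Longrightarrow> \<not> near 1 a ({..r + 1} - {j}) x"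
      by blast
    from PES_of_vectors[OF _ this] obtain S where "is_PES \<Omega> (r + 1) S"
      by auto
    then have "enat (r + 1) \<le> enat r"
      using is_PES_le_r_PES PES order_trans by blast
    then show False
      by simp
  qed
  then obtain \<beta> where \<beta>: "1 \<le> \<beta>" "\<And>a. (\<forall>i\<le>r + 1. a i \<in> cone) \<Longrightarrow>
      (\<exists>x\<in>cone. \<forall>j\<le>r + 1. near \<beta> a ({..r + 1} - {j}) x)"
    using cc.center_or_simplex[of "r + 1"] by auto
  define b where "b = ln \<beta> / 2"
  have b: "0 \<le> b" "exp (2 * b) = \<beta>"
    using \<beta>(1) by (auto simp: b_def)
  have "\<exists>p\<in>\<Omega>. \<forall>j\<le>r + 1. \<exists>q\<in>hull_fill (nths as (- {j})). hilbert_dist \<Omega> p q \<le> b"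
    if "as \<in> tuples \<Omega> (r + 2)" for as
  proof -
    have as: "as \<in> tuples \<Omega> (Suc (r + 1))"
      using that by simp
    obtain x where x: "x \<in> cone" "\<And>j. j \<le> r + 1 \<Longrightarrow> near \<beta> (\<lambda>i. \<phi> (as ! i)) ({..r + 1} - {j}) x"
      using \<beta>(2)[of "\<lambda>i. \<phi> (as ! i)"] tuple_in_cone[OF as] by blast
    \<comment> \<open>\<open>near_add\<close> with second coefficient 0 serves to rescale x to the
      slice.\<close>
    have "near \<beta> (\<lambda>i. \<phi> (as ! i)) ({..r + 1} - {j}) (\<phi> (proj_pt x))" if "j \<le> r + 1" for j
      using near_add[OF x(2)[OF that] x(2)[OF that], of "inverse (w \<bullet> x)" 0] w_pos_C[OF x(1)]
      by (simp add: proj_pt_cone(2)[OF x(1)])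
    then show ?thesis
      using near_hull_fill[OF as proj_pt_cone(1)[OF x(1)] b(1)] proj_pt_cone(1)[OF x(1)] b(2)
      by (metis Diff_eq)
  qed
  then show ?thesis
    using b(1) by blast
qed

text \<open>A predicate in B, so that a threshold can be chosen for each pair of scales when \<Psi>
  is built. The distance 2 s + 1 is the constant 3 \<beta>^2 for \<beta> = exp (2 s), rounded
  up.\<close>

definition center_bound :: "nat \<Rightarrow> real \<Rightarrow> real \<Rightarrow> real \<Rightarrow> bool"
  where "center_bound r s D B \<longleftrightarrow> 0 \<le> B \<and> (\<forall>as\<in>tuples \<Omega> (r + 2). \<forall>x\<in>\<Omega>. \<forall>y\<in>\<Omega>.
    (\<forall>j\<le>r + 1. \<forall>z\<in>{x, y}. \<exists>q\<in>hull_fill (nths as (- {j})). hilbert_dist \<Omega> z q \<le> s) \<longrightarrow>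
    B < hilbert_dist \<Omega> x y \<longrightarrow>
    (\<exists>i j. \<exists>v\<in>\<Omega>. \<exists>v'\<in>\<Omega>. i \<le> r + 1 \<and> j \<le> r + 1 \<and> i \<noteq> j \<and>
      (\<forall>l\<le>r + 1. \<forall>z\<in>{v, v'}. \<exists>q\<in>hull_fill (nths as (- {l})). hilbert_dist \<Omega> z q \<le> s) \<and>
      (\<forall>z\<in>{v, v'}. \<exists>q\<in>hull_fill (nths as (- {i, j})). hilbert_dist \<Omega> z q \<le> 2 * s + 1) \<and>
      D < hilbert_dist \<Omega> v v'))"

lemma far_centers:
  assumes cc: "cocompact_cone cone w cbound K" and s: "0 \<le> s" and D: "0 \<le> D"
  shows "\<exists>B. center_bound r s D B"
proof -
  interpret cc: cocompact_cone cone w cbound K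
    by (rule cc)
  define \<beta> where "\<beta> = exp (2 * s)"
  define \<gamma> where "\<gamma> = exp (2 * (2 * s + 1))"
  \<comment> \<open>Because 3 < e^2, the constant 3 exp (4 s) is below exp (4 s + 2), which
    corresponds to the distance 2 s + 1.\<close>
  have "(3 :: real) < exp 1 * exp 1"
  proof -
    have "(2 :: real) \<le> exp 1"
      using exp_ge_add_one_self[of 1] by simp
    then show ?thesis
      using mult_mono[of 2 "exp 1" 2 "exp 1 :: real"] by simp
  qed
  then have "3 * (\<beta>\<^sup>2) < exp 1 * exp 1 * \<beta>\<^sup>2"
    by (intro mult_strict_right_mono) (auto simp: \<beta>_def)
  also have "\<dots> = \<gamma>"
    by (simp add: \<beta>_def \<gamma>_def power2_eq_square flip: exp_add)
  finally have \<beta>: "1 \<le> \<beta>" "3 * \<beta>\<^sup>2 < \<gamma>"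
    using s by (auto simp: \<beta>_def)
  obtain M where M: "\<And>a x y. \<lbrakk>\<forall>i\<le>r + 1. a i \<in> cone; x \<in> cone; y \<in> cone;
      \<forall>j\<le>r + 1. near \<beta> a ({..r + 1} - {j}) x \<and> near \<beta> a ({..r + 1} - {j}) y; \<not> rel M x y\<rbrakk> \<Longrightarrow>
    \<exists>i j v v'. i \<le> r + 1 \<and> j \<le> r + 1 \<and> i \<noteq> j \<and> v \<in> cone \<and> v' \<in> cone \<and>
      (\<forall>l\<le>r + 1. near \<beta> a ({..r + 1} - {l}) v \<and> near \<beta> a ({..r + 1} - {l}) v') \<and>
      near \<gamma> a ({..r + 1} - {i, j}) v \<and> near \<gamma> a ({..r + 1} - {i, j}) v' \<and> \<not> rel (exp (2 * D)) v v'"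
    using cc.far_points_near_codim2[OF \<beta>, of "r + 1" "exp (2 * D)"] by blast
  \<comment> \<open>M may be below 1; the maximum makes B nonnegative.\<close>
  define B where "B = ln (max 1 M) / 2"
  have B: "0 \<le> B" "M \<le> exp (2 * B)"
    by (auto simp: B_def)
  show ?thesis
    unfolding center_bound_def
  proof (intro exI[of _ B] conjI ballI impI B(1))
    fix as x y
    assume "as \<in> tuples \<Omega> (r + 2)" and xy: "x \<in> \<Omega>" "y \<in> \<Omega>"
      and near: "\<forall>j\<le>r + 1. \<forall>z\<in>{x, y}. \<exists>q\<in>hull_fill (nths as (- {j})). hilbert_dist \<Omega> z q \<le> s"
      and far: "B < hilbert_dist \<Omega> x y"
    then have as: "as \<in> tuples \<Omega> (Suc (r + 1))"
      by simp
    define a where "a i = \<phi> (as ! i)" for i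
    have s': "0 \<le> 2 * s + 1"
      using s by simp
    have n1: "near \<beta> a ({..r + 1} - {j}) (\<phi> z) \<longleftrightarrow>
        (\<exists>q\<in>hull_fill (nths as (- {j})). hilbert_dist \<Omega> z q \<le> s)" if "z \<in> \<Omega>" for z j
      unfolding a_def \<beta>_def by (rule near_hull_fill[OF as that s]) auto
    have n2: "near \<gamma> a ({..r + 1} - {i, j}) (\<phi> z) \<longleftrightarrow>
        (\<exists>q\<in>hull_fill (nths as (- {i, j})). hilbert_dist \<Omega> z q \<le> 2 * s + 1)" if "z \<in> \<Omega>" for z i j
      unfolding a_def \<gamma>_def by (rule near_hull_fill[OF as that s']) auto
    have "\<not> rel M (\<phi> x) (\<phi> y)"
    proof
      assume "rel M (\<phi> x) (\<phi> y)"
      then have "rel (exp (2 * B)) (\<phi> x) (\<phi> y)"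
        using rel_mono B(2) C_le chart_in_cone xy by blast
      then show False
        using hilbert_dist_le_iff[OF xy B(1)] far by simp
    qed
    note far' = this
    have aC: "\<forall>i\<le>r + 1. a i \<in> cone"
      using tuple_in_cone[OF as] by (simp add: a_def)
    have nxy: "\<forall>j\<le>r + 1. near \<beta> a ({..r + 1} - {j}) (\<phi> x) \<and> near \<beta> a ({..r + 1} - {j}) (\<phi> y)"
      using near n1 xy by simp
    from M[OF aC chart_in_cone[OF xy(1)] chart_in_cone[OF xy(2)] nxy far'] obtain i j v v' where ij: "i \<le> r + 1" "j \<le> r + 1" "i \<noteq> j" and v: "v \<in> cone" "v' \<in> cone"
      and nb: "\<And>l. l \<le> r + 1 \<Longrightarrow> near \<beta> a ({..r + 1} - {l}) v"
        "\<And>l. l \<le> r + 1 \<Longrightarrow> near \<beta> a ({..r + 1} - {l}) v'"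
      and nc: "near \<gamma> a ({..r + 1} - {i, j}) v" "near \<gamma> a ({..r + 1} - {i, j}) v'"
      and nr: "\<not> rel (exp (2 * D)) v v'"
      by blast
    have sc: "near \<mu> a I (\<phi> (proj_pt z))" if "near \<mu> a I z" "z \<in> cone" for \<mu> I z
      using near_add[OF that(1,1), of "inverse (w \<bullet> z)" 0] w_pos_C[OF that(2)]
      by (simp add: proj_pt_cone(2)[OF that(2)])
    let ?v = "proj_pt v" and ?v' = "proj_pt v'"
    have p: "?v \<in> \<Omega>" "?v' \<in> \<Omega>"
      using proj_pt_cone(1) v by auto
    have "\<not> rel (exp (2 * D)) (\<phi> ?v) (\<phi> ?v')"
    proof
      assume "rel (exp (2 * D)) (\<phi> ?v) (\<phi> ?v')"
      then have "rel (exp (2 * D)) ((w \<bullet> v) *\<^sub>R \<phi> ?v) ((w \<bullet> v') *\<^sub>R \<phi> ?v')"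
        using w_pos_C v by (intro rel_scale) auto
      then show False
        using nr w_pos_C[OF v(1)] w_pos_C[OF v(2)] by (simp add: proj_pt_cone(2) v)
    qed
    then have "D < hilbert_dist \<Omega> ?v ?v'"
      using hilbert_dist_le_iff[OF p D] by simp
    moreover have "\<forall>l\<le>r + 1. \<forall>z\<in>{?v, ?v'}. \<exists>q\<in>hull_fill (nths as (- {l})). hilbert_dist \<Omega> z q \<le> s"
      using n1 p sc[OF nb(1) v(1)] sc[OF nb(2) v(2)] by blast
    moreover have "\<forall>z\<in>{?v, ?v'}. \<exists>q\<in>hull_fill (nths as (- {i, j})). hilbert_dist \<Omega> z q \<le> 2 * s + 1"
      using n2 p sc[OF nc(1) v(1)] sc[OF nc(2) v(2)] by blast
    ultimately show "\<exists>i j. \<exists>v\<in>\<Omega>. \<exists>v'\<in>\<Omega>. i \<le> r + 1 \<and> j \<le> r + 1 \<and> i \<noteq> j \<and>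
        (\<forall>l\<le>r + 1. \<forall>z\<in>{v, v'}. \<exists>q\<in>hull_fill (nths as (- {l})). hilbert_dist \<Omega> z q \<le> s) \<and>
        (\<forall>z\<in>{v, v'}. \<exists>q\<in>hull_fill (nths as (- {i, j})). hilbert_dist \<Omega> z q \<le> 2 * s + 1) \<and>
        D < hilbert_dist \<Omega> v v'"
      using ij p by blast
  qed
qed

text \<open>All facets together with one face of codimension two have no common vertex, so
  genericity bounds the part of the intersection of the facet neighbourhoods near such a face.\<close>

lemma generic_codim2:
  assumes gen: "coarse_generic \<Omega> (hilbert_dist \<Omega>) r (\<lambda>_. hull_fill) \<delta> D as"
    and as: "as \<in> tuples \<Omega> (r + 2)" and r: "1 \<le> r" and \<delta>: "0 < \<delta>" and D: "0 \<le> D"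
    and ij: "i \<le> r + 1" "j \<le> r + 1" "i \<noteq> j" and v: "v \<in> \<Omega>" "v' \<in> \<Omega>"
    and facets: "\<And>l z. l \<le> r + 1 \<Longrightarrow> z \<in> {v, v'} \<Longrightarrow>
      \<exists>q\<in>hull_fill (nths as (- {l})). hilbert_dist \<Omega> z q < \<delta>"
    and codim2: "\<And>z. z \<in> {v, v'} \<Longrightarrow> \<exists>q\<in>hull_fill (nths as (- {i, j})). hilbert_dist \<Omega> z q < \<delta>"
  shows "hilbert_dist \<Omega> v v' \<le> D"
proof (rule ccontr)
  assume far: "\<not> ?thesis"
  \<comment> \<open>The indices 1 to r + 2 stand for the facets, m omitting the vertex m - 1; the
    index r + 3 stands for the face of codimension two.\<close>
  define I where "I m = (if m \<le> r + 2 then {0..r + 1} - {m - 1} else {0..r + 1} - {i, j})" for m :: nat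
  have len: "length as = Suc (r + 1)"
    using as by (simp add: tuples_def)
  \<comment> \<open>Genericity asks for subsets of {0..r + 1}, while facets are written with
    complements in all natural numbers; on tuples of length r + 2 both give the same hull.\<close>
  have Ieq: "hull_fill (nths as ({0..r + 1} - J)) = hull_fill (nths as (- J))" for J
    unfolding hull_fill_nths[OF len] by (rule arg_cong[of _ _ "\<lambda>I. {p \<in> \<Omega>. \<phi> p \<in> convex hull (_ ` I)}"]) auto
  have card2: "card ({0..r + 1} - {i, j}) = r"
    using ij by (subst card_Diff_subset) auto
  have card1: "card ({0..r + 1} - {l}) = r + 1" if "l \<le> r + 1" for l
    using that by (subst card_Diff_subset) auto
  have "I m \<noteq> {} \<and> I m \<subset> {0..r + 1}" if "m \<in> {1..r + 3}" for m
  proof -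
    have "card (I m) \<in> {r, r + 1}"
      using card1[of "m - 1"] card2 by (auto simp: I_def)
    moreover have "I m \<subseteq> {0..r + 1}"
      by (auto simp: I_def)
    moreover have "card {0..r + 1} = r + 2"
      by simp
    \<comment> \<open>The face of codimension two has r vertices, so r \<ge> 1 makes it
      nonempty.\<close>
    ultimately show ?thesis
      using r by (intro conjI psubsetI notI) auto
  qed
  moreover have "(\<Inter>m\<in>{1..r + 3}. I m) = {}"
  proof -
    have "l \<notin> I (Suc l)" if "l \<le> r + 1" for l
      using that by (simp add: I_def)
    moreover have "l \<notin> I 1" if "\<not> l \<le> r + 1" for l
      using that by (auto simp: I_def)
    ultimately have "\<exists>m\<in>{1..r + 3}. l \<notin> I m" for l
      by (cases "l \<le> r + 1") (force intro: bexI[of _ "Suc l"] bexI[of _ 1])+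
    then show ?thesis
      by blast
  qed
  moreover have "ennreal D < diam (hilbert_dist \<Omega>)
      (\<Inter>m\<in>{1..r + 3}. nbhd \<Omega> (hilbert_dist \<Omega>) \<delta> (hull_fill (nths as (I m))))"
  proof -
    have "z \<in> nbhd \<Omega> (hilbert_dist \<Omega>) \<delta> (hull_fill (nths as (I m)))"
      if m: "m \<in> {1..r + 3}" and z: "z \<in> {v, v'}" for m z
    proof -
      have "\<exists>q\<in>hull_fill (nths as (I m)). hilbert_dist \<Omega> z q < \<delta>"
      proof (cases "m \<le> r + 2")
        case True
        have "hull_fill (nths as (I m)) = hull_fill (nths as (- {m - 1}))"
          using True Ieq[of "{m - 1}"] by (simp only: I_def if_True)
        then show ?thesis
          using facets[of "m - 1" z] z True by simp
      next
        case False
        have "hull_fill (nths as (I m)) = hull_fill (nths as (- {i, j}))"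
          using False Ieq[of "{i, j}"] by (simp only: I_def if_False)
        then show ?thesis
          using codim2[OF z] by simp
      qed
      then show ?thesis
        using z v by (auto simp: nbhd_pos[OF hilbert_nonneg \<delta>])
    qed
    then have "ennreal (hilbert_dist \<Omega> v v') \<le> diam (hilbert_dist \<Omega>)
      (\<Inter>m\<in>{1..r + 3}. nbhd \<Omega> (hilbert_dist \<Omega>) \<delta> (hull_fill (nths as (I m))))"
      unfolding diam_def by (intro SUP_upper2[of v] SUP_upper2[of v']) auto
    then show ?thesis
      using far D by (intro less_le_trans[OF ennreal_lessI]) auto
  qed
  ultimately have "\<forall>m\<in>{1..r + 3}. card (I m) = r + 1"
    using gen unfolding coarse_generic_def by (metis (no_types, lifting) le_add2 add.commute one_le_numeral trans_le_add2)
  then have "card (I (r + 3)) = r + 1"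
    by auto
  then show False
    using card2 by (simp add: I_def)
qed

section \<open>Choice of the constants and of the control function\<close>

lemma coarse_median_of_bounds:
  assumes r: "1 \<le> r" and b: "0 \<le> b"
    and center: "\<And>as. as \<in> tuples \<Omega> (r + 2) \<Longrightarrow> \<exists>p\<in>\<Omega>. \<forall>j\<le>r + 1.
      \<exists>q\<in>hull_fill (nths as (- {j})). hilbert_dist \<Omega> p q \<le> b"
    and far: "\<And>s D. 0 \<le> s \<Longrightarrow> 0 \<le> D \<Longrightarrow> \<exists>B. center_bound r s D B"
  shows "coarse_median_structure \<Omega> (hilbert_dist \<Omega>) r"
proof -
  \<comment> \<open>A natural number, so that rounding \<delta> \<ge>
    \<open>\<delta>\<^sub>0\<close> down to an integer stays at or above it. The size 2 b + 6
    ensures 2 s + 1 < m for s = lam (m + 1) and all such integers m.\<close>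
  define \<delta>\<^sub>0 where "\<delta>\<^sub>0 = real (nat \<lceil>2 * b + 6\<rceil>)"
  have \<delta>0: "2 * b + 6 \<le> \<delta>\<^sub>0"
    unfolding \<delta>\<^sub>0_def by linarith
  \<comment> \<open>The added 1 passes from distance at most b to the strict inequality in
    \<open>nbhd\<close>. With slope 1 / 4, doubling the distance leaves slope 1 / 2, still less than
    that of \<delta>.\<close>
  define lam where "lam \<delta> = 1 / 4 * (\<delta> - \<delta>\<^sub>0) + (b + 1)" for \<delta>
  have lam0: "lam \<delta>\<^sub>0 = b + 1"
    by (simp add: lam_def)
  \<comment> \<open>The thresholds come from a compactness argument that gives no monotonicity, so
    they are chosen at integer scales only. The maximum covers small m, where lam may be
    negative.\<close>
  define B where "B m l = (SOME B. center_bound r (max 0 (lam (real m + 1))) (real l) B)" for m l :: nat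
  have B: "center_bound r (max 0 (lam (real m + 1))) (real l) (B m l)" for m l
    unfolding B_def by (rule someI_ex[OF far]) auto
  \<comment> \<open>Summing nonnegative thresholds over all smaller integers gives a function that
    is monotone in both arguments and bounds each of its terms.\<close>
  define \<Psi> where "\<Psi> \<delta> D = (\<Sum>m\<le>nat \<lfloor>\<delta>\<rfloor>. \<Sum>l\<le>nat \<lceil>D\<rceil>. B m l)" for \<delta> D :: real
  have Bnn: "0 \<le> B m l" for m l
    using B[of m l] by (simp add: center_bound_def)
  have \<Psi>nn: "0 \<le> \<Psi> \<delta> D" for \<delta> D
    unfolding \<Psi>_def by (intro sum_nonneg Bnn)
  have \<Psi>D: "\<Psi> \<delta> D \<le> \<Psi> \<delta> D'" if "D \<le> D'" for \<delta> D D'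
  proof -
    have "{..nat \<lceil>D\<rceil>} \<subseteq> {..nat \<lceil>D'\<rceil>}"
      using nat_mono[OF ceiling_mono[OF that]] by simp
    then show ?thesis
      unfolding \<Psi>_def by (intro sum_mono sum_mono2 Bnn) auto
  qed
  have \<Psi>\<delta>: "\<Psi> \<delta> D \<le> \<Psi> \<delta>' D" if "\<delta> \<le> \<delta>'" for \<delta> \<delta>' D
  proof -
    have "{..nat \<lfloor>\<delta>\<rfloor>} \<subseteq> {..nat \<lfloor>\<delta>'\<rfloor>}"
      using nat_mono[OF floor_mono[OF that]] by simp
    then show ?thesis
      unfolding \<Psi>_def by (intro sum_mono2 sum_nonneg Bnn) auto
  qed
  have CM1: "(\<Inter>j\<in>{0..r + 1}. nbhd \<Omega> (hilbert_dist \<Omega>) (lam \<delta>\<^sub>0) (hull_fill (nths as (- {j})))) \<noteq> {}"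
    if as: "as \<in> tuples \<Omega> (r + 2)" for as
  proof -
    obtain p where p: "p \<in> \<Omega>" "\<And>j. j \<le> r + 1 \<Longrightarrow> \<exists>q\<in>hull_fill (nths as (- {j})). hilbert_dist \<Omega> p q \<le> b"
      using center[OF as] by blast
    have "p \<in> nbhd \<Omega> (hilbert_dist \<Omega>) (lam \<delta>\<^sub>0) (hull_fill (nths as (- {j})))" if j: "j \<in> {0..r + 1}" for j
    proof -
      have pos: "0 < lam \<delta>\<^sub>0"
        using lam0 b by simp
      obtain q where q: "q \<in> hull_fill (nths as (- {j}))" "hilbert_dist \<Omega> p q \<le> b"
        using p(2)[of j] j by auto
      then have "hilbert_dist \<Omega> p q < b + 1"
        by linarith
      then show ?thesis
        unfolding nbhd_pos[OF hilbert_nonneg pos] unfolding lam0 using p(1) q(1) by blast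
    qed
    then show ?thesis
      by blast
  qed
  have CM2: "diam (hilbert_dist \<Omega>)
      (\<Inter>j\<in>{0..r + 1}. nbhd \<Omega> (hilbert_dist \<Omega>) (lam \<delta>) (hull_fill (nths as (- {j})))) \<le> ennreal (\<Psi> \<delta> D)"
    if \<delta>: "\<delta>\<^sub>0 \<le> \<delta>" and D: "\<delta>\<^sub>0 \<le> D" and as: "as \<in> tuples \<Omega> (r + 2)"
      and gen: "coarse_generic \<Omega> (hilbert_dist \<Omega>) r (\<lambda>_. hull_fill) \<delta> D as" for \<delta> D as
  proof -
    \<comment> \<open>\<delta> is rounded down to m, while s is taken at m + 1 to stay above lam
      \<delta>; still 2 s + 1 < m \<le> \<delta>. D is rounded up to l, so points farther apart than
      l contradict genericity.\<close>
    define m where "m = nat \<lfloor>\<delta>\<rfloor>"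
    define l where "l = nat \<lceil>D\<rceil>"
    define s where "s = lam (real m + 1)"
    have "nat \<lceil>2 * b + 6\<rceil> \<le> m"
      unfolding m_def by (rule le_nat_floor) (use \<delta> in \<open>simp add: \<delta>\<^sub>0_def\<close>)
    then have m: "real m \<le> \<delta>" "\<delta> < real m + 1" "\<delta>\<^sub>0 \<le> real m"
      using \<delta> \<delta>0 b unfolding m_def \<delta>\<^sub>0_def by linarith+
    have l: "D \<le> real l" "0 \<le> D"
      using D \<delta>0 b unfolding l_def by linarith+
    have s: "0 < lam \<delta>" "lam \<delta> < s" "2 * s + 1 < real m"
      using m \<delta> \<delta>0 b by (auto simp: s_def lam_def field_simps)
    have mx: "max 0 (lam (real m + 1)) = s"
      using s by (simp add: s_def)
    have \<delta>p: "0 < \<delta>"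
      using \<delta> \<delta>0 b by linarith
    have bounded: "hilbert_dist \<Omega> x y \<le> B m l"
      if xy: "\<And>j. j \<le> r + 1 \<Longrightarrow> x \<in> nbhd \<Omega> (hilbert_dist \<Omega>) (lam \<delta>) (hull_fill (nths as (- {j})))"
        "\<And>j. j \<le> r + 1 \<Longrightarrow> y \<in> nbhd \<Omega> (hilbert_dist \<Omega>) (lam \<delta>) (hull_fill (nths as (- {j})))" for x y
    proof (rule ccontr)
      assume "\<not> hilbert_dist \<Omega> x y \<le> B m l"
      then have far_xy: "B m l < hilbert_dist \<Omega> x y"
        by simp
      have xy\<Omega>: "x \<in> \<Omega>" "y \<in> \<Omega>"
        using xy[of 0] by (auto simp: nbhd_pos[OF hilbert_nonneg s(1)])
      have near_xy: "\<forall>j\<le>r + 1. \<forall>z\<in>{x, y}. \<exists>q\<in>hull_fill (nths as (- {j})). hilbert_dist \<Omega> z q \<le> s"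
      proof (intro allI impI ballI)
        fix j z assume "j \<le> r + 1" "z \<in> {x, y}"
        then have "z \<in> nbhd \<Omega> (hilbert_dist \<Omega>) (lam \<delta>) (hull_fill (nths as (- {j})))"
          using xy by blast
        then obtain q where "q \<in> hull_fill (nths as (- {j}))" "hilbert_dist \<Omega> z q < lam \<delta>"
          unfolding nbhd_pos[OF hilbert_nonneg s(1)] by blast
        then show "\<exists>q\<in>hull_fill (nths as (- {j})). hilbert_dist \<Omega> z q \<le> s"
          using s(2) by (intro bexI[of _ q]) auto
      qed
      have "center_bound r s (real l) (B m l)"
        using B[of m l] by (simp only: mx)
      from this[unfolded center_bound_def, THEN conjunct2, THEN bspec, OF as, THEN bspec, OF xy\<Omega>(1),
          THEN bspec, OF xy\<Omega>(2), THEN mp, OF near_xy, THEN mp, OF far_xy]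
      obtain i j v v' where ij: "i \<le> r + 1" "j \<le> r + 1" "i \<noteq> j" and v: "v \<in> \<Omega>" "v' \<in> \<Omega>"
        and f: "\<forall>l\<le>r + 1. \<forall>z\<in>{v, v'}. \<exists>q\<in>hull_fill (nths as (- {l})). hilbert_dist \<Omega> z q \<le> s"
        and c: "\<forall>z\<in>{v, v'}. \<exists>q\<in>hull_fill (nths as (- {i, j})). hilbert_dist \<Omega> z q \<le> 2 * s + 1"
        and d: "real l < hilbert_dist \<Omega> v v'"
        by blast
      have "hilbert_dist \<Omega> v v' \<le> D"
      proof (rule generic_codim2[OF gen as r \<delta>p l(2) ij v])
        have "s < \<delta>" "2 * s + 1 < \<delta>"
          using s m by linarith+
        then show "\<exists>q\<in>hull_fill (nths as (- {l})). hilbert_dist \<Omega> z q < \<delta>" if "l \<le> r + 1" "z \<in> {v, v'}" for l z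
          using f that by (meson order_le_less_trans)
        show "\<exists>q\<in>hull_fill (nths as (- {i, j})). hilbert_dist \<Omega> z q < \<delta>" if "z \<in> {v, v'}" for z
          using c that \<open>2 * s + 1 < \<delta>\<close> by (meson order_le_less_trans)
      qed
      then show False
        using d l by linarith
    qed
    have B\<Psi>: "B m l \<le> \<Psi> \<delta> D"
    proof -
      have "B m l \<le> (\<Sum>l\<le>nat \<lceil>D\<rceil>. B m l)"
        by (rule member_le_sum) (auto simp: l_def Bnn)
      also have "\<dots> \<le> \<Psi> \<delta> D"
        unfolding \<Psi>_def by (rule member_le_sum[of m _ "\<lambda>m. \<Sum>l\<le>nat \<lceil>D\<rceil>. B m l"])
          (auto simp: m_def Bnn intro!: sum_nonneg)
      finally show ?thesis .
    qed
    show ?thesis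
      unfolding diam_def
    proof (intro SUP_least ennreal_leI)
      fix x y
      assume "x \<in> (\<Inter>j\<in>{0..r + 1}. nbhd \<Omega> (hilbert_dist \<Omega>) (lam \<delta>) (hull_fill (nths as (- {j}))))"
        and "y \<in> (\<Inter>j\<in>{0..r + 1}. nbhd \<Omega> (hilbert_dist \<Omega>) (lam \<delta>) (hull_fill (nths as (- {j}))))"
      then have "hilbert_dist \<Omega> x y \<le> B m l"
        by (intro bounded; simp)
      with B\<Psi> show "hilbert_dist \<Omega> x y \<le> \<Psi> \<delta> D"
        by linarith
    qed
  qed
  show ?thesis
    unfolding coarse_median_structure_def
  proof (rule conjI, rule hilbert_metric, rule conjI, rule r, rule exI[of _ "\<lambda>_. hull_fill"],
      rule exI[of _ "\<lambda>R. R"], rule exI[of _ \<delta>\<^sub>0], rule exI[of _ "1 / 4"], rule exI[of _ "b + 1"],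
      rule exI[of _ lam], rule exI[of _ \<Psi>], intro conjI)
    show "lam = (\<lambda>\<delta>. 1 / 4 * (\<delta> - \<delta>\<^sub>0) + (b + 1))"
      by (simp add: lam_def[abs_def])
  qed (use hull_fill_filling b \<delta>0 \<Psi>nn \<Psi>D \<Psi>\<delta> CM1 CM2 in \<open>auto simp: mono_on_def\<close>)
qed

end

theorem theorem1p10:
  fixes \<Omega> :: "'n::finite rproj set" and r :: nat
  assumes "properly_convex_domain \<Omega>"
    and "quasi_homogeneous \<Omega>"
    and "enat r \<ge> r_PES \<Omega>"
  shows "coarse_median_structure \<Omega> (hilbert_dist \<Omega>) r"
proof -
  define w where "w = (SOME w. convex_chart \<Omega> w)"
  have "\<exists>w. convex_chart \<Omega> w"
    using assms(1) by (simp add: properly_convex_domain_def)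
  then have w: "convex_chart \<Omega> w"
    unfolding w_def by (rule someI_ex)
  interpret projective_domain \<Omega> w
  proof
    show "some_chart \<Omega> = chart w"
      by (simp add: some_chart_def w_def)
  qed (use assms(1) w in \<open>auto simp: properly_convex_domain_def\<close>)
  obtain K where "compact K" "K \<subseteq> \<Omega>" "(\<Union>g\<in>Aut \<Omega>. g ` K) = \<Omega>"
    using assms(2) unfolding quasi_homogeneous_def by blast
  then have cc: "cocompact_cone cone w cbound (\<phi> ` K)"
    by (rule cocompact_chart)
  have "enat 1 \<le> enat r"
    using r_PES_ge_1 assms(1,3) order_trans unfolding properly_convex_domain_def by blast
  then have r: "1 \<le> r"
    by simp
  obtain b where b: "0 \<le> b" "\<forall>as\<in>tuples \<Omega> (r + 2). \<exists>p\<in>\<Omega>. \<forall>j\<le>r + 1.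
      \<exists>q\<in>hull_fill (nths as (- {j})). hilbert_dist \<Omega> p q \<le> b"
    using center_exists[OF cc r assms(3)] by blast
  show ?thesis
    by (rule coarse_median_of_bounds[OF r b(1) bspec[OF b(2)] far_centers[OF cc]])
qed

end
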